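(* Let $G$ be a finite group, let $\omega\in Z^3(G,\mathbb{T})$, and let $(n_k)_{k\in\mathbb{N}}$ be a sequence of positive integers. Suppose there is an $\omega$-anomalous action of $G$ on the UHF algebra $\bigotimes_{k\in\mathbb{N}} M_{n_k}(\mathbb{C})$. Let $r$ be the order of $[\omega]$ in $H^3(G,\mathbb{T})$. Then $r^\infty$ divides the supernatural number $\prod_{k\in\mathbb{N}} n_k$.
   Context: $\mathbb{T}$ is the unit circle in $\mathbb{C}$, regarded as a $G$-module with trivial action. A $3$-cocycle $\omega \in Z^3(G,\mathbb{T})$ is a function $\omega:G^3\to\mathbb{T}$ with $\omega(h,k,l)\,\omega(gh,k,l)^{-1}\omega(g,hk,l)\,\omega(g,h,kl)^{-1}\omega(g,h,k)=1$ for all $g,h,k,l\in G$; $H^3(G,\mathbb{T})$ is the usual group cohomology and $[\omega]$ is the class of $\omega$. Anomalous actions: for $\omega\in Z^3(G,\mathbb{T})$, an $\omega$-anomalous action of $G$ on a unital C*-algebra $A$ consists of an automorphism $\theta_g\in\mathrm{Aut}(A)$ for every $g\in G$ and unitaries $u_{g,h}\in U(A)$ for $g,h\in G$ such that (1) $\theta_{gh}=\mathrm{Ad}(u_{g,h})\theta_g\theta_h$ for all $g,h\in G$, and (2) $\omega(g,h,k)\,u_{gh,k}u_{g,h}=u_{g,hk}\,\theta_g(u_{h,k})$ for all $g,h,k\in G$. Here $\mathrm{Ad}(u)(a)=uau^*$. Tensor products are C*-algebraic infinite tensor products. The supernatural number $\mathfrak{n}=\prod_{k} n_k$ is the formal product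 of primes $p$ with exponents in $\{0,1,2,\dots,\infty\}$ obtained by adding exponents. A positive integer $m$ divides $\mathfrak{n}$ if $m$ divides $n_1n_2\cdots n_K$ for some $K$; $r^\infty$ divides $\mathfrak{n}$ if $r^m$ divides $\mathfrak{n}$ for every $m\in\mathbb{N}$. *)

theory Defs
  imports
    "HOL-Analysis.Analysis"
    "HOL-Algebra.Product_Groups"
    "HOL-Algebra.Multiplicative_Group"
    "Jordan_Normal_Form.Schur_Decomposition"
begin

section \<open>Unital C*-algebras\<close>

text \<open>
  Nonzero unital C*-algebras; the real structure inherited from \<^class>\<open>banach\<close> is the
  restriction of the complex one.
\<close>

class cstar_algebra = real_normed_algebra_1 + banach +
  fixes scaleC :: "complex \<Rightarrow> 'a \<Rightarrow> 'a" (infixr \<open>*\<^sub>C\<close> 75)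
    and adj :: "'a \<Rightarrow> 'a"
  assumes scaleC_add_right: "c *\<^sub>C (x + y) = c *\<^sub>C x + c *\<^sub>C y"
    and scaleC_add_left: "(c + d) *\<^sub>C x = c *\<^sub>C x + d *\<^sub>C x"
    and scaleC_scaleC: "c *\<^sub>C d *\<^sub>C x = (c * d) *\<^sub>C x"
    and scaleR_scaleC: "r *\<^sub>R x = complex_of_real r *\<^sub>C x"
    and mult_scaleC_left: "c *\<^sub>C x * y = c *\<^sub>C (x * y)"
    and mult_scaleC_right: "x * c *\<^sub>C y = c *\<^sub>C (x * y)"
    and norm_scaleC: "norm (c *\<^sub>C x) = cmod c * norm x"
    and adj_adj: "adj (adj x) = x"
    and adj_add: "adj (x + y) = adj x + adj y"
    and adj_mult: "adj (x * y) = adj y * adj x"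
    and adj_scaleC: "adj (c *\<^sub>C x) = cnj c *\<^sub>C adj x"
    and cstar_identity: "norm (adj x * x) = (norm x)\<^sup>2"

text \<open>
  The algebras under consideration are norm-closed unital *-subalgebras of an arbitrary ambient
  C*-algebra type. The whole type is allowed. A carrier set is used because a single HOL type
  can then accommodate all UHF algebras at once (they all embed unitally into the bounded
  operators on a separable Hilbert space), while a family of types depending on the sequence
  of matrix sizes is not expressible.
\<close>

definition unital_cstar_subalgebra :: "'a::cstar_algebra set \<Rightarrow> bool" where
  "unital_cstar_subalgebra A \<longleftrightarrow>
     closed A \<and> 1 \<in> A \<and>
     (\<forall>x\<in>A. \<forall>y\<in>A. x + y \<in> A \<and> x * y \<in> A) \<and>
     (\<forall>c. \<forall>x\<in>A. c *\<^sub>C x \<in> A) \<and>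
     (\<forall>x\<in>A. adj x \<in> A)"

definition unitary_elements :: "'a::cstar_algebra set \<Rightarrow> 'a set" where
  "unitary_elements A = {u \<in> A. adj u * u = 1 \<and> u * adj u = 1}"

definition star_automorphisms :: "'a::cstar_algebra set \<Rightarrow> ('a \<Rightarrow> 'a) set" where
  "star_automorphisms A =
     {f. bij_betw f A A \<and>
         (\<forall>x\<in>A. \<forall>y\<in>A. f (x + y) = f x + f y \<and> f (x * y) = f x * f y) \<and>
         (\<forall>c. \<forall>x\<in>A. f (c *\<^sub>C x) = c *\<^sub>C f x) \<and>
         (\<forall>x\<in>A. f (adj x) = adj (f x))}"

definition Ad :: "'a::cstar_algebra \<Rightarrow> 'a \<Rightarrow> 'a" where
  "Ad u a = u * a * adj u"

section \<open>UHF algebras\<close>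

definition kronecker :: "complex mat \<Rightarrow> complex mat \<Rightarrow> complex mat" where
  "kronecker X Y = mat (dim_row X * dim_row Y) (dim_col X * dim_col Y)
     (\<lambda>(i, j). X $$ (i div dim_row Y, j div dim_col Y) * Y $$ (i mod dim_row Y, j mod dim_col Y))"

definition unital_star_embedding ::
    "nat \<Rightarrow> 'a::cstar_algebra set \<Rightarrow> (complex mat \<Rightarrow> 'a) \<Rightarrow> bool" where
  "unital_star_embedding N A \<phi> \<longleftrightarrow>
     \<phi> ` carrier_mat N N \<subseteq> A \<and> inj_on \<phi> (carrier_mat N N) \<and> \<phi> (1\<^sub>m N) = 1 \<and>
     (\<forall>X\<in>carrier_mat N N. \<forall>Y\<in>carrier_mat N N.
        \<phi> (X + Y) = \<phi> X + \<phi> Y \<and> \<phi> (X * Y) = \<phi> X * \<phi> Y) \<and>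
     (\<forall>c. \<forall>X\<in>carrier_mat N N. \<phi> (c \<cdot>\<^sub>m X) = c *\<^sub>C \<phi> X) \<and>
     (\<forall>X\<in>carrier_mat N N. \<phi> (mat_adjoint X) = adj (\<phi> X))"

text \<open>
  \<open>A\<close> is the infinite C*-tensor product of the matrix algebras of sizes \<open>n 0\<close>, \<open>n 1\<close>, \<dots>, i.e. the
  C*-inductive limit of the finite tensor products, with connecting maps \<open>X \<mapsto> X \<otimes> 1\<close>. The tensor
  product of the first \<open>K\<close> factors is identified with the matrices of size \<open>\<Prod>k<K. n k\<close> by means of
  the Kronecker product. This determines \<open>A\<close> up to *-isomorphism, because injective
  *-homomorphisms of C*-algebras are isometric.
\<close>

definition infinite_matrix_tensor_product ::
    "(nat \<Rightarrow> nat) \<Rightarrow> 'a::cstar_algebra set \<Rightarrow> bool" where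
  "infinite_matrix_tensor_product n A \<longleftrightarrow>
     unital_cstar_subalgebra A \<and>
     (\<exists>\<phi> :: nat \<Rightarrow> complex mat \<Rightarrow> 'a.
        (\<forall>K. unital_star_embedding (\<Prod>k<K. n k) A (\<phi> K)) \<and>
        (\<forall>K. \<forall>X\<in>carrier_mat (\<Prod>k<K. n k) (\<Prod>k<K. n k).
           \<phi> (Suc K) (kronecker X (1\<^sub>m (n K))) = \<phi> K X) \<and>
        closure (\<Union>K. \<phi> K ` carrier_mat (\<Prod>k<K. n k) (\<Prod>k<K. n k)) = A)"

text \<open>Divisibility of the supernatural number \<open>\<Prod>k. n k\<close> by a positive integer.\<close>

definition dvd_supernatural :: "nat \<Rightarrow> (nat \<Rightarrow> nat) \<Rightarrow> bool" where
  "dvd_supernatural m n \<longleftrightarrow> (\<exists>K. m dvd (\<Prod>k<K. n k))"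

section \<open>Third cohomology with coefficients in the circle (trivial action)\<close>

definition circle_group :: "complex monoid" where
  "circle_group = \<lparr>carrier = sphere 0 1, monoid.mult = (*), one = 1\<rparr>"

text \<open>
  Cochains are extensional functions (equal to \<^const>\<open>undefined\<close> off the carrier of the group), so
  that they are determined by their values on the group.
\<close>

definition cochains2 :: "('g, 'm) monoid_scheme \<Rightarrow> ('g \<times> 'g \<Rightarrow> complex) monoid" where
  "cochains2 G = product_group (carrier G \<times> carrier G) (\<lambda>_. circle_group)"

definition cochains3 :: "('g, 'm) monoid_scheme \<Rightarrow> ('g \<times> 'g \<times> 'g \<Rightarrow> complex) monoid" where
  "cochains3 G = product_group (carrier G \<times> carrier G \<times> carrier G) (\<lambda>_. circle_group)"

definition coboundary2 ::
    "('g, 'm) monoid_scheme \<Rightarrow> ('g \<times> 'g \<Rightarrow> complex) \<Rightarrow> 'g \<times> 'g \<times> 'g \<Rightarrow> complex" where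
  "coboundary2 G \<beta> = (\<lambda>(g, h, k) \<in> carrier G \<times> carrier G \<times> carrier G.
     \<beta> (h, k) * inverse (\<beta> (g \<otimes>\<^bsub>G\<^esub> h, k)) * \<beta> (g, h \<otimes>\<^bsub>G\<^esub> k) * inverse (\<beta> (g, h)))"

definition cocycles3 :: "('g, 'm) monoid_scheme \<Rightarrow> ('g \<times> 'g \<times> 'g \<Rightarrow> complex) set" where
  "cocycles3 G = {\<omega> \<in> carrier (cochains3 G).
     \<forall>g\<in>carrier G. \<forall>h\<in>carrier G. \<forall>k\<in>carrier G. \<forall>l\<in>carrier G.
       \<omega> (h, k, l) * inverse (\<omega> (g \<otimes>\<^bsub>G\<^esub> h, k, l)) * \<omega> (g, h \<otimes>\<^bsub>G\<^esub> k, l)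
         * inverse (\<omega> (g, h, k \<otimes>\<^bsub>G\<^esub> l)) * \<omega> (g, h, k) = 1}"

definition coboundaries3 :: "('g, 'm) monoid_scheme \<Rightarrow> ('g \<times> 'g \<times> 'g \<Rightarrow> complex) set" where
  "coboundaries3 G = coboundary2 G ` carrier (cochains2 G)"

definition Z3 :: "('g, 'm) monoid_scheme \<Rightarrow> ('g \<times> 'g \<times> 'g \<Rightarrow> complex) monoid" where
  "Z3 G = (cochains3 G)\<lparr>carrier := cocycles3 G\<rparr>"

definition H3 :: "('g, 'm) monoid_scheme \<Rightarrow> ('g \<times> 'g \<times> 'g \<Rightarrow> complex) set monoid" where
  "H3 G = Z3 G Mod coboundaries3 G"

definition cohomology_class3 ::
    "('g, 'm) monoid_scheme \<Rightarrow> ('g \<times> 'g \<times> 'g \<Rightarrow> complex) \<Rightarrow> ('g \<times> 'g \<times> 'g \<Rightarrow> complex) set" where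
  "cohomology_class3 G \<omega> = coboundaries3 G #>\<^bsub>Z3 G\<^esub> \<omega>"

text \<open>The quotient is a group, so \<^const>\<open>group.ord\<close> is meaningful for it.\<close>

lemma comm_group_circle_group: "comm_group circle_group"
proof (rule comm_groupI)
  fix x assume x: "x \<in> carrier circle_group"
  then have "inverse x \<in> carrier circle_group" "inverse x * x = 1"
    by (auto simp: circle_group_def norm_inverse intro!: left_inverse)
  then show "\<exists>y\<in>carrier circle_group. y \<otimes>\<^bsub>circle_group\<^esub> x = \<one>\<^bsub>circle_group\<^esub>"
    by (auto simp: circle_group_def)
qed (auto simp: circle_group_def norm_mult)

lemma comm_group_cochains3: "comm_group (cochains3 G)"
proof (rule group.group_comm_groupI)
  show "group (cochains3 G)"
    using comm_group.axioms(2)[OF comm_group_circle_group] by (simp add: cochains3_def)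
qed (simp add: cochains3_def circle_group_def mult.commute)

lemma inv_circle_group: "x \<in> carrier circle_group \<Longrightarrow> inv\<^bsub>circle_group\<^esub> x = inverse x"
  using comm_group.axioms(2)[OF comm_group_circle_group]
  by (intro group.inv_equality) (auto simp: circle_group_def norm_inverse intro!: left_inverse)

lemma coboundary2_in_cocycles3:
  assumes "group G" "\<beta> \<in> carrier (cochains2 G)"
  shows "coboundary2 G \<beta> \<in> cocycles3 G"
proof -
  interpret group G by fact
  have n: "cmod (\<beta> (g, h)) = 1" if "g \<in> carrier G" "h \<in> carrier G" for g h
    using assms(2) that by (auto simp: cochains2_def circle_group_def PiE_iff)
  then have nz: "\<beta> (g, h) \<noteq> 0" if "g \<in> carrier G" "h \<in> carrier G" for g h
    using that by force
  show ?thesis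
    unfolding cocycles3_def cochains3_def coboundary2_def
    by (auto simp: circle_group_def norm_mult norm_inverse n m_assoc) (auto simp: nz field_simps)
qed

lemma subgroup_cocycles3:
  assumes "group G" shows "subgroup (cocycles3 G) (cochains3 G)"
proof -
  interpret group G by fact
  interpret C: comm_group "cochains3 G" by (rule comm_group_cochains3)
  have cg: "group circle_group" using comm_group_circle_group comm_group.axioms(2) by blast
  show ?thesis
  proof
    show "cocycles3 G \<subseteq> carrier (cochains3 G)" by (auto simp: cocycles3_def)
    show "\<one>\<^bsub>cochains3 G\<^esub> \<in> cocycles3 G"
      using C.one_closed by (auto simp: cocycles3_def cochains3_def circle_group_def)
  next
    fix x y assume x: "x \<in> cocycles3 G" and y: "y \<in> cocycles3 G"
    have c: "x \<otimes>\<^bsub>cochains3 G\<^esub> y \<in> carrier (cochains3 G)"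
      using x y by (auto simp: cocycles3_def)
    have e: "(x \<otimes>\<^bsub>cochains3 G\<^esub> y) (g,h,k) = x (g,h,k) * y (g,h,k)"
      if "g \<in> carrier G" "h \<in> carrier G" "k \<in> carrier G" for g h k
      using that by (simp add: cochains3_def product_group_def circle_group_def)
    have 1: "a * b * inverse (a1 * b1) * (a2 * b2) * inverse (a3 * b3) * (a4 * b4) =
          (a * inverse a1 * a2 * inverse a3 * a4) * (b * inverse b1 * b2 * inverse b3 * b4)"
      for a b a1 b1 a2 b2 a3 b3 a4 b4 :: complex by (simp add: inverse_mult_distrib mult_ac)
    show "x \<otimes>\<^bsub>cochains3 G\<^esub> y \<in> cocycles3 G"
      using x y c unfolding cocycles3_def by (simp add: e 1 del: inverse_mult_distrib)
  next
    fix x assume x: "x \<in> cocycles3 G"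
    then have c: "inv\<^bsub>cochains3 G\<^esub> x \<in> carrier (cochains3 G)"
      by (auto simp: cocycles3_def)
    have xc: "x \<in> (\<Pi>\<^sub>E i\<in>carrier G \<times> carrier G \<times> carrier G. carrier circle_group)"
      using x by (simp add: cocycles3_def cochains3_def)
    have e: "(inv\<^bsub>cochains3 G\<^esub> x) (g,h,k) = inverse (x (g,h,k))"
      if "g \<in> carrier G" "h \<in> carrier G" "k \<in> carrier G" for g h k
      unfolding cochains3_def inv_product_group[OF xc cg]
      using that PiE_mem[OF xc, of "(g,h,k)"] by (simp add: inv_circle_group)
    have 1: "inverse a * inverse (inverse a1) * inverse a2 * inverse (inverse a3) * inverse a4 =
          inverse (a * inverse a1 * a2 * inverse a3 * a4)"
      for a a1 a2 a3 a4 :: complex by (simp add: inverse_mult_distrib mult_ac)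
    show "inv\<^bsub>cochains3 G\<^esub> x \<in> cocycles3 G"
      using x c unfolding cocycles3_def by (simp add: e 1 del: inverse_inverse_eq)
  qed
qed

lemma comm_group_Z3: "group G \<Longrightarrow> comm_group (Z3 G)"
  unfolding Z3_def
  by (intro group.group_comm_groupI subgroup.subgroup_is_group subgroup_cocycles3
      comm_group.axioms(2)[OF comm_group_cochains3])
    (auto simp: cocycles3_def cochains3_def circle_group_def mult.commute)

lemma coboundary2_hom:
  assumes "group G" shows "coboundary2 G \<in> hom (cochains2 G) (Z3 G)"
proof (rule homI)
  interpret group G by fact
  fix x y
  show "coboundary2 G (x \<otimes>\<^bsub>cochains2 G\<^esub> y) = coboundary2 G x \<otimes>\<^bsub>Z3 G\<^esub> coboundary2 G y"
    by (auto simp: coboundary2_def Z3_def cochains2_def cochains3_def product_group_def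
        circle_group_def fun_eq_iff inverse_mult_distrib mult_ac)
qed (use coboundary2_in_cocycles3[OF assms] in \<open>auto simp: Z3_def\<close>)

lemma comm_group_H3:
  assumes "group G" shows "comm_group (H3 G)"
proof -
  interpret Z: comm_group "Z3 G" by (rule comm_group_Z3[OF assms])
  have "group (cochains2 G)" unfolding cochains2_def
    using comm_group.axioms(2)[OF comm_group_circle_group] by simp
  then have "group_hom (cochains2 G) (Z3 G) (coboundary2 G)"
    using coboundary2_hom[OF assms] Z.group_axioms
    by (simp add: group_hom_def group_hom_axioms_def)
  then have "subgroup (coboundaries3 G) (Z3 G)"
    unfolding coboundaries3_def by (rule group_hom.img_is_subgroup)
  then show ?thesis unfolding H3_def by (rule Z.abelian_FactGroup)
qed

section \<open>Anomalous actions\<close>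

definition anomalous_action ::
    "('g, 'm) monoid_scheme \<Rightarrow> ('g \<times> 'g \<times> 'g \<Rightarrow> complex) \<Rightarrow> 'a::cstar_algebra set \<Rightarrow>
     ('g \<Rightarrow> 'a \<Rightarrow> 'a) \<Rightarrow> ('g \<Rightarrow> 'g \<Rightarrow> 'a) \<Rightarrow> bool" where
  "anomalous_action G \<omega> A \<theta> u \<longleftrightarrow>
     (\<forall>g\<in>carrier G. \<theta> g \<in> star_automorphisms A) \<and>
     (\<forall>g\<in>carrier G. \<forall>h\<in>carrier G. u g h \<in> unitary_elements A) \<and>
     (\<forall>g\<in>carrier G. \<forall>h\<in>carrier G. \<forall>a\<in>A. \<theta> (g \<otimes>\<^bsub>G\<^esub> h) a = Ad (u g h) (\<theta> g (\<theta> h a))) \<and>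
     (\<forall>g\<in>carrier G. \<forall>h\<in>carrier G. \<forall>k\<in>carrier G.
        \<omega> (g, h, k) *\<^sub>C (u (g \<otimes>\<^bsub>G\<^esub> h) k * u g h) = u g (h \<otimes>\<^bsub>G\<^esub> k) * \<theta> g (u h k))"

end

theory Submission
  imports Defs
begin

text \<open>
  The normalized trace \<open>tau\<close> on \<open>A\<close> yields a determinant of de la Harpe and Skandalis: near 1 it is
  \<open>exp (tau (log c))\<close>, on a matrix algebra of size \<open>N\<close> it is the \<open>N\<close>-th root of the determinant, and it is
  well defined up to roots of unity whose orders divide some \<open>\<Prod>k<K. n k\<close>. It is multiplicative, and
  invariant under automorphisms because \<open>tau\<close> is the only trace. Applied to the relation between the
  unitaries of an anomalous action, it writes \<open>\<omega>\<close> as a coboundary up to such roots of unity.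

  To remove the first \<open>K0\<close> tensor factors, the action is first cut down to the corner of a minimal
  projection of their tensor product, which every automorphism preserves up to conjugacy. So for every \<open>K0\<close> the
  order of \<open>[\<omega>]\<close> divides some \<open>\<Prod>k=K0..<K. n k\<close>, and consecutive blocks give all powers of it. Invertible
  elements are used instead of unitaries throughout.
\<close>

section \<open>C*-algebra preliminaries\<close>

text \<open>The delicate term is \<open>\<theta> g (u h k)\<close>: an automorphism need not respect
  the matrix algebras, so its determinant cannot be compared with that of \<open>u h k\<close>
  through matrix approximations. Invertible elements are therefore also written as products of
  elements so close to 1 that their images stay where the logarithm is a power series under the
  trace; there invariance follows from uniqueness of the trace. One application of the determinant
  only shows that the order of the class divides one finite product, and repeating it on the same
  algebra gives no higher power; this forces the passage to corners of trace
  \<open>1 / msize K0\<close>. The corner never becomes an algebra of its own: \<open>x\<close> in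
  it is represented by \<open>x * e + (1 - e)\<close>, so the same tower and determinant serve, and
  the scalar given by \<open>\<omega>\<close> enters with the normalized determinant of a rank one
  perturbation of 1. The elements conjugating \<open>\<theta> g e\<close> to \<open>e\<close> come
  from similarity of idempotents and are merely invertible. The perturbed automorphisms may then
  fail to preserve adjoints and norms; only a norm bound survives, and the fineness of the products
  is chosen from it.\<close>

lemma scaleC_one: "1 *\<^sub>C x = (x::'a::cstar_algebra)"
  using scaleR_scaleC[of 1 x] by simp

lemma scaleC_zero_left: "0 *\<^sub>C x = (0::'a::cstar_algebra)"
  using scaleR_scaleC[of 0 x] by simp

lemma scaleC_minus_one: "(-1) *\<^sub>C x = - (x::'a::cstar_algebra)"
  using scaleR_scaleC[of "-1" x] by simp

lemma scaleC_minus_left: "(-c) *\<^sub>C x = - (c *\<^sub>C (x::'a::cstar_algebra))"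
  using scaleC_scaleC[of "-1" c x] by (simp add: scaleC_minus_one)

lemma scaleC_diff_left: "(c - d) *\<^sub>C x = c *\<^sub>C x - d *\<^sub>C (x::'a::cstar_algebra)"
  using scaleC_add_left[of c "-d" x] by (simp add: scaleC_minus_left)

lemma scaleC_diff_right: "c *\<^sub>C (x - y) = c *\<^sub>C x - c *\<^sub>C (y::'a::cstar_algebra)"
  using scaleC_add_right[of c "x - y" y] by (simp add: algebra_simps)

lemma bounded_linear_scaleC_left: "bounded_linear (\<lambda>c. c *\<^sub>C (x::'a::cstar_algebra))"
  by (rule bounded_linear_intro[of _ "norm x"])
    (simp_all add: scaleC_add_left scaleR_scaleC scaleC_scaleC norm_scaleC scaleR_conv_of_real)

lemma bounded_linear_scaleC_right: "bounded_linear (\<lambda>x. c *\<^sub>C (x::'a::cstar_algebra))"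
  by (rule bounded_linear_intro[of _ "cmod c"])
    (simp_all add: scaleC_add_right scaleR_scaleC scaleC_scaleC norm_scaleC mult.commute)

lemma adj_minus: "adj (- x) = - adj (x::'a::cstar_algebra)"
  using adj_scaleC[of "-1" x] by (simp add: scaleC_minus_one)

lemma adj_diff: "adj (x - y) = adj x - adj (y::'a::cstar_algebra)"
  using adj_add[of x "-y"] by (simp add: adj_minus)

lemma adj_one: "adj 1 = (1::'a::cstar_algebra)"
  using adj_mult[of 1 "adj (1::'a)"] by (simp add: adj_adj)

lemma norm_adj: "norm (adj x) = norm (x::'a::cstar_algebra)"
proof -
  have *: "norm x \<le> norm (adj x)" for x :: 'a
  proof (cases "x = 0")
    case False
    have "norm x * norm x \<le> norm (adj x) * norm x"
      using norm_mult_ineq[of "adj x" x] by (simp add: cstar_identity power2_eq_square)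
    with False show ?thesis by simp
  qed simp
  show ?thesis using *[of x] *[of "adj x"] by (simp add: adj_adj)
qed

lemma bounded_linear_adj: "bounded_linear (adj :: 'a::cstar_algebra \<Rightarrow> 'a)"
  by (rule bounded_linear_intro[of _ 1]) (simp_all add: adj_add scaleR_scaleC adj_scaleC norm_adj)

lemma norm_unitary: "adj u * u = 1 \<Longrightarrow> norm (u::'a::cstar_algebra) = 1"
  using cstar_identity[of u] by (simp add: power2_eq_1_iff) (use norm_ge_zero[of u] in linarith)

text \<open>Covers both \<open>A\<close> and the images of the matrix algebras, so that inverses and
  square roots near 1 can be taken inside either.\<close>

definition closed_subalgebra :: "'a::cstar_algebra set \<Rightarrow> bool" where
  "closed_subalgebra B \<longleftrightarrow> closed B \<and> 1 \<in> B \<and>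
     (\<forall>x\<in>B. \<forall>y\<in>B. x + y \<in> B \<and> x * y \<in> B) \<and> (\<forall>c. \<forall>x\<in>B. c *\<^sub>C x \<in> B)"

lemma unital_cstar_imp_closed_subalgebra: "unital_cstar_subalgebra A \<Longrightarrow> closed_subalgebra A"
  by (auto simp: closed_subalgebra_def unital_cstar_subalgebra_def)

context
  fixes B :: "'a::cstar_algebra set"
  assumes B: "closed_subalgebra B"
begin

lemma subalgebra_closed: "closed B"
  and subalgebra_one: "1 \<in> B"
  and subalgebra_add: "x \<in> B \<Longrightarrow> y \<in> B \<Longrightarrow> x + y \<in> B"
  and subalgebra_mult: "x \<in> B \<Longrightarrow> y \<in> B \<Longrightarrow> x * y \<in> B"
  and subalgebra_scaleC: "x \<in> B \<Longrightarrow> c *\<^sub>C x \<in> B"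
  using B by (auto simp: closed_subalgebra_def)

lemma subalgebra_zero: "0 \<in> B"
  using subalgebra_scaleC[OF subalgebra_one, of 0] by (simp add: scaleC_zero_left)

lemma subalgebra_scaleR: "x \<in> B \<Longrightarrow> r *\<^sub>R x \<in> B"
  by (simp add: scaleR_scaleC subalgebra_scaleC)

lemma subalgebra_uminus: "x \<in> B \<Longrightarrow> - x \<in> B"
  using subalgebra_scaleC[of x "-1"] by (simp add: scaleC_minus_one)

lemma subalgebra_diff: "x \<in> B \<Longrightarrow> y \<in> B \<Longrightarrow> x - y \<in> B"
  using subalgebra_add[of x "-y"] subalgebra_uminus by simp

lemma subalgebra_power: "x \<in> B \<Longrightarrow> x ^ k \<in> B"
  by (induction k) (auto simp: subalgebra_one subalgebra_mult)

lemma subalgebra_sum: "(\<And>i. i \<in> I \<Longrightarrow> f i \<in> B) \<Longrightarrow> sum f I \<in> B"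
  by (induction I rule: infinite_finite_induct) (auto simp: subalgebra_zero subalgebra_add)

lemmas subalgebra_intros = subalgebra_one subalgebra_zero subalgebra_add subalgebra_mult
  subalgebra_scaleC subalgebra_scaleR subalgebra_uminus subalgebra_diff subalgebra_power

text \<open>Neumann series, kept in \<open>B\<close> by closedness. The explicit bound on
  \<open>d - 1\<close> later keeps inverses within the radius where \<open>logtr\<close> is
  additive.\<close>

lemma inverse_near_one:
  assumes c: "c \<in> B" and n: "norm (c - 1) < 1"
  obtains d where "d \<in> B" "c * d = 1" "d * c = 1"
    "norm (d - 1) \<le> norm (c - 1) / (1 - norm (c - 1))"
proof -
  define x where "x = 1 - c"
  have x: "x \<in> B" "norm x < 1" "norm x = norm (c - 1)" and cx: "c = 1 - x"
    using c n by (auto simp: x_def norm_minus_commute intro: subalgebra_intros)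
  have sn: "summable (\<lambda>k. norm (x ^ k))"
    by (rule summable_comparison_test'[OF summable_geometric[of "norm x"], of 0])
      (use x norm_power_ineq[of x] in auto)
  then have s: "summable (\<lambda>k. x ^ k)" by (rule summable_norm_cancel)
  define d where "d = (\<Sum>k. x ^ k)"
  have "(\<lambda>m. \<Sum>k<m. x ^ k) \<longlonglongrightarrow> d"
    using summable_LIMSEQ[OF s] by (simp add: d_def)
  then have dB: "d \<in> B"
    by (rule closed_sequentially[OF subalgebra_closed, rotated]) (auto intro: subalgebra_sum subalgebra_power x)
  have d1: "d = 1 + (\<Sum>k. x ^ Suc k)"
    using suminf_split_head[OF s] by (simp add: d_def)
  have s1: "(\<Sum>k. x ^ Suc k) = x * d" "(\<Sum>k. x ^ Suc k) = d * x"
    using suminf_mult[OF s, of x] suminf_mult2[OF s, of x] by (simp_all add: d_def power_commutes)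
  have "c * d = 1" "d * c = 1"
    using d1 s1 by (auto simp: cx algebra_simps)
  moreover have "norm (d - 1) \<le> norm x / (1 - norm x)"
  proof -
    have 1: "norm (d - 1) \<le> norm x * norm d"
      using d1 s1 norm_mult_ineq[of x d] by (simp add: algebra_simps)
    have "norm d \<le> 1 + norm (d - 1)"
      using norm_triangle_ineq[of 1 "d - 1"] by simp
    then have "norm x * norm d \<le> norm x * (1 + norm (d - 1))"
      by (rule mult_left_mono) simp
    with 1 have "norm (d - 1) * (1 - norm x) \<le> norm x"
      by (simp add: algebra_simps)
    then show ?thesis using x by (simp add: pos_le_divide_eq)
  qed
  ultimately show ?thesis using that[of d] dB x by simp
qed

text \<open>The element \<open>1 - s\<close> is a square root of \<open>1 - b\<close>, obtained as the fixed point of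
  \<open>s \<mapsto> (b + s\<^sup>2) / 2\<close>.\<close>

lemma square_root_near_one:
  assumes b: "b \<in> B" "norm b \<le> 3/4"
  obtains s where "s \<in> B" "norm s \<le> 1/2" "(1 - s) * (1 - s) = 1 - b"
    "\<And>a. a * b = b * a \<Longrightarrow> a * s = s * a" "adj b = b \<Longrightarrow> adj s = s"
proof -
  \<comment> \<open>Commutation and self-adjointness are closed conditions preserved by
    \<open>F\<close>, so they are imposed on the set where Banach's theorem is applied.\<close>
  define S where "S = B \<inter> cball 0 (1/2) \<inter> (\<Inter>a\<in>{a. a * b = b * a}. {s. a * s = s * a})
    \<inter> {s. adj b = b \<longrightarrow> adj s = s}"
  define F where "F s = (1/2) *\<^sub>R (b + s * s)" for s
  have clS: "closed S"
  proof -
    have "closed {s. adj b = b \<longrightarrow> adj s = s}"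
      by (cases "adj b = b")
        (auto intro!: closed_Collect_eq linear_continuous_on bounded_linear_adj continuous_on_id)
    then show ?thesis unfolding S_def
      by (intro closed_Int closed_INT ballI closed_Collect_eq subalgebra_closed) (auto intro!: continuous_intros)
  qed
  have "\<exists>!s\<in>S. F s = s"
  proof (rule Banach_fix[where c = "1/2"])
    show "complete S" using clS by (simp add: complete_eq_closed)
    show "S \<noteq> {}" using subalgebra_zero linear_0[OF bounded_linear.linear[OF bounded_linear_adj]] by (auto simp: S_def intro!: exI[of _ 0])
    show "F ` S \<subseteq> S"
    proof (rule image_subsetI)
      fix s assume s: "s \<in> S"
      then have n: "norm s \<le> 1/2" by (simp add: S_def)
      have "norm (b + s * s) \<le> norm b + norm s * norm s"
        by (rule order_trans[OF norm_triangle_ineq]) (simp add: norm_mult_ineq)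
      \<comment> \<open>Half of this sum is exactly the radius 1/2 of the ball.\<close>
      also have "\<dots> \<le> 3/4 + 1/2 * (1/2)"
        using n b(2) by (intro add_mono mult_mono) auto
      finally have 1: "norm (F s) \<le> 1/2" by (simp add: F_def)
      have sB: "s \<in> B" using s by (simp add: S_def)
      have 2: "F s \<in> B" unfolding F_def using sB b(1) by (intro subalgebra_intros)
      have 3: "a * F s = F s * a" if "a * b = b * a" for a
      proof -
        have "a * s = s * a" using s that by (auto simp: S_def)
        then have "a * (s * s) = (s * s) * a" by (metis mult.assoc)
        then show ?thesis using that by (simp only: F_def mult_scaleR_left mult_scaleR_right distrib_left distrib_right)
      qed
      have 4: "adj (F s) = F s" if "adj b = b"
      proof -
        have "adj s = s" using s that by (auto simp: S_def)
        then show ?thesis using that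
          by (simp only: F_def scaleR_scaleC adj_scaleC adj_add adj_mult complex_cnj_complex_of_real)
      qed
      show "F s \<in> S" using 1 2 3 4 by (auto simp: S_def)
    qed
    fix s t assume st: "s \<in> S" "t \<in> S"
    have "F s - F t = (1/2) *\<^sub>R (s * (s - t) + (s - t) * t)"
      by (simp add: F_def algebra_simps)
    then have "norm (F s - F t) \<le> (1/2) * (norm s * norm (s - t) + norm (s - t) * norm t)"
      using norm_triangle_ineq[of "s * (s - t)" "(s - t) * t"] norm_mult_ineq[of s "s - t"]
        norm_mult_ineq[of "s - t" t] by simp
    also have "\<dots> \<le> (1/2) * (1/2 * norm (s - t) + norm (s - t) * (1/2))"
      using st by (intro mult_left_mono add_mono mult_right_mono) (auto simp: S_def)
    finally show "dist (F s) (F t) \<le> 1/2 * dist s t" by (simp add: dist_norm)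
  qed auto
  then obtain s where s: "s \<in> S" and F: "F s = s" by blast
  have "2 *\<^sub>R s = b + s * s" using arg_cong[OF F, of "\<lambda>x. 2 *\<^sub>R x"] by (simp add: F_def)
  then have "(1 - s) * (1 - s) = 1 - b" by (simp add: algebra_simps scaleR_2)
  then show ?thesis using that[of s] s by (auto simp: S_def)
qed

end

text \<open>A self-adjoint \<open>h\<close> of norm at most \<open>1/2\<close> is the real part of the unitary \<open>h + i sqrt (1 - h\<^sup>2)\<close>,
  and the image of a unitary has norm 1.\<close>

lemma star_automorphism_bounded:
  assumes A: "unital_cstar_subalgebra A" and f: "f \<in> star_automorphisms A" and x: "x \<in> A"
  shows "norm (f x) \<le> 2 * norm x"
proof -
  note sub = subalgebra_intros[OF unital_cstar_imp_closed_subalgebra[OF A]]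
  have fA: "f x \<in> A" if "x \<in> A" for x
    using f that by (auto simp: star_automorphisms_def bij_betw_def)
  have fadd: "f (x + y) = f x + f y" and fmult: "f (x * y) = f x * f y" if "x \<in> A" "y \<in> A" for x y
    using f that by (auto simp: star_automorphisms_def)
  have fsc: "f (c *\<^sub>C x) = c *\<^sub>C f x" and fadj: "f (adj x) = adj (f x)" if "x \<in> A" for x c
    using f that by (auto simp: star_automorphisms_def)
  have adjA: "adj x \<in> A" if "x \<in> A" for x
    using A that by (simp add: unital_cstar_subalgebra_def)
  have fone: "f 1 = 1"
  proof -
    have "1 \<in> f ` A" using f sub(1) by (simp add: star_automorphisms_def bij_betw_def)
    then obtain y where "y \<in> A" "f y = 1" by auto
    then show ?thesis using fmult[of 1 y] sub(1) by simp
  qed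
  have small: "norm (f h) \<le> 1" if h: "h \<in> A" "adj h = h" "norm h \<le> 1/2" for h
  proof -
    have "norm (h * h) \<le> 1/2 * (1/2)"
      using norm_mult_ineq[of h h] mult_mono[OF h(3) h(3)] by simp
    then have nb: "norm (h * h) \<le> 3/4" by simp
    obtain s where s: "s \<in> A" "(1 - s) * (1 - s) = 1 - h * h"
      "\<And>a. a * (h * h) = h * h * a \<Longrightarrow> a * s = s * a" "adj (h * h) = h * h \<Longrightarrow> adj s = s"
      using square_root_near_one[OF unital_cstar_imp_closed_subalgebra[OF A] sub(4)[OF h(1) h(1)] nb] by metis
    define y where "y = 1 - s"
    have y: "y \<in> A" "adj y = y" "h * y = y * h" "y * y = 1 - h * h"
      using s(1,2,4) s(3)[of h] h(2) sub(8)[OF sub(1) s(1)]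
      by (simp_all add: y_def adj_diff adj_one adj_mult mult.assoc left_diff_distrib right_diff_distrib)
    define u where "u = h + \<i> *\<^sub>C y"
    have u: "u \<in> A" "adj u = h - \<i> *\<^sub>C y"
      using h y by (auto simp: u_def adj_add adj_scaleC scaleC_minus_left intro!: sub)
    \<comment> \<open>Both products equal \<open>h * h + y * y = 1\<close>, because \<open>y\<close>
      commutes with \<open>h\<close>: everything that commutes with \<open>h * h\<close> commutes
      with \<open>s\<close>.\<close>
    have "adj u * u = 1"
      unfolding u(2) unfolding u_def
      by (simp add: algebra_simps mult_scaleC_left mult_scaleC_right scaleC_scaleC scaleC_minus_one scaleC_diff_right scaleC_add_right y)
    moreover have "u * adj u = 1"
      unfolding u(2) unfolding u_def
      by (simp add: algebra_simps mult_scaleC_left mult_scaleC_right scaleC_scaleC scaleC_minus_one scaleC_diff_right scaleC_add_right y)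
    ultimately have "adj (f u) * f u = 1" "adj (f (adj u)) * f (adj u) = 1"
      using fmult[OF u(1) adjA[OF u(1)]] fmult[OF adjA[OF u(1)] u(1)] fadj[OF u(1)]
        fadj[OF adjA[OF u(1)]] fone by (simp_all add: adj_adj)
    then have nu: "norm (f u) = 1" "norm (f (adj u)) = 1" by (auto intro: norm_unitary)
    have "f u + f (adj u) = f (2 *\<^sub>R h)"
      using fadd[OF u(1) adjA[OF u(1)]] by (simp add: u(2)) (simp add: u_def scaleR_2)
    also have "\<dots> = 2 *\<^sub>R f h" using h by (simp add: scaleR_scaleC fsc)
    finally have "2 * norm (f h) \<le> norm (f u) + norm (f (adj u))"
      using norm_triangle_ineq[of "f u" "f (adj u)"] by simp
    then show ?thesis using nu by simp
  qed
  \<comment> \<open>Scaling \<open>h\<close> to norm 1/2 costs the factor 2. The C*-identity then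
    carries the bound from \<open>adj x * x\<close> to \<open>x\<close>.\<close>
  have sa: "norm (f h) \<le> 2 * norm h" if h: "h \<in> A" "adj h = h" for h
  proof (cases "h = 0")
    case False
    define r where "r = 1 / (2 * norm h)"
    have r: "r > 0" using False by (simp add: r_def)
    have "norm (f (r *\<^sub>R h)) \<le> 1"
      by (rule small) (use h False in \<open>auto simp: sub r_def scaleR_scaleC adj_scaleC norm_scaleC norm_divide norm_mult\<close>)
    moreover have "f (r *\<^sub>R h) = r *\<^sub>R f h" using h by (simp add: scaleR_scaleC fsc)
    ultimately have "r * norm (f h) \<le> 1" using r by simp
    then show ?thesis using False by (simp add: r_def field_simps)
  next
    case True
    then show ?thesis using fsc[OF h(1), of 0] by (simp add: scaleC_zero_left)
  qed
  have "(norm (f x))\<^sup>2 = norm (f (adj x * x))"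
    using x adjA by (simp add: cstar_identity[symmetric] fmult fadj)
  also have "\<dots> \<le> 2 * norm (adj x * x)"
    by (rule sa) (auto simp: x adjA sub adj_mult adj_adj)
  also have "\<dots> \<le> (2 * norm x)\<^sup>2" by (simp add: cstar_identity power_mult_distrib)
  finally show ?thesis by (rule power2_le_imp_le) simp
qed

section \<open>Complex matrices\<close>

definition mat_trace :: "complex mat \<Rightarrow> complex" where
  "mat_trace X = (\<Sum>i<dim_row X. X $$ (i, i))"

lemma mat_trace_add:
  "X \<in> carrier_mat N N \<Longrightarrow> Y \<in> carrier_mat N N \<Longrightarrow> mat_trace (X + Y) = mat_trace X + mat_trace Y"
  by (auto simp: mat_trace_def sum.distrib)

lemma mat_trace_smult: "X \<in> carrier_mat N N \<Longrightarrow> mat_trace (c \<cdot>\<^sub>m X) = c * mat_trace X"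
  by (auto simp: mat_trace_def sum_distrib_left)

lemma mat_trace_one: "mat_trace (1\<^sub>m N) = of_nat N"
  by (simp add: mat_trace_def)

lemma mat_trace_mult_commute:
  assumes "X \<in> carrier_mat N N" "Y \<in> carrier_mat N N"
  shows "mat_trace (X * Y) = mat_trace (Y * X)"
proof -
  have *: "mat_trace (X * Y) = (\<Sum>i<N. \<Sum>j<N. X $$ (i, j) * Y $$ (j, i))"
    if "X \<in> carrier_mat N N" "Y \<in> carrier_mat N N" for X Y
    using that by (auto simp: mat_trace_def scalar_prod_def atLeast0LessThan intro!: sum.cong)
  show ?thesis
    unfolding *[OF assms] *[OF assms(2,1)]
    by (subst sum.swap) (simp add: mult.commute)
qed

definition unit_mat :: "nat \<Rightarrow> nat \<Rightarrow> nat \<Rightarrow> complex mat" where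
  "unit_mat N i j = mat N N (\<lambda>p. if p = (i, j) then 1 else 0)"

lemma unit_mat_carrier [simp]: "unit_mat N i j \<in> carrier_mat N N"
  by (simp add: unit_mat_def)

lemma unit_mat_mult:
  assumes "i < N" "j < N" "k < N" "l < N"
  shows "unit_mat N i j * unit_mat N k l = (if j = k then unit_mat N i l else 0\<^sub>m N N)"
  using assms
  by (intro eq_matI) (auto simp: unit_mat_def scalar_prod_def if_distrib[of "\<lambda>x. x * _"] cong: if_cong)

text \<open>The scalar action \<open>sc\<close> is a parameter because \<open>L\<close> will be a
  complex functional as well as an embedding into the C*-algebra.\<close>

lemma linear_mat_expand:
  fixes L :: "complex mat \<Rightarrow> 'b::ab_group_add" and sc :: "complex \<Rightarrow> 'b \<Rightarrow> 'b"
  assumes add: "\<And>X Y. X \<in> carrier_mat N N \<Longrightarrow> Y \<in> carrier_mat N N \<Longrightarrow> L (X + Y) = L X + L Y"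
    and sc: "\<And>c X. X \<in> carrier_mat N N \<Longrightarrow> L (c \<cdot>\<^sub>m X) = sc c (L X)"
    and X: "X \<in> carrier_mat N N"
  shows "L X = (\<Sum>(i, j)\<in>{..<N} \<times> {..<N}. sc (X $$ (i, j)) (L (unit_mat N i j)))"
proof -
  have zero: "L (0\<^sub>m N N) = 0"
    using add[of "0\<^sub>m N N" "0\<^sub>m N N"] by simp
  have *: "L (mat N N (\<lambda>p. if p \<in> S then X $$ p else 0)) =
      (\<Sum>(i, j)\<in>S. sc (X $$ (i, j)) (L (unit_mat N i j)))"
    if "finite S" "S \<subseteq> {..<N} \<times> {..<N}" for S
    using that
  proof (induction S)
    case empty
    have "mat N N (\<lambda>p. 0::complex) = 0\<^sub>m N N" by (intro eq_matI) auto
    then show ?case using zero by simp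
  next
    case (insert q S)
    obtain i j where q: "q = (i, j)" by (cases q)
    have "mat N N (\<lambda>p. if p \<in> insert q S then X $$ p else 0) =
        X $$ (i, j) \<cdot>\<^sub>m unit_mat N i j + mat N N (\<lambda>p. if p \<in> S then X $$ p else 0)"
      using insert q by (intro eq_matI) (auto simp: unit_mat_def)
    then show ?case using insert q by (simp add: add sc)
  qed
  have "mat N N (\<lambda>p. if p \<in> {..<N} \<times> {..<N} then X $$ p else 0) = X"
    using X by (intro eq_matI) auto
  then show ?thesis using *[of "{..<N} \<times> {..<N}"] by simp
qed

text \<open>A trace kills the off-diagonal matrix units, which are commutators, and has the same
  value on all diagonal ones. It will be applied to \<open>tau\<close> composed with an
  endomorphism.\<close>

lemma mat_trace_unique:
  fixes t :: "complex mat \<Rightarrow> complex"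
  assumes add: "\<And>X Y. X \<in> carrier_mat N N \<Longrightarrow> Y \<in> carrier_mat N N \<Longrightarrow> t (X + Y) = t X + t Y"
    and sc: "\<And>c X. X \<in> carrier_mat N N \<Longrightarrow> t (c \<cdot>\<^sub>m X) = c * t X"
    and comm: "\<And>X Y. X \<in> carrier_mat N N \<Longrightarrow> Y \<in> carrier_mat N N \<Longrightarrow> t (X * Y) = t (Y * X)"
    and one: "t (1\<^sub>m N) = 1" and N: "N > 0" and X: "X \<in> carrier_mat N N"
  shows "t X = mat_trace X / of_nat N"
proof -
  have zero: "t (0\<^sub>m N N) = 0"
    using add[of "0\<^sub>m N N" "0\<^sub>m N N"] by simp
  have off: "t (unit_mat N i j) = 0" if "i < N" "j < N" "i \<noteq> j" for i j
    using comm[of "unit_mat N i i" "unit_mat N i j"] that by (simp add: unit_mat_mult zero)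
  have on: "t (unit_mat N i i) = t (unit_mat N 0 0)" if "i < N" for i
    using comm[of "unit_mat N i 0" "unit_mat N 0 i"] that N by (simp add: unit_mat_mult)
  have *: "t X = (\<Sum>i<N. X $$ (i, i)) * t (unit_mat N 0 0)" if X: "X \<in> carrier_mat N N" for X
  proof -
    have "t X = (\<Sum>i<N. \<Sum>j<N. X $$ (i, j) * t (unit_mat N i j))"
      using linear_mat_expand[of N t "(*)", OF add sc X] by (simp add: sum.cartesian_product)
    also have "\<dots> = (\<Sum>i<N. \<Sum>j<N. if j = i then X $$ (i, i) * t (unit_mat N 0 0) else 0)"
    proof (intro sum.cong refl)
      fix i j assume "i \<in> {..<N}" "j \<in> {..<N}"
      then show "X $$ (i, j) * t (unit_mat N i j) = (if j = i then X $$ (i, i) * t (unit_mat N 0 0) else 0)"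
        using on[of i] off[of i j] by (cases "j = i") simp_all
    qed
    also have "\<dots> = (\<Sum>i<N. X $$ (i, i)) * t (unit_mat N 0 0)"
      by (simp add: sum_distrib_right)
    finally show ?thesis .
  qed
  from *[of "1\<^sub>m N"] one have "of_nat N * t (unit_mat N 0 0) = 1" by simp
  then have "t (unit_mat N 0 0) = 1 / of_nat N"
    using N by (simp add: field_simps)
  then show ?thesis using *[OF X] X by (simp add: mat_trace_def)
qed

section \<open>Triangular forms, idempotents and spectra\<close>

lemma upper_triangular_mult:
  fixes S T :: "complex mat"
  assumes S: "S \<in> carrier_mat N N" "upper_triangular S" and T: "T \<in> carrier_mat N N" "upper_triangular T"
  shows "upper_triangular (S * T)" and "\<And>i. i < N \<Longrightarrow> (S * T) $$ (i, i) = S $$ (i, i) * T $$ (i, i)"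
proof -
  have e: "(S * T) $$ (i, j) = (\<Sum>k<N. S $$ (i, k) * T $$ (k, j))" if "i < N" "j < N" for i j
    using that S T by (auto simp: scalar_prod_def atLeast0LessThan intro!: sum.cong)
  have z: "S $$ (i, k) * T $$ (k, j) = 0" if "i < N" "k < N" "k \<noteq> i" "j \<le> i" for i j k
    using that upper_triangularD[OF S(2), of k i] upper_triangularD[OF T(2), of j k] S T
    by (cases "k < i") auto
  show "upper_triangular (S * T)"
  proof (rule upper_triangularI)
    fix i j assume "j < i" "i < dim_row (S * T)"
    then have ij: "j < i" "i < N" using S by auto
    have "S $$ (i, k) * T $$ (k, j) = 0" if "k < N" for k
      using z[of i k j] that ij upper_triangularD[OF T(2), of j i] T by (cases "k = i") auto
    then have "(\<Sum>k<N. S $$ (i, k) * T $$ (k, j)) = 0" by (intro sum.neutral) blast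
    then show "(S * T) $$ (i, j) = 0" using ij e[of i j] by simp
  qed
  fix i assume i: "i < N"
  have "(\<Sum>k<N. S $$ (i, k) * T $$ (k, i)) = (\<Sum>k<N. if k = i then S $$ (i, i) * T $$ (i, i) else 0)"
    using i by (intro sum.cong) (auto simp: z simp del: mult_eq_0_iff)
  then show "(S * T) $$ (i, i) = S $$ (i, i) * T $$ (i, i)" using i by (simp add: e)
qed

text \<open>Schur form with eigenvalues ordered by decreasing real part, which for an idempotent
  puts the ones before the zeros.\<close>

lemma complex_schur:
  fixes X :: "complex mat"
  assumes X: "X \<in> carrier_mat N N"
  obtains T P Q where "T \<in> carrier_mat N N" "P \<in> carrier_mat N N" "Q \<in> carrier_mat N N"
    "P * Q = 1\<^sub>m N" "Q * P = 1\<^sub>m N" "X = P * T * Q" "upper_triangular T"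
    "\<And>i. i < N \<Longrightarrow> eigenvalue X (T $$ (i, i))"
    "\<And>i j. i \<le> j \<Longrightarrow> j < N \<Longrightarrow> Re (T $$ (j, j)) \<le> Re (T $$ (i, i))"
proof -
  obtain as where as: "char_poly X = (\<Prod>a\<leftarrow>as. [:- a, 1:])" "length as = N"
    using char_poly_factorized[OF X] by blast
  define es where "es = sort_key (\<lambda>z. - Re z) as"
  have len: "length es = N" using as by (simp add: es_def)
  have cp: "char_poly X = (\<Prod>a\<leftarrow>es. [:- a, 1:])"
    unfolding as(1) prod_mset_prod_list[symmetric] by (simp add: es_def)
  obtain T P Q where s: "schur_decomposition X es = (T, P, Q)" by (metis prod_cases3)
  note S = schur_decomposition[OF X cp s]
  have w: "similar_mat_wit X T P Q" and ut: "upper_triangular T" and d: "diag_mat T = es"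
    using S by auto
  note W = similar_mat_witD2[OF X w]
  have di: "T $$ (i, i) = es ! i" if "i < N" for i
    using that W(5) arg_cong[OF d, of "\<lambda>l. l ! i"] by (auto simp: diag_mat_def)
  have ev: "eigenvalue X (T $$ (i, i))" if "i < N" for i
  proof -
    have "es ! i \<in> set es" using that len by simp
    then show ?thesis
      unfolding eigenvalue_root_char_poly[OF X] cp di[OF that]
      by (auto simp: poly_prod_list prod_list_zero_iff image_iff)
  qed
  have so: "Re (T $$ (j, j)) \<le> Re (T $$ (i, i))" if "i \<le> j" "j < N" for i j
  proof -
    have "sorted (map (\<lambda>z. - Re z) es)" by (simp add: es_def)
    from sorted_nth_mono[OF this that(1)] show ?thesis using that len by (simp add: di)
  qed
  show ?thesis using that[OF W(5-7) W(1-3) ut ev so] .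
qed

text \<open>The eigenvector is repeated in every column, since embeddings act on square matrices
  only; the eigenvalue equation thus becomes an identity in the algebra.\<close>

lemma eigenvalue_mat:
  assumes X: "X \<in> carrier_mat N N" and ev: "eigenvalue X \<mu>"
  obtains V where "V \<in> carrier_mat N N" "V \<noteq> 0\<^sub>m N N" "X * V = \<mu> \<cdot>\<^sub>m V"
proof -
  obtain v where v: "v \<in> carrier_vec N" "v \<noteq> 0\<^sub>v N" "X *\<^sub>v v = \<mu> \<cdot>\<^sub>v v"
    using ev X by (auto simp: eigenvalue_def eigenvector_def)
  define V where "V = mat N N (\<lambda>(i, j). v $ i)"
  have V: "V \<in> carrier_mat N N" by (simp add: V_def)
  have col: "col V j = v" if "j < N" for j
    using that v(1) by (intro eq_vecI) (auto simp: V_def)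
  obtain i where i: "i < N" "v $ i \<noteq> 0"
  proof (rule ccontr)
    assume "\<not> thesis"
    then have "v = 0\<^sub>v N" using v(1) that by (intro eq_vecI) auto
    with v(2) show False by blast
  qed
  then have "V $$ (i, i) \<noteq> 0" by (simp add: V_def)
  then have ne: "V \<noteq> 0\<^sub>m N N" using i by auto
  have "X * V = \<mu> \<cdot>\<^sub>m V"
  proof (rule eq_matI)
    fix i j assume "i < dim_row (\<mu> \<cdot>\<^sub>m V)" "j < dim_col (\<mu> \<cdot>\<^sub>m V)"
    then have ij: "i < N" "j < N" by (auto simp: V_def)
    have "(X * V) $$ (i, j) = (X *\<^sub>v v) $ i"
      using ij X V v(1) by (simp add: col)
    also have "\<dots> = \<mu> * v $ i" using v ij by simp
    finally show "(X * V) $$ (i, j) = (\<mu> \<cdot>\<^sub>m V) $$ (i, j)" using ij by (simp add: V_def)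
  qed (use X V in auto)
  with that V ne show ?thesis by blast
qed

lemma mat_inverse_exists:
  fixes X :: "complex mat"
  assumes X: "X \<in> carrier_mat N N" and d: "det X \<noteq> 0"
  obtains Y where "Y \<in> carrier_mat N N" "X * Y = 1\<^sub>m N" "Y * X = 1\<^sub>m N"
  using det_non_zero_imp_unit[OF X d] by (auto simp: Units_def ring_mat_def)

text \<open>The normal form of an idempotent of rank \<open>m\<close>. With the ones in the leading
  positions, \<open>X \<mapsto> X \<otimes> 1\<close> maps such matrices to such matrices.\<close>

definition diag_ones :: "nat \<Rightarrow> nat \<Rightarrow> complex mat" where
  "diag_ones m N = mat N N (\<lambda>(i, j). if i = j \<and> i < m then 1 else 0)"

lemma diag_ones_carrier [simp]: "diag_ones m N \<in> carrier_mat N N"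
  by (simp add: diag_ones_def)

lemma mat_trace_diag_ones: "m \<le> N \<Longrightarrow> mat_trace (diag_ones m N) = of_nat m"
proof -
  assume m: "m \<le> N"
  have "mat_trace (diag_ones m N) = (\<Sum>i<N. if i < m then 1 else 0)"
    by (auto simp: mat_trace_def diag_ones_def intro!: sum.cong)
  also have "\<dots> = (\<Sum>i<m. 1)"
    using m by (intro sum.mono_neutral_cong_right) auto
  finally show ?thesis by simp
qed

lemma diag_ones_upper_triangular: "upper_triangular (diag_ones m N)"
  by (auto simp: diag_ones_def)

lemma diag_ones_idem: "diag_ones m N * diag_ones m N = diag_ones m N"
  by (intro eq_matI)
    (auto simp: diag_ones_def scalar_prod_def if_distrib[of "\<lambda>x. x * _"] intro!: sum.neutral cong: if_cong)

text \<open>If \<open>T\<close> is the triangular form of the idempotent, with the ones first on the diagonal, and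
  \<open>E = diag_ones m N\<close>, then \<open>T E + (1 - T) (1 - E)\<close> is unitriangular and intertwines \<open>T\<close> and \<open>E\<close>.\<close>

lemma idempotent_mat_conjugate:
  fixes X :: "complex mat"
  assumes X: "X \<in> carrier_mat N N" and idem: "X * X = X" and tr: "mat_trace X = of_nat m"
  obtains W V where "W \<in> carrier_mat N N" "V \<in> carrier_mat N N" "W * V = 1\<^sub>m N" "V * W = 1\<^sub>m N"
    "X * W = W * diag_ones m N"
proof -
  obtain T P Q where s: "T \<in> carrier_mat N N" "P \<in> carrier_mat N N" "Q \<in> carrier_mat N N"
    "P * Q = 1\<^sub>m N" "Q * P = 1\<^sub>m N" "X = P * T * Q" "upper_triangular T"
    and so: "\<And>i j. i \<le> j \<Longrightarrow> j < N \<Longrightarrow> Re (T $$ (j, j)) \<le> Re (T $$ (i, i))"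
    using complex_schur[OF X] by metis
  define E where "E = diag_ones m N"
  have E: "E \<in> carrier_mat N N" "upper_triangular E" "E * E = E"
    by (simp_all add: E_def diag_ones_upper_triangular diag_ones_idem)
  have assoc: "A * B * C = A * (B * C)"
    if "A \<in> carrier_mat N N" "B \<in> carrier_mat N N" "C \<in> carrier_mat N N" for A B C :: "complex mat"
    using that by (rule assoc_mult_mat)
  have QXP: "Q * X * P = T"
  proof -
    have "Q * X * P = Q * P * T * (Q * P)"
      unfolding s(6) using s(1-3) by (simp only: assoc mult_carrier_mat[of _ N N _ N])
    then show ?thesis using s(1) by (simp add: s(5))
  qed
  have TT: "T * T = T"
  proof -
    have "T * T = Q * X * P * (Q * X * P)" by (simp add: QXP)
    also have "\<dots> = Q * (X * (P * Q) * X) * P"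
      using s(1-3) X by (simp only: assoc mult_carrier_mat[of _ N N _ N])
    also have "\<dots> = T" using X s(4) by (simp add: idem QXP)
    finally show ?thesis .
  qed
  have d01: "T $$ (i, i) = 0 \<or> T $$ (i, i) = 1" if "i < N" for i
    using upper_triangular_mult(2)[OF s(1,7) s(1,7) that] TT by simp
  have "mat_trace X = mat_trace (T * Q * P)"
    unfolding s(6) using s(1-3) mat_trace_mult_commute[of P N "T * Q"]
    by (simp only: assoc mult_carrier_mat[of _ N N _ N])
  also have "\<dots> = mat_trace T" using s(1,3) assoc[OF s(1) s(3) s(2)] by (simp add: s(5))
  finally have trT: "(\<Sum>i<N. T $$ (i, i)) = of_nat m" using tr s(1) by (simp add: mat_trace_def)
  \<comment> \<open>The diagonal entries are 0 or 1 in decreasing order, so \<open>I\<close> is an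
    initial segment, and the trace says that it has \<open>m\<close> elements.\<close>
  define I where "I = {i. i < N \<and> T $$ (i, i) = 1}"
  have "(\<Sum>i<N. T $$ (i, i)) = (\<Sum>i<N. if i \<in> I then 1 else 0)"
    using d01 by (intro sum.cong) (auto simp: I_def)
  also have "\<dots> = of_nat (card I)"
    by (subst sum.If_cases) (auto simp: I_def Collect_conj_eq[symmetric] intro!: arg_cong[of _ _ card])
  finally have cI: "card I = m" using trT by simp
  have finI: "finite I" by (simp add: I_def)
  have down: "i \<in> I" if "j \<in> I" "i \<le> j" for i j
    using so[of i j] that d01[of i] by (auto simp: I_def)
  have Iless: "i \<in> I \<longleftrightarrow> i < m" for i
  proof
    assume i: "i \<in> I"
    then have "{..i} \<subseteq> I" using down by auto
    from card_mono[OF finI this] show "i < m" using cI by simp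
  next
    assume i: "i < m"
    show "i \<in> I"
    proof (rule ccontr)
      assume n: "i \<notin> I"
      have "I \<subseteq> {..<i}" using n down by (metis lessThan_iff not_le subsetI)
      from card_mono[OF _ this] show False using cI i by simp
    qed
  qed
  define W where "W = T * E + (1\<^sub>m N - T) * (1\<^sub>m N - E)"
  have mc: "1\<^sub>m N - T \<in> carrier_mat N N" "1\<^sub>m N - E \<in> carrier_mat N N" using s E by auto
  have WW: "W \<in> carrier_mat N N" using s E mc by (simp add: W_def)
  have ut1: "upper_triangular (1\<^sub>m N - T)" "upper_triangular (1\<^sub>m N - E)"
    using s(1,7) E(1,2) by (auto simp: upper_triangular_def)
  have utW: "upper_triangular W"
    using upper_triangular_mult(1)[OF s(1,7) E(1,2)] upper_triangular_mult(1)[OF mc(1) ut1(1) mc(2) ut1(2)] s E mc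
    by (auto simp: upper_triangular_def W_def simp del: index_mult_mat(1))
  \<comment> \<open>\<open>T\<close> and \<open>E\<close> have the same diagonal, and
    \<open>t * t + (1 - t) * (1 - t) = 1\<close> for \<open>t\<close> equal to 0 or 1.\<close>
  have dW: "W $$ (i, i) = 1" if i: "i < N" for i
  proof -
    have "W $$ (i, i) = T $$ (i, i) * E $$ (i, i) + (1 - T $$ (i, i)) * (1 - E $$ (i, i))"
      using i s E mc upper_triangular_mult(2)[OF s(1,7) E(1,2) i]
        upper_triangular_mult(2)[OF mc(1) ut1(1) mc(2) ut1(2) i]
      by (simp add: W_def del: index_mult_mat(1))
    moreover have "E $$ (i, i) = (if i \<in> I then 1 else 0)"
      using i by (simp add: E_def diag_ones_def Iless)
    moreover have "T $$ (i, i) = (if i \<in> I then 1 else 0)"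
      using i d01[OF i] by (auto simp: I_def)
    ultimately show ?thesis by auto
  qed
  have "det W = 1"
    unfolding det_upper_triangular[OF utW WW] prod_list_diag_prod using WW dW by auto
  then obtain V where V: "V \<in> carrier_mat N N" "W * V = 1\<^sub>m N" "V * W = 1\<^sub>m N"
    using mat_inverse_exists[OF WW] by auto
  have "T * ((1\<^sub>m N - T) * (1\<^sub>m N - E)) = 0\<^sub>m N N"
  proof -
    have "T * (1\<^sub>m N - T) = 0\<^sub>m N N"
      using s TT by (subst mult_minus_distrib_mat[of _ N N]) auto
    then show ?thesis using assoc[OF s(1) mc] left_mult_zero_mat[OF mc(2), of N] by metis
  qed
  moreover have "T * (T * E) = T * E" using assoc[OF s(1) s(1) E(1)] TT by simp
  moreover have "T * W = T * (T * E) + T * ((1\<^sub>m N - T) * (1\<^sub>m N - E))"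
    unfolding W_def by (rule mult_add_distrib_mat[of _ N N]) (use s(1) E(1) mc in auto)
  ultimately have TW: "T * W = T * E" using s(1) E(1) by simp
  have "(1\<^sub>m N - T) * (1\<^sub>m N - E) * E = 0\<^sub>m N N"
  proof -
    have "(1\<^sub>m N - E) * E = 0\<^sub>m N N"
      using E by (subst minus_mult_distrib_mat[of _ N N]) auto
    then show ?thesis using assoc[OF mc E(1)] right_mult_zero_mat[OF mc(1), of N] by metis
  qed
  moreover have "T * E * E = T * E" using assoc[OF s(1) E(1) E(1)] E(3) by simp
  moreover have "W * E = T * E * E + (1\<^sub>m N - T) * (1\<^sub>m N - E) * E"
    unfolding W_def by (rule add_mult_distrib_mat[of _ N N]) (use s(1) E(1) mc in auto)
  ultimately have WE: "W * E = T * E" using s(1) E(1) by simp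
  have c1: "P * W \<in> carrier_mat N N" "V * Q \<in> carrier_mat N N" using s WW V by auto
  have "P * W * (V * Q) = P * (W * V) * Q" "V * Q * (P * W) = V * (Q * P) * W"
    using s(2,3) WW V(1) by (simp_all only: assoc mult_carrier_mat[of _ N N _ N])
  then have inv: "P * W * (V * Q) = 1\<^sub>m N" "V * Q * (P * W) = 1\<^sub>m N"
    using s(2,3) V WW by (simp_all add: s(4,5))
  have "X * (P * W) = P * (T * ((Q * P) * W))"
    unfolding s(6) using s(1-3) WW by (simp only: assoc mult_carrier_mat[of _ N N _ N])
  also have "\<dots> = P * W * E" using assoc[OF s(2) WW E(1)] WW by (simp add: TW WE s(5))
  finally show ?thesis using that[OF c1 inv] by (simp add: E_def)
qed

text \<open>One list of eigenvalues, read off a triangular form, serves for all three conclusions.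
  This is what connects a logarithm defined by traces of powers with the determinant.\<close>

lemma power_spectrum:
  fixes X :: "complex mat"
  assumes X: "X \<in> carrier_mat N N"
  obtains \<mu> where "\<And>i. i < N \<Longrightarrow> eigenvalue X (\<mu> i)" "\<And>k. mat_trace (X ^\<^sub>m k) = (\<Sum>i<N. \<mu> i ^ k)"
    "\<And>z. det (1\<^sub>m N - z \<cdot>\<^sub>m X) = (\<Prod>i<N. 1 - z * \<mu> i)"
proof -
  obtain T P Q where s: "T \<in> carrier_mat N N" "P \<in> carrier_mat N N" "Q \<in> carrier_mat N N"
    "P * Q = 1\<^sub>m N" "Q * P = 1\<^sub>m N" "X = P * T * Q" "upper_triangular T"
    and ev: "\<And>i. i < N \<Longrightarrow> eigenvalue X (T $$ (i, i))"
    using complex_schur[OF X] by metis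
  have w: "similar_mat_wit X T P Q" by (rule similar_mat_witI[OF s(4-6) X s(1-3)])
  have Tk: "upper_triangular (T ^\<^sub>m k) \<and> (\<forall>i<N. (T ^\<^sub>m k) $$ (i, i) = T $$ (i, i) ^ k)" for k
  proof (induction k)
    case 0
    then show ?case using s(1) by auto
  next
    case (Suc k)
    have c: "T ^\<^sub>m k \<in> carrier_mat N N" using s(1) by simp
    show ?case
      using Suc upper_triangular_mult[OF c _ s(1) s(7)] by (auto simp del: index_mult_mat(1))
  qed
  have tr: "mat_trace (X ^\<^sub>m k) = (\<Sum>i<N. (T $$ (i, i)) ^ k)" for k
  proof -
    have c: "T ^\<^sub>m k \<in> carrier_mat N N" using s(1) by simp
    have "mat_trace (X ^\<^sub>m k) = mat_trace (P * (T ^\<^sub>m k * Q))"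
      using similar_mat_wit_pow_id[OF w, of k] s c by (simp add: assoc_mult_mat[of _ N N _ N _ N])
    also have "\<dots> = mat_trace (T ^\<^sub>m k * Q * P)"
      using s c by (intro mat_trace_mult_commute) auto
    also have "\<dots> = mat_trace (T ^\<^sub>m k)"
      using s c by (simp add: assoc_mult_mat[of _ N N _ N _ N])
    also have "\<dots> = (\<Sum>i<N. (T $$ (i, i)) ^ k)"
      using Tk[of k] c by (auto simp: mat_trace_def)
    finally show ?thesis .
  qed
  have det: "det (1\<^sub>m N - z \<cdot>\<^sub>m X) = (\<Prod>i<N. 1 - z * T $$ (i, i))" for z
  proof -
    define Tz where "Tz = z \<cdot>\<^sub>m T"
    have Tz: "Tz \<in> carrier_mat N N" using s by (simp add: Tz_def)
    have mc: "1\<^sub>m N - Tz \<in> carrier_mat N N" using Tz by auto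
    have "z \<cdot>\<^sub>m X = P * Tz * Q"
      unfolding s(6) Tz_def using s(1-3) mult_smult_distrib[OF s(2,1)] mult_smult_assoc_mat[of "P * T" N N Q N]
      by simp
    moreover have "P * (1\<^sub>m N - Tz) * Q = P * Q - P * Tz * Q"
      using s(2,3) Tz by (simp add: mult_minus_distrib_mat[of _ N N _ N] minus_mult_distrib_mat[of _ N N _ _ N])
    ultimately have "1\<^sub>m N - z \<cdot>\<^sub>m X = P * (1\<^sub>m N - Tz) * Q" using s(4) by simp
    then have "det (1\<^sub>m N - z \<cdot>\<^sub>m X) = det P * det (1\<^sub>m N - Tz) * det Q"
      by (simp only: det_mult[OF mult_carrier_mat[OF s(2) mc] s(3)] det_mult[OF s(2) mc])
    also have "\<dots> = det (1\<^sub>m N - Tz)"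
      using det_mult[OF s(2,3)] s(4) by (simp add: mult.commute mult.left_commute)
    also have "\<dots> = (\<Prod>i<N. 1 - z * T $$ (i, i))"
    proof -
      have ut: "upper_triangular (1\<^sub>m N - Tz)" using s(1,7) by (auto simp: upper_triangular_def Tz_def)
      show ?thesis unfolding det_upper_triangular[OF ut mc] prod_list_diag_prod
        using s by (auto simp: atLeast0LessThan Tz_def intro!: prod.cong)
    qed
    finally show ?thesis .
  qed
  show ?thesis using that[of "\<lambda>i. T $$ (i, i)"] ev tr det by blast
qed

section \<open>Kronecker products with an identity matrix\<close>

lemma kronecker_carrier: "X \<in> carrier_mat N N \<Longrightarrow> kronecker X (1\<^sub>m m) \<in> carrier_mat (N * m) (N * m)"
  by (auto simp: kronecker_def)

lemma mat_trace_kronecker_one: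
  assumes X: "X \<in> carrier_mat N N" and m: "m > 0"
  shows "mat_trace (kronecker X (1\<^sub>m m)) = of_nat m * mat_trace X"
proof -
  have "mat_trace (kronecker X (1\<^sub>m m)) = (\<Sum>i<N * m. X $$ (i div m, i div m))"
    using X m by (auto simp: mat_trace_def kronecker_def intro!: sum.cong)
  also have "\<dots> = (\<Sum>a<N. \<Sum>i\<in>{a * m..<a * m + m}. X $$ (i div m, i div m))"
    by (rule sum.nat_group[symmetric])
  also have "\<dots> = (\<Sum>a<N. \<Sum>i\<in>{a * m..<a * m + m}. X $$ (a, a))"
    by (intro sum.cong refl) (metis atLeastLessThan_iff add.commute div_nat_eqI mult.commute mult_Suc_right)
  finally show ?thesis using X by (simp add: mat_trace_def sum_distrib_left)
qed

text \<open>The product is again triangular and repeats each diagonal entry \<open>m\<close> times.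
  General matrices are reduced to this case by the Schur form.\<close>

lemma upper_triangular_det_kronecker_one:
  fixes T :: "complex mat"
  assumes T: "T \<in> carrier_mat N N" "upper_triangular T" and m: "m > 0"
  shows "det (kronecker T (1\<^sub>m m)) = det T ^ m"
proof -
  have ut: "upper_triangular (kronecker T (1\<^sub>m m))"
  proof (rule upper_triangularI)
    fix i j assume ij: "j < i" "i < dim_row (kronecker T (1\<^sub>m m))"
    then have i: "i < N * m" using T by (simp add: kronecker_def)
    have "j div m \<le> i div m" using ij by (intro div_le_mono) auto
    moreover have "i mod m \<noteq> j mod m" if "i div m = j div m"
      using ij(1) that by (metis div_mult_mod_eq less_irrefl)
    moreover have "i div m < N" using i m by (simp add: less_mult_imp_div_less)
    ultimately show "kronecker T (1\<^sub>m m) $$ (i, j) = 0"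
      using T i ij m upper_triangularD[OF T(2), of "j div m" "i div m"]
      by (cases "i div m = j div m") (auto simp: kronecker_def)
  qed
  have "det (kronecker T (1\<^sub>m m)) = (\<Prod>i<N * m. T $$ (i div m, i div m))"
    unfolding det_upper_triangular[OF ut kronecker_carrier[OF T(1)]] prod_list_diag_prod
    using T m by (auto simp: kronecker_def atLeast0LessThan intro!: prod.cong)
  also have "\<dots> = (\<Prod>a<N. \<Prod>i\<in>{a * m..<a * m + m}. T $$ (i div m, i div m))"
    by (rule prod.nat_group[symmetric])
  also have "\<dots> = (\<Prod>a<N. \<Prod>i\<in>{a * m..<a * m + m}. T $$ (a, a))"
    by (intro prod.cong refl) (metis atLeastLessThan_iff add.commute div_nat_eqI mult.commute mult_Suc_right)
  also have "\<dots> = det T ^ m"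
    unfolding det_upper_triangular[OF T(2,1)] prod_list_diag_prod
    using T by (simp add: prod_power_distrib atLeast0LessThan)
  finally show ?thesis .
qed

lemma kronecker_diag_ones:
  assumes "m > 0" shows "kronecker (diag_ones k N) (1\<^sub>m m) = diag_ones (k * m) (N * m)"
proof (rule eq_matI)
  fix i j assume "i < dim_row (diag_ones (k * m) (N * m))" "j < dim_col (diag_ones (k * m) (N * m))"
  then have ij: "i < N * m" "j < N * m" by (auto simp: diag_ones_def)
  have "i div m < N" "j div m < N" using ij by (auto simp: less_mult_imp_div_less)
  moreover have "i = j \<longleftrightarrow> i div m = j div m \<and> i mod m = j mod m" by (metis div_mult_mod_eq)
  moreover have "i div m < k \<longleftrightarrow> i < k * m" using assms by (simp add: div_less_iff_less_mult)
  ultimately show "kronecker (diag_ones k N) (1\<^sub>m m) $$ (i, j) = diag_ones (k * m) (N * m) $$ (i, j)"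
    using ij assms by (auto simp: kronecker_def diag_ones_def)
qed (auto simp: kronecker_def diag_ones_def)

section \<open>The tracial state\<close>

context
  fixes N :: nat and A :: "'a::cstar_algebra set" and \<phi> :: "complex mat \<Rightarrow> 'a"
  assumes emb: "unital_star_embedding N A \<phi>"
begin

lemma embedding_in: "X \<in> carrier_mat N N \<Longrightarrow> \<phi> X \<in> A"
  and embedding_one: "\<phi> (1\<^sub>m N) = 1"
  and embedding_add: "X \<in> carrier_mat N N \<Longrightarrow> Y \<in> carrier_mat N N \<Longrightarrow> \<phi> (X + Y) = \<phi> X + \<phi> Y"
  and embedding_mult: "X \<in> carrier_mat N N \<Longrightarrow> Y \<in> carrier_mat N N \<Longrightarrow> \<phi> (X * Y) = \<phi> X * \<phi> Y"
  and embedding_smult: "X \<in> carrier_mat N N \<Longrightarrow> \<phi> (c \<cdot>\<^sub>m X) = c *\<^sub>C \<phi> X"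
  using emb by (auto simp: unital_star_embedding_def)

lemma embedding_eq_iff:
  "X \<in> carrier_mat N N \<Longrightarrow> Y \<in> carrier_mat N N \<Longrightarrow> \<phi> X = \<phi> Y \<longleftrightarrow> X = Y"
  using emb by (auto simp: unital_star_embedding_def inj_on_def)

lemma embedding_zero: "\<phi> (0\<^sub>m N N) = 0"
  using embedding_add[of "0\<^sub>m N N" "0\<^sub>m N N"] by simp

lemma embedding_diff:
  assumes "X \<in> carrier_mat N N" "Y \<in> carrier_mat N N"
  shows "\<phi> (X - Y) = \<phi> X - \<phi> Y"
proof -
  have "X - Y = X + (-1) \<cdot>\<^sub>m Y" using assms by (intro eq_matI) auto
  then show ?thesis using assms by (simp add: embedding_add embedding_smult scaleC_minus_one)
qed

lemma embedding_power: "X \<in> carrier_mat N N \<Longrightarrow> \<phi> (X ^\<^sub>m k) = \<phi> X ^ k"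
proof (induction k)
  case (Suc k)
  then show ?case using pow_carrier_mat[OF Suc.prems, of k]
    by (simp add: embedding_mult power_commutes)
qed (auto simp: embedding_one)

text \<open>A substitute for isometry of the embedding: a nonzero matrix \<open>V\<close> of
  eigenvectors gives \<open>\<phi> X * \<phi> V = \<mu> *\<^sub>C \<phi> V\<close>, and
  \<open>norm (\<phi> V)\<close> cancels.\<close>

lemma eigenvalue_norm_le:
  assumes X: "X \<in> carrier_mat N N" and ev: "eigenvalue X \<mu>"
  shows "cmod \<mu> \<le> norm (\<phi> X)"
proof -
  obtain V where V: "V \<in> carrier_mat N N" "V \<noteq> 0\<^sub>m N N" "X * V = \<mu> \<cdot>\<^sub>m V"
    using eigenvalue_mat[OF X ev] by metis
  have "\<phi> V \<noteq> 0" using V embedding_eq_iff[of V "0\<^sub>m N N"] by (auto simp: embedding_zero)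
  moreover have "\<phi> X * \<phi> V = \<mu> *\<^sub>C \<phi> V"
    using V X by (simp add: embedding_mult[symmetric] embedding_smult)
  then have "cmod \<mu> * norm (\<phi> V) \<le> norm (\<phi> X) * norm (\<phi> V)"
    using norm_mult_ineq[of "\<phi> X" "\<phi> V"] by (simp add: norm_scaleC)
  ultimately show ?thesis by simp
qed

lemma mat_trace_norm_le:
  assumes X: "X \<in> carrier_mat N N"
  shows "cmod (mat_trace X) \<le> real N * norm (\<phi> X)"
proof -
  obtain \<mu> where \<mu>: "\<And>i. i < N \<Longrightarrow> eigenvalue X (\<mu> i)" "\<And>k. mat_trace (X ^\<^sub>m k) = (\<Sum>i<N. \<mu> i ^ k)"
    using power_spectrum[OF X] by metis
  have "mat_trace X = (\<Sum>i<N. \<mu> i)" using \<mu>(2)[of 1] X by simp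
  also have "cmod \<dots> \<le> (\<Sum>i<N. norm (\<phi> X))"
    by (rule sum_norm_le) (use \<mu>(1) eigenvalue_norm_le[OF X] in auto)
  finally show ?thesis by simp
qed

text \<open>Only closedness needs work. Each entry is the trace of a product with a matrix unit,
  hence bounded by the norm of the image, so convergence of the images forces convergence of all
  entries.\<close>

lemma closed_subalgebra_embedding_image: "closed_subalgebra (\<phi> ` carrier_mat N N)"
proof -
  have "closed (\<phi> ` carrier_mat N N)"
    unfolding closed_sequential_limits
  proof (intro allI impI, elim conjE)
    fix x l assume "\<forall>k. x k \<in> \<phi> ` carrier_mat N N" and lim: "x \<longlonglongrightarrow> l"
    then have "\<forall>k. \<exists>X. X \<in> carrier_mat N N \<and> x k = \<phi> X" by blast
    then obtain Y where Y: "\<And>k. Y k \<in> carrier_mat N N" "\<And>k. x k = \<phi> (Y k)" by metis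
    have entry: "X $$ (i, j) = mat_trace (X * unit_mat N j i)"
      if "X \<in> carrier_mat N N" "i < N" "j < N" for X i j
    proof -
      have "(X * unit_mat N j i) $$ (k, k) = (if k = i then X $$ (i, j) else 0)" if "k < N" for k
        using that \<open>X \<in> carrier_mat N N\<close> \<open>i < N\<close> \<open>j < N\<close>
        by (cases "k = i") (auto simp: scalar_prod_def unit_mat_def if_distrib[of "\<lambda>x. _ * x"] cong: if_cong)
      then have "mat_trace (X * unit_mat N j i) = (\<Sum>k<N. if k = i then X $$ (i, j) else 0)"
        using that by (auto simp: mat_trace_def simp del: index_mult_mat(1))
      then show ?thesis using that by simp
    qed
    have bound: "cmod (X $$ (i, j)) \<le> real N * norm (\<phi> (unit_mat N j i)) * norm (\<phi> X)"
      if "X \<in> carrier_mat N N" "i < N" "j < N" for X i j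
    proof -
      have "cmod (X $$ (i, j)) \<le> real N * norm (\<phi> X * \<phi> (unit_mat N j i))"
        using mat_trace_norm_le[of "X * unit_mat N j i"] that entry[OF that] by (simp add: embedding_mult)
      also have "\<dots> \<le> real N * (norm (\<phi> X) * norm (\<phi> (unit_mat N j i)))"
        by (intro mult_left_mono norm_mult_ineq) auto
      finally show ?thesis by (simp add: mult_ac)
    qed
    have Cx: "Cauchy x" using lim by (rule LIMSEQ_imp_Cauchy)
    have "convergent (\<lambda>k. Y k $$ (i, j))" if ij: "i < N" "j < N" for i j
    proof (rule Cauchy_convergent, rule CauchyI)
      fix e :: real assume e: "e > 0"
      define C where "C = real N * norm (\<phi> (unit_mat N j i)) + 1"
      have C: "C > 0" by (simp add: C_def add_nonneg_pos)
      obtain M where M: "\<And>m k. m \<ge> M \<Longrightarrow> k \<ge> M \<Longrightarrow> norm (x m - x k) < e / C"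
        using CauchyD[OF Cx, of "e / C"] e C by auto
      have "cmod (Y m $$ (i, j) - Y k $$ (i, j)) < e" if "m \<ge> M" "k \<ge> M" for m k
      proof -
        have "cmod (Y m $$ (i, j) - Y k $$ (i, j)) \<le> real N * norm (\<phi> (unit_mat N j i)) * norm (x m - x k)"
          using bound[of "Y m - Y k" i j] ij Y(1)[of m] Y(1)[of k] minus_carrier_mat[OF Y(1)]
          by (simp add: Y(2) embedding_diff)
        also have "\<dots> \<le> C * norm (x m - x k)"
          by (intro mult_right_mono) (auto simp: C_def)
        also have "\<dots> < e" using M[OF that] C by (simp add: field_simps)
        finally show ?thesis .
      qed
      then show "\<exists>M. \<forall>m\<ge>M. \<forall>k\<ge>M. cmod (Y m $$ (i, j) - Y k $$ (i, j)) < e" by blast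
    qed
    then obtain z where z: "\<And>i j. i < N \<Longrightarrow> j < N \<Longrightarrow> (\<lambda>k. Y k $$ (i, j)) \<longlonglongrightarrow> z i j"
      unfolding convergent_def by metis
    define Z where "Z = mat N N (\<lambda>(i, j). z i j)"
    have Z: "Z \<in> carrier_mat N N" by (simp add: Z_def)
    have expand: "\<phi> X = (\<Sum>(i, j)\<in>{..<N} \<times> {..<N}. X $$ (i, j) *\<^sub>C \<phi> (unit_mat N i j))"
      if "X \<in> carrier_mat N N" for X
      by (rule linear_mat_expand[OF embedding_add embedding_smult that])
    have "(\<lambda>k. \<Sum>p\<in>{..<N} \<times> {..<N}. Y k $$ p *\<^sub>C \<phi> (unit_mat N (fst p) (snd p))) \<longlonglongrightarrow>
        (\<Sum>p\<in>{..<N} \<times> {..<N}. z (fst p) (snd p) *\<^sub>C \<phi> (unit_mat N (fst p) (snd p)))"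
      by (intro tendsto_sum bounded_linear.tendsto[OF bounded_linear_scaleC_left]) (auto intro: z)
    moreover have "x = (\<lambda>k. \<Sum>p\<in>{..<N} \<times> {..<N}. Y k $$ p *\<^sub>C \<phi> (unit_mat N (fst p) (snd p)))"
      by (rule ext, unfold Y(2), subst expand[OF Y(1)]) (simp add: case_prod_unfold)
    moreover have "\<phi> Z = (\<Sum>p\<in>{..<N} \<times> {..<N}. z (fst p) (snd p) *\<^sub>C \<phi> (unit_mat N (fst p) (snd p)))"
      by (subst expand[OF Z]) (auto simp: Z_def intro!: sum.cong)
    ultimately have "x \<longlonglongrightarrow> \<phi> Z" by simp
    with lim have "l = \<phi> Z" by (rule LIMSEQ_unique)
    with Z show "l \<in> \<phi> ` carrier_mat N N" by blast
  qed
  moreover have "1 \<in> \<phi> ` carrier_mat N N" using embedding_one by (metis image_eqI one_carrier_mat)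
  moreover have "\<phi> X + \<phi> Y \<in> \<phi> ` carrier_mat N N" "\<phi> X * \<phi> Y \<in> \<phi> ` carrier_mat N N"
    "c *\<^sub>C \<phi> X \<in> \<phi> ` carrier_mat N N"
    if "X \<in> carrier_mat N N" "Y \<in> carrier_mat N N" for X Y c
    using that embedding_add[OF that] embedding_mult[OF that] embedding_smult[of X c]
    by (metis image_eqI add_carrier_mat, metis image_eqI mult_carrier_mat, metis image_eqI smult_carrier_mat)
  ultimately show ?thesis unfolding closed_subalgebra_def by auto
qed

end

section \<open>The tower of matrix algebras and its trace\<close>

locale matrix_tower =
  fixes n :: "nat \<Rightarrow> nat" and A :: "'a::cstar_algebra set" and \<phi> :: "nat \<Rightarrow> complex mat \<Rightarrow> 'a"
  assumes pos: "n k > 0"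
    and subalgebra: "unital_cstar_subalgebra A"
    and embedding: "unital_star_embedding (\<Prod>k<K. n k) A (\<phi> K)"
    and connecting: "X \<in> carrier_mat (\<Prod>k<K. n k) (\<Prod>k<K. n k) \<Longrightarrow>
      \<phi> (Suc K) (kronecker X (1\<^sub>m (n K))) = \<phi> K X"
    and dense: "closure (\<Union>K. \<phi> K ` carrier_mat (\<Prod>k<K. n k) (\<Prod>k<K. n k)) = A"
begin

abbreviation msize :: "nat \<Rightarrow> nat" where "msize K \<equiv> \<Prod>k<K. n k"

abbreviation mats :: "nat \<Rightarrow> complex mat set" where "mats K \<equiv> carrier_mat (msize K) (msize K)"

lemma msize_pos: "msize K > 0"
  by (simp add: pos prod_pos)

lemmas closed_A = unital_cstar_imp_closed_subalgebra[OF subalgebra]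
lemmas in_A = subalgebra_intros[OF closed_A]
lemmas emb_in [simp] = embedding_in[OF embedding]
lemmas emb_one [simp] = embedding_one[OF embedding]
lemmas emb_add = embedding_add[OF embedding]
lemmas emb_mult = embedding_mult[OF embedding]
lemmas emb_smult = embedding_smult[OF embedding]
lemmas emb_diff = embedding_diff[OF embedding]
lemmas emb_power = embedding_power[OF embedding]
lemmas emb_eq_iff = embedding_eq_iff[OF embedding]

lemma det_kronecker_one:
  assumes X: "X \<in> mats K"
  shows "det (kronecker X (1\<^sub>m (n K))) = det X ^ n K"
proof -
  define k where "k Y = kronecker Y (1\<^sub>m (n K))" for Y
  obtain T P Q where s: "T \<in> mats K" "P \<in> mats K" "Q \<in> mats K" "P * Q = 1\<^sub>m (msize K)"
    "X = P * T * Q" "upper_triangular T"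
    using complex_schur[OF X] by metis
  have c: "k Y \<in> mats (Suc K)" if "Y \<in> mats K" for Y
    using kronecker_carrier[OF that, of "n K"] by (simp add: k_def mult.commute)
  \<comment> \<open>Read off from the embeddings instead of the entries: both sides have the same
    image under the injective \<open>\<phi> (Suc K)\<close>.\<close>
  have kmult: "k (Y * Z) = k Y * k Z" if "Y \<in> mats K" "Z \<in> mats K" for Y Z
  proof -
    have "\<phi> (Suc K) (k (Y * Z)) = \<phi> (Suc K) (k Y * k Z)"
      using connecting[OF mult_carrier_mat[OF that]] connecting[OF that(1)] connecting[OF that(2)]
        emb_mult[OF c[OF that(1)] c[OF that(2)]] emb_mult[OF that]
      unfolding k_def[symmetric] by simp
    then show ?thesis
      using emb_eq_iff[OF c[OF mult_carrier_mat[OF that]] mult_carrier_mat[OF c[OF that(1)] c[OF that(2)]]]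
      by blast
  qed
  have k1: "k (1\<^sub>m (msize K)) = 1\<^sub>m (msize (Suc K))"
  proof -
    have "\<phi> (Suc K) (k (1\<^sub>m (msize K))) = \<phi> (Suc K) (1\<^sub>m (msize (Suc K)))"
      using connecting[of "1\<^sub>m (msize K)" K] emb_one unfolding k_def by (simp del: prod.lessThan_Suc)
    then show ?thesis using emb_eq_iff[OF c[OF one_carrier_mat] one_carrier_mat] by blast
  qed
  have dT: "det (k T) = det T ^ n K"
    unfolding k_def by (rule upper_triangular_det_kronecker_one[OF s(1,6) pos])
  have "k X = k P * k T * k Q" 
    by (simp only: s(5) kmult[OF mult_carrier_mat[OF s(2) s(1)] s(3)] kmult[OF s(2,1)])
  then have "det (k X) = det (k P) * det (k T) * det (k Q)"
    by (simp only: det_mult[OF mult_carrier_mat[OF c[OF s(2)] c[OF s(1)]] c[OF s(3)]]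
        det_mult[OF c[OF s(2)] c[OF s(1)]])
  moreover have "det (k P) * det (k Q) = 1"
    using det_mult[OF c[OF s(2)] c[OF s(3)]] kmult[OF s(2,3)] k1 s(4)
    by (metis det_one)
  moreover have "det X = det T"
  proof -
    have "det P * det Q = 1" using s(4) det_mult[OF s(2,3)] by simp
    moreover have "det X = det P * det T * det Q"
      by (simp only: s(5) det_mult[OF mult_carrier_mat[OF s(2) s(1)] s(3)] det_mult[OF s(2) s(1)])
    ultimately show ?thesis by (simp add: mult.commute mult.left_commute)
  qed
  ultimately show ?thesis using dT by (simp add: k_def mult.commute mult.left_commute)
qed

text \<open>Enlarging the level preserves the normalized trace and every logarithm of the
  determinant divided by the size. The latter is stated through \<open>exp\<close> so that no branch
  is chosen.\<close>

lemma emb_lift: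
  assumes "K \<le> K'" and X: "X \<in> mats K"
  obtains X' where "X' \<in> mats K'" "\<phi> K' X' = \<phi> K X"
    "mat_trace X' / of_nat (msize K') = mat_trace X / of_nat (msize K)"
    "\<And>d. det X = exp (of_nat (msize K) * d) \<Longrightarrow> det X' = exp (of_nat (msize K') * d)"
proof -
  have "\<exists>X'. X' \<in> mats K' \<and> \<phi> K' X' = \<phi> K X \<and>
      mat_trace X' / of_nat (msize K') = mat_trace X / of_nat (msize K) \<and>
      (\<forall>d. det X = exp (of_nat (msize K) * d) \<longrightarrow> det X' = exp (of_nat (msize K') * d))"
    using assms(1)
  proof (induction K' rule: dec_induct)
    case base
    then show ?case using X by auto
  next
    case (step k)
    then obtain Y where Y: "Y \<in> mats k" "\<phi> k Y = \<phi> K X"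
      "mat_trace Y / of_nat (msize k) = mat_trace X / of_nat (msize K)"
      "\<And>d. det X = exp (of_nat (msize K) * d) \<Longrightarrow> det Y = exp (of_nat (msize k) * d)"
      by blast
    define Y' where "Y' = kronecker Y (1\<^sub>m (n k))"
    have "Y' \<in> mats (Suc k)"
      using kronecker_carrier[OF Y(1), of "n k"] by (simp add: Y'_def mult.commute)
    moreover have "\<phi> (Suc k) Y' = \<phi> K X" using connecting[OF Y(1)] Y(2) by (simp add: Y'_def)
    moreover have "mat_trace Y' / of_nat (msize (Suc k)) = mat_trace X / of_nat (msize K)"
      using mat_trace_kronecker_one[OF Y(1) pos] Y(3) pos[of k] by (simp add: Y'_def)
    moreover have "det Y' = exp (of_nat (msize (Suc k)) * d)" if "det X = exp (of_nat (msize K) * d)" for d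
      using Y(4)[OF that] by (simp add: Y'_def det_kronecker_one[OF Y(1)] exp_of_nat_mult[symmetric] mult_ac)
    ultimately show ?case by blast
  qed
  with that show ?thesis by blast
qed

definition union :: "'a set" where
  "union = (\<Union>K. \<phi> K ` mats K)"

lemma union_subset: "union \<subseteq> A"
  by (subst dense[symmetric]) (simp add: union_def closure_subset)

lemma emb_dense:
  assumes x: "x \<in> A" and e: "e > 0"
  obtains K X where "K \<ge> K0" "X \<in> mats K" "norm (\<phi> K X - x) < e"
proof -
  from x obtain y where y: "y \<in> union" "dist y x < e"
    using e unfolding dense[symmetric] union_def[symmetric] closure_approachable by blast
  then obtain K X where X: "X \<in> mats K" "y = \<phi> K X" by (auto simp: union_def)
  obtain X' where "X' \<in> mats (max K K0)" "\<phi> (max K K0) X' = \<phi> K X"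
    using emb_lift[OF max.cobounded1 X(1)] by metis
  with y X show ?thesis using that[of "max K K0" X'] by (simp add: dist_norm)
qed

lemma common_level:
  assumes "x \<in> union" "y \<in> union"
  obtains K X Y where "X \<in> mats K" "Y \<in> mats K" "x = \<phi> K X" "y = \<phi> K Y"
proof -
  obtain K1 X1 K2 X2 where 1: "X1 \<in> mats K1" "x = \<phi> K1 X1" "X2 \<in> mats K2" "y = \<phi> K2 X2"
    using assms by (auto simp: union_def)
  obtain X where "X \<in> mats (max K1 K2)" "\<phi> (max K1 K2) X = \<phi> K1 X1"
    using emb_lift[OF max.cobounded1 1(1)] by metis
  moreover obtain Y where "Y \<in> mats (max K1 K2)" "\<phi> (max K1 K2) Y = \<phi> K2 X2"
    using emb_lift[OF max.cobounded2 1(3)] by metis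
  ultimately show ?thesis using that 1 by metis
qed

text \<open>The normalized trace is independent of the level and 1-Lipschitz on the union, hence
  extends to the closure.\<close>

lemma tracial_state_exists:
  "\<exists>t. continuous_on A t \<and> (\<forall>K. \<forall>X\<in>mats K. t (\<phi> K X) = mat_trace X / of_nat (msize K))"
proof -
  have wd: "mat_trace X / of_nat (msize K) = mat_trace Y / of_nat (msize K')"
    if X: "X \<in> mats K" and Y: "Y \<in> mats K'" and eq: "\<phi> K X = \<phi> K' Y" for K K' X Y
  proof -
    obtain X' where X': "X' \<in> mats (max K K')" "\<phi> (max K K') X' = \<phi> K X"
      "mat_trace X' / of_nat (msize (max K K')) = mat_trace X / of_nat (msize K)"
      using emb_lift[OF max.cobounded1 X] by metis
    obtain Y' where Y': "Y' \<in> mats (max K K')" "\<phi> (max K K') Y' = \<phi> K' Y"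
      "mat_trace Y' / of_nat (msize (max K K')) = mat_trace Y / of_nat (msize K')"
      using emb_lift[OF max.cobounded2 Y] by metis
    have "X' = Y'" using X' Y' eq emb_eq_iff by metis
    with X' Y' show ?thesis by simp
  qed
  define f where "f x = (SOME t. \<exists>K X. X \<in> mats K \<and> x = \<phi> K X \<and> t = mat_trace X / of_nat (msize K))" for x
  have f: "f (\<phi> K X) = mat_trace X / of_nat (msize K)" if X: "X \<in> mats K" for K X
    unfolding f_def
  proof (rule some_equality)
    fix t assume "\<exists>K' Y. Y \<in> mats K' \<and> \<phi> K X = \<phi> K' Y \<and> t = mat_trace Y / of_nat (msize K')"
    then show "t = mat_trace X / of_nat (msize K)" using wd[OF X] by metis
  qed (use X in blast)
  have lip: "dist (f x) (f y) \<le> dist x y" if xy: "x \<in> union" "y \<in> union" for x y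
  proof -
    obtain K X Y where K: "X \<in> mats K" "Y \<in> mats K" "x = \<phi> K X" "y = \<phi> K Y"
      using common_level[OF xy] by metis
    have XY: "X - Y \<in> mats K" using K by auto
    have "mat_trace (X - Y) = mat_trace X - mat_trace Y"
      using K by (auto simp: mat_trace_def sum_subtractf)
    then have "f x - f y = mat_trace (X - Y) / of_nat (msize K)"
      using K by (simp add: f diff_divide_distrib)
    moreover have "cmod (mat_trace (X - Y)) \<le> real (msize K) * norm (x - y)"
      using mat_trace_norm_le[OF embedding XY] K by (simp add: emb_diff)
    ultimately show ?thesis using msize_pos[of K]
      by (simp add: dist_norm norm_divide divide_le_eq mult.commute del: of_nat_prod)
  qed
  have "uniformly_continuous_on union f"
    unfolding uniformly_continuous_on_def using lip by (meson le_less_trans)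
  then obtain g where g: "uniformly_continuous_on (closure union) g" "\<And>x. x \<in> union \<Longrightarrow> f x = g x"
    by (rule uniformly_continuous_on_extension_on_closure) blast
  have "continuous_on A g"
    using uniformly_continuous_imp_continuous[OF g(1)] dense by (simp add: union_def)
  moreover have "g (\<phi> K X) = mat_trace X / of_nat (msize K)" if "X \<in> mats K" for K X
  proof -
    have "\<phi> K X \<in> union" using that by (auto simp: union_def)
    then show ?thesis using f[OF that] g(2) by simp
  qed
  ultimately show ?thesis by blast
qed

definition tau :: "'a \<Rightarrow> complex" where
  "tau = (SOME t. continuous_on A t \<and> (\<forall>K. \<forall>X\<in>mats K. t (\<phi> K X) = mat_trace X / of_nat (msize K)))"

lemma continuous_on_tau: "continuous_on A tau"
  and tau_emb: "X \<in> mats K \<Longrightarrow> tau (\<phi> K X) = mat_trace X / of_nat (msize K)"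
  using someI_ex[OF tracial_state_exists] unfolding tau_def[symmetric] by auto

lemma tendsto_tau: "s \<longlonglongrightarrow> x \<Longrightarrow> x \<in> A \<Longrightarrow> (\<And>i. s i \<in> A) \<Longrightarrow> (\<lambda>i. tau (s i)) \<longlonglongrightarrow> tau x"
  by (rule continuous_on_tendsto_compose[OF continuous_on_tau]) auto

lemma union_sequence:
  assumes "x \<in> A"
  obtains s where "\<And>i. s i \<in> union" "s \<longlonglongrightarrow> x"
  using assms unfolding dense[symmetric] union_def[symmetric] closure_sequential by blast

text \<open>Any two elements of the dense union lie in a common matrix algebra, so an identity
  between continuous expressions in two variables only has to be checked on matrices of one
  level.\<close>

lemma tau_two:
  assumes "\<And>K X Y. X \<in> mats K \<Longrightarrow> Y \<in> mats K \<Longrightarrow> F (\<phi> K X) (\<phi> K Y) = (G (\<phi> K X) (\<phi> K Y) :: complex)"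
    and "\<And>s t x y. s \<longlonglongrightarrow> x \<Longrightarrow> t \<longlonglongrightarrow> y \<Longrightarrow> x \<in> A \<Longrightarrow> y \<in> A \<Longrightarrow> (\<And>i. s i \<in> A) \<Longrightarrow> (\<And>i. t i \<in> A) \<Longrightarrow>
      (\<lambda>i. F (s i) (t i)) \<longlonglongrightarrow> F x y"
    and "\<And>s t x y. s \<longlonglongrightarrow> x \<Longrightarrow> t \<longlonglongrightarrow> y \<Longrightarrow> x \<in> A \<Longrightarrow> y \<in> A \<Longrightarrow> (\<And>i. s i \<in> A) \<Longrightarrow> (\<And>i. t i \<in> A) \<Longrightarrow>
      (\<lambda>i. G (s i) (t i)) \<longlonglongrightarrow> G x y"
    and x: "x \<in> A" and y: "y \<in> A"
  shows "F x y = G x y"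
proof -
  obtain s where s: "\<And>i. s i \<in> union" "s \<longlonglongrightarrow> x" using union_sequence[OF x] by metis
  obtain t where t: "\<And>i. t i \<in> union" "t \<longlonglongrightarrow> y" using union_sequence[OF y] by metis
  have sA: "\<And>i. s i \<in> A" "\<And>i. t i \<in> A" using s t union_subset by auto
  have eq: "F (s i) (t i) = G (s i) (t i)" for i
    using common_level[OF s(1) t(1), of i i] assms(1) by metis
  show ?thesis
    using assms(2)[OF s(2) t(2) x y sA] assms(3)[OF s(2) t(2) x y sA] unfolding eq by (rule LIMSEQ_unique)
qed

lemma tau_add: "x \<in> A \<Longrightarrow> y \<in> A \<Longrightarrow> tau (x + y) = tau x + tau y"
  by (rule tau_two[of "\<lambda>x y. tau (x + y)" "\<lambda>x y. tau x + tau y"])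
    (auto intro!: tendsto_intros tendsto_tau in_A
      simp: emb_add[symmetric] tau_emb mat_trace_add[of _ "msize _"] add_divide_distrib)

lemma tau_mult_commute: "x \<in> A \<Longrightarrow> y \<in> A \<Longrightarrow> tau (x * y) = tau (y * x)"
  by (rule tau_two[of "\<lambda>x y. tau (x * y)" "\<lambda>x y. tau (y * x)"])
    (auto intro!: tendsto_intros tendsto_tau in_A
      simp: emb_mult[symmetric] tau_emb mat_trace_mult_commute[of _ "msize _"] mult_carrier_mat[of _ "msize _" "msize _" _ "msize _"])

lemma tau_scaleC: "x \<in> A \<Longrightarrow> tau (c *\<^sub>C x) = c * tau x"
  by (rule tau_two[of "\<lambda>x y. tau (c *\<^sub>C x)" "\<lambda>x y. c * tau x" x x])
    (auto intro!: tendsto_intros tendsto_tau in_A bounded_linear.tendsto[OF bounded_linear_scaleC_right]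
      simp: emb_smult[symmetric] tau_emb mat_trace_smult[of _ "msize _"])

lemma tau_one: "tau 1 = 1"
  using tau_emb[of "1\<^sub>m (msize 0)" 0] emb_one[of 0] by (simp add: mat_trace_one)

lemma norm_tau_le:
  assumes x: "x \<in> A" shows "cmod (tau x) \<le> norm x"
proof -
  obtain s where s: "\<And>i. s i \<in> union" "s \<longlonglongrightarrow> x" using union_sequence[OF x] by metis
  have sA: "\<And>i. s i \<in> A" using s union_subset by auto
  have "cmod (tau (s i)) \<le> norm (s i)" for i
  proof -
    obtain K X where X: "X \<in> mats K" "s i = \<phi> K X" using s(1)[of i] by (auto simp: union_def)
    show ?thesis using mat_trace_norm_le[OF embedding X(1)] msize_pos[of K] X
      by (simp add: tau_emb norm_divide divide_le_eq mult.commute del: of_nat_prod)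
  qed
  then show ?thesis
    by (intro LIMSEQ_le[OF tendsto_norm[OF tendsto_tau[OF s(2) x sA]] tendsto_norm[OF s(2)]]) auto
qed

end

section \<open>The logarithm of the determinant near 1\<close>

context matrix_tower
begin

text \<open>The trace of the principal logarithm; the summand for \<open>k = 0\<close> vanishes because \<open>x / 0 = 0\<close>.\<close>

definition logtr :: "'a \<Rightarrow> complex" where
  "logtr c = (\<Sum>k. - tau ((1 - c) ^ k) / of_nat k)"

lemma msize_neq_0: "of_nat (msize K) \<noteq> (0::complex)"
  using msize_pos[of K] by (metis neq0_conv of_nat_eq_0_iff)

text \<open>The eigenvalues of \<open>1 - X\<close> have modulus below 1, so the series of
  \<open>ln (1 - \<mu>)\<close> can be summed over them; the factor \<open>msize K\<close> undoes
  the normalization of \<open>tau\<close>.\<close>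

lemma det_eq_exp_logtr:
  assumes X: "X \<in> mats K" and near: "norm (\<phi> K X - 1) < 1"
  shows "det X = exp (of_nat (msize K) * logtr (\<phi> K X))"
proof -
  define Y where "Y = 1\<^sub>m (msize K) - X"
  have Y: "Y \<in> mats K" using X by (auto simp: Y_def)
  have pY: "\<phi> K Y = 1 - \<phi> K X" using X by (simp add: Y_def emb_diff)
  obtain \<mu> where \<mu>: "\<And>i. i < msize K \<Longrightarrow> eigenvalue Y (\<mu> i)"
    "\<And>k. mat_trace (Y ^\<^sub>m k) = (\<Sum>i<msize K. \<mu> i ^ k)"
    "\<And>z. det (1\<^sub>m (msize K) - z \<cdot>\<^sub>m Y) = (\<Prod>i<msize K. 1 - z * \<mu> i)"
    using power_spectrum[OF Y] by metis
  have small: "cmod (\<mu> i) < 1" if "i < msize K" for i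
    using eigenvalue_norm_le[OF embedding Y \<mu>(1)[OF that]] near by (simp add: pY norm_minus_commute)
  note N0 = msize_neq_0[of K]
  have "(\<lambda>k. \<Sum>i<msize K. - (\<mu> i ^ k) / of_nat k) sums (\<Sum>i<msize K. ln (1 - \<mu> i))"
    by (rule sums_sum) (use Ln_series'[of "- \<mu> i" for i] small in auto)
  moreover have "(\<Sum>i<msize K. - (\<mu> i ^ k) / of_nat k) =
      of_nat (msize K) * (- tau ((1 - \<phi> K X) ^ k) / of_nat k)" for k
  proof -
    have "tau ((1 - \<phi> K X) ^ k) = (\<Sum>i<msize K. \<mu> i ^ k) / of_nat (msize K)"
      using tau_emb[OF pow_carrier_mat[OF Y, of k]] Y by (simp add: emb_power pY \<mu>(2))
    then have "of_nat (msize K) * tau ((1 - \<phi> K X) ^ k) = (\<Sum>i<msize K. \<mu> i ^ k)"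
      using N0 by simp
    then show ?thesis by (simp add: sum_negf sum_divide_distrib[symmetric] del: of_nat_prod)
  qed
  ultimately have "(\<lambda>k. of_nat (msize K) * (- tau ((1 - \<phi> K X) ^ k) / of_nat k)) sums (\<Sum>i<msize K. ln (1 - \<mu> i))"
    by simp
  from sums_mult_D[OF this N0]
  have "logtr (\<phi> K X) = (\<Sum>i<msize K. ln (1 - \<mu> i)) / of_nat (msize K)"
    unfolding logtr_def by (rule sums_unique[symmetric])
  then have "of_nat (msize K) * logtr (\<phi> K X) = (\<Sum>i<msize K. ln (1 - \<mu> i))"
    using N0 by simp
  moreover have "exp (\<Sum>i<msize K. ln (1 - \<mu> i)) = (\<Prod>i<msize K. 1 - \<mu> i)"
    unfolding exp_sum[OF finite_lessThan] by (intro prod.cong refl exp_Ln) (use small in force)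
  moreover have "det X = (\<Prod>i<msize K. 1 - \<mu> i)"
  proof -
    have "X = 1\<^sub>m (msize K) - 1 \<cdot>\<^sub>m Y" using X by (intro eq_matI) (auto simp: Y_def)
    then show ?thesis using \<mu>(3)[of 1] by simp
  qed
  ultimately show ?thesis by simp
qed

text \<open>The radius 3/4 gives a geometric majorant and still contains products of two elements
  within 1/4 of 1, which are within 9/16.\<close>

lemma continuous_on_logtr: "continuous_on {c \<in> A. norm (c - 1) \<le> 3/4} logtr"
  unfolding logtr_def
proof (rule uniform_limit_theorem[OF _ Weierstrass_m_test])
  have cp: "continuous_on {c \<in> A. norm (c - 1) \<le> 3/4} (\<lambda>c. tau ((1 - c) ^ k))" for k
  proof (rule continuous_on_compose2[OF continuous_on_tau])
    show "continuous_on {c \<in> A. norm (c - 1) \<le> 3/4} (\<lambda>c. (1 - c) ^ k)" by (intro continuous_intros)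
  qed (auto intro: in_A)
  show "\<forall>\<^sub>F m in sequentially. continuous_on {c \<in> A. norm (c - 1) \<le> 3/4}
      (\<lambda>c. \<Sum>k<m. - tau ((1 - c) ^ k) / of_nat k)"
  proof (intro always_eventually allI continuous_on_sum)
    fix k
    have "(\<lambda>c. - tau ((1 - c) ^ k) / of_nat k) = (\<lambda>c. tau ((1 - c) ^ k) * (- inverse (of_nat k)))"
      by (simp add: divide_inverse)
    then show "continuous_on {c \<in> A. norm (c - 1) \<le> 3/4} (\<lambda>c. - tau ((1 - c) ^ k) / of_nat k)"
      by (simp only:) (intro continuous_on_mult cp continuous_on_const)
  qed
  show "summable (\<lambda>k. (3/4::real) ^ k)" by (rule summable_geometric) simp
  show "norm (- tau ((1 - c) ^ k) / of_nat k) \<le> (3/4) ^ k" if "c \<in> {c \<in> A. norm (c - 1) \<le> 3/4}" for k c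
  proof -
    have "cmod (tau ((1 - c) ^ k)) \<le> norm ((1 - c) ^ k)"
      using that by (intro norm_tau_le in_A) auto
    also have "\<dots> \<le> norm (1 - c) ^ k" by (rule norm_power_ineq)
    also have "\<dots> \<le> (3/4) ^ k" using that by (intro power_mono) (auto simp: norm_minus_commute)
    finally have 1: "cmod (tau ((1 - c) ^ k)) \<le> (3/4) ^ k" .
    have "norm (- tau ((1 - c) ^ k) / of_nat k) \<le> cmod (tau ((1 - c) ^ k))"
      by (cases "k = 0") (auto simp: norm_divide divide_le_eq mult_le_cancel_left1)
    with 1 show ?thesis by linarith
  qed
qed simp

lemma tau_zero: "tau 0 = 0"
  using tau_add[of 0 0] in_A(2) by simp

lemma logtr_one: "logtr 1 = 0"
proof -
  have *: "(\<lambda>k. - tau ((1 - 1) ^ k) / of_nat k) = (\<lambda>k. 0)"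
    by (rule ext, case_tac k) (auto simp: tau_zero)
  show ?thesis unfolding logtr_def * by simp
qed

lemma norm_mult_near_one:
  fixes a b :: 'a
  assumes "norm (a - 1) \<le> r" "norm (b - 1) \<le> s"
  shows "norm (a * b - 1) \<le> r + s + r * s"
proof -
  have "a * b - 1 = (a - 1) + (b - 1) + (a - 1) * (b - 1)" by (simp add: algebra_simps)
  also have "norm \<dots> \<le> norm (a - 1) + norm (b - 1) + norm (a - 1) * norm (b - 1)"
    by (intro norm_triangle_le add_mono norm_mult_ineq order_refl norm_triangle_ineq)
  also have "\<dots> \<le> r + s + r * s"
    using assms order_trans[OF norm_ge_zero assms(1)] by (intro add_mono mult_mono) auto
  finally show ?thesis .
qed

text \<open>Along the segments from 1 to the two factors, the size times the defect of additivity is a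
  continuous logarithm of 1.\<close>

lemma logtr_mult_emb:
  assumes X: "X \<in> mats K" "norm (\<phi> K X - 1) < 1/4" and Y: "Y \<in> mats K" "norm (\<phi> K Y - 1) < 1/4"
  shows "logtr (\<phi> K X * \<phi> K Y) = logtr (\<phi> K X) + logtr (\<phi> K Y)"
proof -
  define path where "path Z t = 1\<^sub>m (msize K) + complex_of_real t \<cdot>\<^sub>m (Z - 1\<^sub>m (msize K))" for Z t
  have path: "path Z t \<in> mats K" and phipath: "\<phi> K (path Z t) = 1 + t *\<^sub>R (\<phi> K Z - 1)"
    if "Z \<in> mats K" for Z t
    using that by (auto simp: path_def emb_add emb_smult emb_diff scaleR_scaleC minus_carrier_mat)
  have near: "norm (1 + t *\<^sub>R (\<phi> K Z - 1) - 1) \<le> 1/4" if "norm (\<phi> K Z - 1) < 1/4" "t \<in> {0..1}" for Z t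
    using mult_mono[of "\<bar>t\<bar>" 1 "norm (\<phi> K Z - 1)" "1/4"] that by auto
  define a where "a t = 1 + t *\<^sub>R (\<phi> K X - 1)" for t
  define b where "b t = 1 + t *\<^sub>R (\<phi> K Y - 1)" for t
  have nab: "norm (a t - 1) \<le> 1/4" "norm (b t - 1) \<le> 1/4" "norm (a t * b t - 1) \<le> 3/4" if "t \<in> {0..1}" for t
  proof -
    show 1: "norm (a t - 1) \<le> 1/4" "norm (b t - 1) \<le> 1/4"
      using near[OF X(2) that] near[OF Y(2) that] by (simp_all add: a_def b_def)
    show "norm (a t * b t - 1) \<le> 3/4"
      using norm_mult_near_one[OF 1] by simp
  qed
  have nab34: "norm (a t - 1) \<le> 3/4" "norm (b t - 1) \<le> 3/4" if "t \<in> {0..1}" for t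
    using nab(1,2)[OF that] by linarith+
  have abA: "a t \<in> A" "b t \<in> A" for t
    using X(1) Y(1) by (auto simp: a_def b_def intro!: in_A)
  define f where "f t = of_nat (msize K) * (logtr (a t * b t) - logtr (a t) - logtr (b t))" for t
  have "continuous_on {0..1} a" "continuous_on {0..1} b"
    unfolding a_def b_def by (intro continuous_intros)+
  then have cont: "continuous_on {0..1} f"
    unfolding f_def using nab(3) nab34 abA
    by (intro continuous_intros continuous_on_compose2[OF continuous_on_logtr])
      (auto intro!: in_A intro: order_trans continuous_on_mult simp: subset_eq)
  have ef: "exp (f t) = 1" if t: "t \<in> {0..1}" for t
  proof -
    have e: "\<phi> K (path X t) = a t" "\<phi> K (path Y t) = b t" "\<phi> K (path X t * path Y t) = a t * b t"
      using X Y path by (simp_all add: phipath a_def b_def emb_mult)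
    have c: "path X t \<in> mats K" "path Y t \<in> mats K" "path X t * path Y t \<in> mats K"
      using X Y path by (auto intro: mult_carrier_mat)
    have "exp (of_nat (msize K) * logtr (a t * b t)) = det (path X t * path Y t)"
      using det_eq_exp_logtr[OF c(3)] nab(3)[OF t] by (simp add: e)
    also have "\<dots> = exp (of_nat (msize K) * logtr (a t)) * exp (of_nat (msize K) * logtr (b t))"
      unfolding det_mult[OF c(1,2)]
      using det_eq_exp_logtr[OF c(1)] det_eq_exp_logtr[OF c(2)] nab(1,2)[OF t] by (simp add: e)
    finally show ?thesis by (simp add: f_def right_diff_distrib exp_diff exp_add[symmetric])
  qed
  have "f constant_on {0..1}"
  proof (rule continuous_discrete_range_constant[OF _ cont])
    fix x :: real assume x: "x \<in> {0..1}"
    \<comment> \<open>Distinct logarithms of 1 differ by at least \<open>2 * pi\<close> in the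
      imaginary part, hence by at least 1.\<close>
    have "1 \<le> norm (f y - f x)" if "y \<in> {0..1}" "f y \<noteq> f x" for y
    proof (rule ccontr)
      assume "\<not> ?thesis"
      then have "\<bar>Im (f y) - Im (f x)\<bar> < 1" using abs_Im_le_cmod[of "f y - f x"] by simp
      then have "\<bar>Im (f y) - Im (f x)\<bar> < 2 * pi" using pi_gt3 by linarith
      then have "f y = f x" by (rule exp_complex_eqI) (simp add: ef[OF x] ef[OF that(1)])
      with that show False by simp
    qed
    then show "\<exists>e>0. \<forall>y. y \<in> {0..1} \<and> f y \<noteq> f x \<longrightarrow> e \<le> norm (f y - f x)"
      by (intro exI[of _ 1]) auto
  qed simp
  then have "f 1 = f 0" unfolding constant_on_def by (metis atLeastAtMost_iff order_refl zero_le_one)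
  moreover have "f 0 = 0" by (simp add: f_def a_def b_def logtr_one)
  ultimately have "f 1 = 0" by (rule trans)
  then have "of_nat (msize K) * (logtr (\<phi> K X * \<phi> K Y) - logtr (\<phi> K X) - logtr (\<phi> K Y)) = 0"
    by (simp only: f_def a_def b_def scaleR_one add_diff_cancel_left' diff_add_cancel add.commute[of 1])
  then have "logtr (\<phi> K X * \<phi> K Y) - logtr (\<phi> K X) - logtr (\<phi> K Y) = 0"
    using msize_neq_0 mult_eq_0_iff by blast
  then show ?thesis by (simp add: algebra_simps)
qed

text \<open>Passes to the limit from matrices. The strict bounds put the approximants into the same
  balls eventually.\<close>

lemma logtr_mult:
  assumes a: "a \<in> A" "norm (a - 1) < 1/4" and b: "b \<in> A" "norm (b - 1) < 1/4"
  shows "logtr (a * b) = logtr a + logtr b"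
proof -
  obtain s where s: "\<And>i. s i \<in> union" "s \<longlonglongrightarrow> a" using union_sequence[OF a(1)] by metis
  obtain t where t: "\<And>i. t i \<in> union" "t \<longlonglongrightarrow> b" using union_sequence[OF b(1)] by metis
  have stA: "\<And>i. s i \<in> A" "\<And>i. t i \<in> A" using s t union_subset by auto
  have es: "\<forall>\<^sub>F i in sequentially. norm (s i - 1) < 1/4"
    by (rule order_tendstoD(2)[OF tendsto_norm[OF tendsto_diff[OF s(2) tendsto_const]] a(2)])
  have et: "\<forall>\<^sub>F i in sequentially. norm (t i - 1) < 1/4"
    by (rule order_tendstoD(2)[OF tendsto_norm[OF tendsto_diff[OF t(2) tendsto_const]] b(2)])
  have mult: "norm (x * y - 1) \<le> 3/4" if "norm (x - 1) < 1/4" "norm (y - 1) < 1/4" for x y :: 'a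
    using norm_mult_near_one[of x "1/4" y "1/4"] that by simp
  have lim: "(\<lambda>i. logtr (g i)) \<longlonglongrightarrow> logtr x"
    if "g \<longlonglongrightarrow> x" "x \<in> A" "norm (x - 1) \<le> 3/4" "\<And>i. g i \<in> A" "\<forall>\<^sub>F i in sequentially. norm (g i - 1) \<le> 3/4"
    for g x
    by (rule continuous_on_tendsto_compose[OF continuous_on_logtr that(1)]) (use that in auto)
  have 1: "(\<lambda>i. logtr (s i * t i)) \<longlonglongrightarrow> logtr (a * b)"
    by (rule lim[OF tendsto_mult[OF s(2) t(2)]])
      (use a b stA mult eventually_elim2[OF es et, of "\<lambda>i. norm (s i * t i - 1) \<le> 3/4"] in \<open>auto intro: in_A\<close>)
  have "(\<lambda>i. logtr (s i) + logtr (t i)) \<longlonglongrightarrow> logtr a + logtr b"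
    using a b stA by (intro tendsto_add lim s(2) t(2) eventually_mono[OF es] eventually_mono[OF et]) auto
  moreover have "\<forall>\<^sub>F i in sequentially. logtr (s i) + logtr (t i) = logtr (s i * t i)"
    using es et
  proof eventually_elim
    case (elim i)
    obtain K X Y where "X \<in> mats K" "Y \<in> mats K" "s i = \<phi> K X" "t i = \<phi> K Y"
      using common_level[OF s(1) t(1)] by metis
    with elim show ?case using logtr_mult_emb by simp
  qed
  ultimately have "(\<lambda>i. logtr (s i * t i)) \<longlonglongrightarrow> logtr a + logtr b"
    by (rule Lim_transform_eventually)
  with 1 show ?thesis by (rule LIMSEQ_unique)
qed

section \<open>Invariance of \<open>logtr\<close> under conjugation and endomorphisms\<close>

lemma logtr_conj:
  assumes "s \<in> A" "s' \<in> A" "s * s' = 1" "s' * s = 1" "c \<in> A"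
  shows "logtr (s' * c * s) = logtr c"
proof -
  have p: "(1 - s' * c * s) ^ k = s' * (1 - c) ^ k * s" for k
  proof (induction k)
    case (Suc k)
    have "(1 - s' * c * s) ^ Suc k = (s' * (1 - c) * s) * (s' * (1 - c) ^ k * s)"
      using Suc assms(4) by (simp add: algebra_simps)
    also have "\<dots> = s' * (1 - c) * (s * s') * (1 - c) ^ k * s" by (simp only: mult.assoc)
    finally show ?case by (simp add: assms(3) mult.assoc)
  qed (simp add: assms)
  have "tau ((1 - s' * c * s) ^ k) = tau ((1 - c) ^ k)" for k
  proof -
    have "tau (s' * ((1 - c) ^ k * s)) = tau ((1 - c) ^ k * s * s')"
      by (rule tau_mult_commute) (use assms in \<open>auto intro: in_A\<close>)
    then show ?thesis unfolding p by (simp add: mult.assoc assms(3))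
  qed
  then show ?thesis by (simp add: logtr_def)
qed

text \<open>The structure that survives conjugation of a *-automorphism by an invertible element:
  adjoints may be lost, and the norm is controlled by a constant only.\<close>

definition bounded_endo :: "real \<Rightarrow> ('a \<Rightarrow> 'a) \<Rightarrow> bool" where
  "bounded_endo C \<theta> \<longleftrightarrow> \<theta> 1 = 1 \<and> (\<forall>x\<in>A. \<theta> x \<in> A \<and> norm (\<theta> x) \<le> C * norm x) \<and>
     (\<forall>x\<in>A. \<forall>y\<in>A. \<theta> (x + y) = \<theta> x + \<theta> y \<and> \<theta> (x * y) = \<theta> x * \<theta> y) \<and>
     (\<forall>c. \<forall>x\<in>A. \<theta> (c *\<^sub>C x) = c *\<^sub>C \<theta> x)"

lemma bounded_endoD:
  assumes "bounded_endo C \<theta>"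
  shows "\<theta> 1 = 1" "x \<in> A \<Longrightarrow> \<theta> x \<in> A" "x \<in> A \<Longrightarrow> norm (\<theta> x) \<le> C * norm x"
    "x \<in> A \<Longrightarrow> y \<in> A \<Longrightarrow> \<theta> (x + y) = \<theta> x + \<theta> y" "x \<in> A \<Longrightarrow> y \<in> A \<Longrightarrow> \<theta> (x * y) = \<theta> x * \<theta> y"
    "x \<in> A \<Longrightarrow> \<theta> (c *\<^sub>C x) = c *\<^sub>C \<theta> x"
    "x \<in> A \<Longrightarrow> y \<in> A \<Longrightarrow> \<theta> (x - y) = \<theta> x - \<theta> y"
    "x \<in> A \<Longrightarrow> \<theta> (x ^ k) = \<theta> x ^ k" "C \<ge> 1"
proof -
  show 1: "\<theta> 1 = 1" "x \<in> A \<Longrightarrow> \<theta> x \<in> A" "x \<in> A \<Longrightarrow> norm (\<theta> x) \<le> C * norm x"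
    "x \<in> A \<Longrightarrow> y \<in> A \<Longrightarrow> \<theta> (x + y) = \<theta> x + \<theta> y" "x \<in> A \<Longrightarrow> y \<in> A \<Longrightarrow> \<theta> (x * y) = \<theta> x * \<theta> y"
    "x \<in> A \<Longrightarrow> \<theta> (c *\<^sub>C x) = c *\<^sub>C \<theta> x" for x y c
    using assms by (auto simp: bounded_endo_def)
  show "x \<in> A \<Longrightarrow> y \<in> A \<Longrightarrow> \<theta> (x - y) = \<theta> x - \<theta> y"
    using 1(4)[of x "(-1) *\<^sub>C y"] 1(6)[of y "-1"] in_A by (simp add: scaleC_minus_one)
  show "x \<in> A \<Longrightarrow> \<theta> (x ^ k) = \<theta> x ^ k"
    by (induction k) (auto simp: 1 in_A)
  show "C \<ge> 1" using 1(3)[OF in_A(1)] 1(1) by simp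
qed

text \<open>On each matrix algebra \<open>tau\<close> composed with \<open>\<theta>\<close> is a
  normalized trace, whether or not \<open>\<theta>\<close> preserves that algebra. Uniqueness
  applies there, and the bound on \<open>\<theta>\<close> extends the identity to the
  closure.\<close>

lemma tau_bounded_endo:
  assumes \<theta>: "bounded_endo C \<theta>" and x: "x \<in> A"
  shows "tau (\<theta> x) = tau x"
proof -
  note E = bounded_endoD[OF \<theta>]
  have emb: "tau (\<theta> (\<phi> K X)) = tau (\<phi> K X)" if X: "X \<in> mats K" for K X
    unfolding tau_emb[OF X]
    by (rule mat_trace_unique[OF _ _ _ _ msize_pos X])
      (simp_all add: emb_add emb_smult emb_mult E tau_add tau_scaleC tau_mult_commute tau_one)
  obtain s where s: "\<And>i. s i \<in> union" "s \<longlonglongrightarrow> x" using union_sequence[OF x] by metis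
  have sA: "\<And>i. s i \<in> A" using s union_subset by auto
  have "(\<lambda>i. \<theta> (s i)) \<longlonglongrightarrow> \<theta> x"
  proof (rule Lim_null_comparison[of _ "\<lambda>i. C * norm (s i - x)", THEN LIM_zero_cancel])
    show "\<forall>\<^sub>F i in sequentially. norm (\<theta> (s i) - \<theta> x) \<le> C * norm (s i - x)"
      using E(3)[OF in_A(8)[OF sA x]] E(7)[OF sA x] by simp
    show "(\<lambda>i. C * norm (s i - x)) \<longlonglongrightarrow> 0"
      by (intro tendsto_mult_right_zero tendsto_norm_zero LIM_zero s)
  qed
  then have "(\<lambda>i. tau (\<theta> (s i))) \<longlonglongrightarrow> tau (\<theta> x)"
    by (rule tendsto_tau) (auto simp: E x sA)
  moreover have "tau (\<theta> (s i)) = tau (s i)" for i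
    using emb s(1)[of i] by (auto simp: union_def)
  ultimately show ?thesis using tendsto_tau[OF s(2) x sA] by (simp add: LIMSEQ_unique)
qed

lemma logtr_bounded_endo:
  assumes \<theta>: "bounded_endo C \<theta>" and c: "c \<in> A"
  shows "logtr (\<theta> c) = logtr c"
proof -
  note E = bounded_endoD[OF \<theta>]
  have "tau ((1 - \<theta> c) ^ k) = tau ((1 - c) ^ k)" for k
  proof -
    have "(1 - \<theta> c) ^ k = \<theta> ((1 - c) ^ k)" using c by (simp add: E in_A)
    then show ?thesis using tau_bounded_endo[OF \<theta>] c by (simp add: in_A)
  qed
  then show ?thesis by (simp add: logtr_def)
qed

end

section \<open>The determinant modulo roots of unity\<close>

context matrix_tower
begin

definition inverses :: "'a \<Rightarrow> 'a \<Rightarrow> bool" where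
  "inverses u v \<longleftrightarrow> u \<in> A \<and> v \<in> A \<and> u * v = 1 \<and> v * u = 1"

lemma inverses_sym: "inverses u v \<Longrightarrow> inverses v u"
  by (simp add: inverses_def)

lemma inverses_mult: "inverses u v \<Longrightarrow> inverses u' v' \<Longrightarrow> inverses (u * u') (v' * v)"
  unfolding inverses_def by (auto intro: in_A) (metis mult.assoc mult.left_neutral)+

lemma inverses_near_one:
  assumes "c \<in> A" "norm (c - 1) < 1"
  obtains d where "inverses c d" "norm (d - 1) \<le> norm (c - 1) / (1 - norm (c - 1))"
  using inverse_near_one[OF closed_A assms] unfolding inverses_def using assms(1) by metis

text \<open>\<open>exp d\<close> is one of the values of the normalized determinant of \<open>u\<close>, computed from any
  sufficiently good factorization of \<open>u\<close> into an invertible matrix and an element near 1.\<close>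

definition log_det :: "'a \<Rightarrow> complex \<Rightarrow> bool" where
  "log_det u d \<longleftrightarrow> u \<in> A \<and> (\<forall>\<delta>>0. \<exists>K X c. X \<in> mats K \<and> c \<in> A \<and> norm (c - 1) < \<delta> \<and>
     u * c = \<phi> K X \<and> det X = exp (of_nat (msize K) * (d + logtr c)))"

lemma log_detE:
  assumes "log_det u d" "\<delta> > 0"
  obtains K X c where "X \<in> mats K" "c \<in> A" "norm (c - 1) < \<delta>" "u * c = \<phi> K X"
    "det X = exp (of_nat (msize K) * (d + logtr c))"
  using assms unfolding log_det_def by blast

lemma log_det_emb:
  assumes "X \<in> mats K" "det X = exp (of_nat (msize K) * d)"
  shows "log_det (\<phi> K X) d"
  unfolding log_det_def
proof (intro conjI allI impI exI[of _ K] exI[of _ X] exI[of _ 1])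
  show "\<phi> K X \<in> A" by (rule emb_in[OF assms(1)])
qed (simp_all add: assms in_A logtr_one)

text \<open>Writing a nearby matrix as \<open>c * e\<close> with \<open>e\<close> near 1, the
  determinant of the matrix is known from \<open>logtr (c * e)\<close>, which is additive.\<close>

lemma log_det_near_one:
  assumes c: "c \<in> A" "norm (c - 1) < 1/4"
  shows "log_det c (logtr c)"
  unfolding log_det_def
proof (intro conjI allI impI c(1))
  fix \<delta> :: real assume \<delta>: "\<delta> > 0"
  obtain d where d: "inverses c d" using inverses_near_one[of c] c by auto
  \<comment> \<open>Since \<open>e - 1 = d * (\<phi> K X - c)\<close>, the denominator compensates
    the norm of \<open>d\<close>; the summand 1 keeps it positive.\<close>
  define \<epsilon> where "\<epsilon> = min (min \<delta> (1/4)) (1 - norm (c - 1)) / (1 + norm d)"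
  have \<epsilon>: "\<epsilon> > 0" using \<delta> c by (auto simp: \<epsilon>_def intro!: divide_pos_pos add_pos_nonneg)
  obtain K X where X: "X \<in> mats K" "norm (\<phi> K X - c) < \<epsilon>"
    using emb_dense[OF c(1) \<epsilon>] by metis
  define e where "e = d * \<phi> K X"
  have eA: "e \<in> A" using d X by (auto simp: e_def inverses_def intro: in_A)
  have ce: "c * e = \<phi> K X" using d by (simp add: e_def inverses_def mult.assoc[symmetric])
  have "e - 1 = d * (\<phi> K X - c)" using d by (simp add: e_def inverses_def algebra_simps)
  then have "norm (e - 1) \<le> norm d * norm (\<phi> K X - c)" by (simp add: norm_mult_ineq)
  also have "\<dots> \<le> (1 + norm d) * norm (\<phi> K X - c)" by (intro mult_right_mono) auto
  also have "\<dots> < (1 + norm d) * \<epsilon>" using X(2) by (intro mult_strict_left_mono add_pos_nonneg) auto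
  also have "\<dots> = min (min \<delta> (1/4)) (1 - norm (c - 1))"
    using add_pos_nonneg[of 1 "norm d"] by (simp add: \<epsilon>_def)
  finally have ne: "norm (e - 1) < \<delta>" "norm (e - 1) < 1/4" by auto
  have "norm (\<phi> K X - 1) \<le> 1/4 + 1/4 + 1/4 * (1/4)"
    unfolding ce[symmetric] by (rule norm_mult_near_one) (use c ne in auto)
  then have "det X = exp (of_nat (msize K) * logtr (\<phi> K X))"
    by (intro det_eq_exp_logtr X(1)) simp
  also have "logtr (\<phi> K X) = logtr c + logtr e"
    unfolding ce[symmetric] by (rule logtr_mult[OF c eA ne(2)])
  finally show "\<exists>K X e. X \<in> mats K \<and> e \<in> A \<and> norm (e - 1) < \<delta> \<and> c * e = \<phi> K X \<and>
      det X = exp (of_nat (msize K) * (logtr c + logtr e))"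
    using X(1) eA ne(1) ce by blast
qed

text \<open>Multiplying the two factorizations leaves \<open>c\<close> on the wrong side of
  \<open>u'\<close>. Conjugation by \<open>u'\<close> moves it across without changing its
  \<open>logtr\<close>.\<close>

lemma log_det_mult:
  assumes u: "log_det u d" and u': "log_det u' d'" and inv: "inverses u' v'"
  shows "log_det (u * u') (d + d')"
  unfolding log_det_def
proof (intro conjI allI impI)
  show "u * u' \<in> A" using u u' by (auto simp: log_det_def intro: in_A)
  fix \<delta> :: real assume \<delta>: "\<delta> > 0"
  define \<eta> where "\<eta> = min (1/4) (\<delta> / 3)"
  have \<eta>: "\<eta> > 0" using \<delta> by (simp add: \<eta>_def)
  \<comment> \<open>\<open>c\<close> must be so close to 1 that its conjugate by \<open>u'\<close>
    is still within \<open>\<eta>\<close>; then \<open>a * c'\<close> is within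
    \<open>3 * \<eta> \<le> \<delta>\<close>.\<close>
  define \<epsilon> where "\<epsilon> = \<eta> / (1 + norm v' * norm u')"
  have den: "1 + norm v' * norm u' > 0" by (intro add_pos_nonneg) auto
  have \<epsilon>: "\<epsilon> > 0" using \<eta> den by (simp add: \<epsilon>_def)
  obtain K' X' c' where 1: "X' \<in> mats K'" "c' \<in> A" "norm (c' - 1) < \<eta>" "u' * c' = \<phi> K' X'"
    "det X' = exp (of_nat (msize K') * (d' + logtr c'))"
    using log_detE[OF u' \<eta>] by metis
  obtain K X c where 2: "X \<in> mats K" "c \<in> A" "norm (c - 1) < \<epsilon>" "u * c = \<phi> K X"
    "det X = exp (of_nat (msize K) * (d + logtr c))"
    using log_detE[OF u \<epsilon>] by metis
  define L where "L = max K K'"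
  obtain Y where Y: "Y \<in> mats L" "\<phi> L Y = \<phi> K X" "det Y = exp (of_nat (msize L) * (d + logtr c))"
    using emb_lift[OF max.cobounded1 2(1), of K'] 2(5) unfolding L_def by metis
  obtain Y' where Y': "Y' \<in> mats L" "\<phi> L Y' = \<phi> K' X'" "det Y' = exp (of_nat (msize L) * (d' + logtr c'))"
    using emb_lift[OF max.cobounded2 1(1), of K] 1(5) unfolding L_def by metis
  define a where "a = v' * c * u'"
  have aA: "a \<in> A" using 2(2) inv by (auto simp: a_def inverses_def intro: in_A)
  have "a - 1 = v' * (c - 1) * u'" using inv by (simp add: a_def inverses_def algebra_simps)
  then have "norm (a - 1) \<le> norm v' * norm (c - 1) * norm u'"
    using norm_mult_ineq[of "v' * (c - 1)" u'] mult_right_mono[OF norm_mult_ineq[of v' "c - 1"], of "norm u'"]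
    by (simp add: order_trans)
  also have "\<dots> \<le> (1 + norm v' * norm u') * norm (c - 1)" by (simp add: algebra_simps)
  also have "\<dots> < (1 + norm v' * norm u') * \<epsilon>" using 2(3) den by (rule mult_strict_left_mono)
  also have "\<dots> = \<eta>" using den by (simp add: \<epsilon>_def)
  finally have na: "norm (a - 1) < \<eta>" .
  have la: "logtr a = logtr c"
    unfolding a_def by (rule logtr_conj) (use inv 2(2) in \<open>auto simp: inverses_def\<close>)
  have "norm (a * c' - 1) \<le> \<eta> + norm (c' - 1) + \<eta> * norm (c' - 1)"
    by (rule norm_mult_near_one) (use na in auto)
  also have "\<dots> \<le> \<eta> + norm (c' - 1) + 1 * norm (c' - 1)"
    by (intro add_left_mono mult_right_mono) (auto simp: \<eta>_def)
  also have "\<dots> < 3 * \<eta>" using 1(3) by simp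
  finally have near: "norm (a * c' - 1) < \<delta>" by (simp add: \<eta>_def)
  have lac: "logtr (a * c') = logtr c + logtr c'"
    unfolding la[symmetric] by (rule logtr_mult) (use aA na 1 in \<open>auto simp: \<eta>_def\<close>)
  have "u * u' * (a * c') = u * (u' * v') * c * (u' * c')" by (simp add: a_def mult.assoc)
  also have "\<dots> = \<phi> L (Y * Y')"
    using inv 1(4) 2(4) Y(1,2) Y'(1,2) by (simp add: inverses_def emb_mult)
  finally have e: "u * u' * (a * c') = \<phi> L (Y * Y')" .
  have "det (Y * Y') = exp (of_nat (msize L) * (d + d' + logtr (a * c')))"
    unfolding det_mult[OF Y(1) Y'(1)] Y(3) Y'(3) lac by (simp add: exp_add[symmetric] algebra_simps)
  then show "\<exists>K X c. X \<in> mats K \<and> c \<in> A \<and> norm (c - 1) < \<delta> \<and> u * u' * c = \<phi> K X \<and>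
      det X = exp (of_nat (msize K) * (d + d' + logtr c))"
    using mult_carrier_mat[OF Y(1) Y'(1)] in_A(4)[OF aA 1(2)] near e by blast
qed

text \<open>Two factorizations of \<open>u\<close> differ by an element \<open>y\<close> near 1. At
  a common level \<open>y\<close> is a quotient of two matrices, and its determinant is
  \<open>exp (of_nat (msize K) * logtr y)\<close>, which accounts for the difference of the
  corrections.\<close>

lemma log_det_unique:
  assumes d1: "log_det u d1" and d2: "log_det u d2"
  obtains K where "K \<ge> K0" "exp (of_nat (msize K) * (d1 - d2)) = 1"
proof -
  \<comment> \<open>With 1/16, the inverse of \<open>c1\<close> is within 1/15 and \<open>y\<close>
    within 2/15 of 1, inside the radius 1/4 of additivity.\<close>
  have p: "(1/16::real) > 0" by simp
  obtain K1 X1 c1 where 1: "X1 \<in> mats K1" "c1 \<in> A" "norm (c1 - 1) < 1/16" "u * c1 = \<phi> K1 X1"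
    "det X1 = exp (of_nat (msize K1) * (d1 + logtr c1))"
    using log_detE[OF d1 p] by metis
  obtain K2 X2 c2 where 2: "X2 \<in> mats K2" "c2 \<in> A" "norm (c2 - 1) < 1/16" "u * c2 = \<phi> K2 X2"
    "det X2 = exp (of_nat (msize K2) * (d2 + logtr c2))"
    using log_detE[OF d2 p] by metis
  define K where "K = max K0 (max K1 K2)"
  have K: "K0 \<le> K" "K1 \<le> K" "K2 \<le> K" by (auto simp: K_def)
  obtain Y1 where Y1: "Y1 \<in> mats K" "\<phi> K Y1 = \<phi> K1 X1" "det Y1 = exp (of_nat (msize K) * (d1 + logtr c1))"
    using emb_lift[OF K(2) 1(1)] 1(5) by metis
  obtain Y2 where Y2: "Y2 \<in> mats K" "\<phi> K Y2 = \<phi> K2 X2" "det Y2 = exp (of_nat (msize K) * (d2 + logtr c2))"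
    using emb_lift[OF K(3) 2(1)] 2(5) by metis
  obtain e where e: "inverses c1 e" "norm (e - 1) \<le> norm (c1 - 1) / (1 - norm (c1 - 1))"
    using inverses_near_one[of c1] 1 by auto
  have "norm (c1 - 1) / (1 - norm (c1 - 1)) \<le> (1/16) / (1 - 1/16)"
    using 1(3) by (intro frac_le) auto
  also have "\<dots> = 1/15" by simp
  finally have ne: "norm (e - 1) \<le> 1/15" using e(2) by (rule order_trans[rotated])
  define y where "y = e * c2"
  have yA: "y \<in> A" using e 2 by (auto simp: y_def inverses_def intro: in_A)
  have "norm (y - 1) \<le> 1/15 + 1/16 + 1/15 * (1/16)"
    unfolding y_def by (rule norm_mult_near_one) (use ne 2 in auto)
  then have ny: "norm (y - 1) < 1/4" by simp
  have c1y: "c1 * y = c2" using e by (simp add: y_def inverses_def mult.assoc[symmetric])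
  have lc2: "logtr c2 = logtr c1 + logtr y"
    unfolding c1y[symmetric] by (rule logtr_mult) (use 1 yA ny in auto)
  obtain Z where Z: "Z \<in> mats K" "Y1 * Z = 1\<^sub>m (msize K)" "Z * Y1 = 1\<^sub>m (msize K)"
    using mat_inverse_exists[OF Y1(1)] Y1(3) by auto
  have "\<phi> K (Z * Y2) = \<phi> K Z * (u * c2)" using Z Y2 2 by (simp add: emb_mult)
  also have "\<dots> = \<phi> K Z * \<phi> K Y1 * y" by (simp only: c1y[symmetric] Y1(2) 1(4)[symmetric] mult.assoc)
  also have "\<dots> = y" using emb_mult[OF Z(1) Y1(1)] Z(3) by simp
  finally have py: "\<phi> K (Z * Y2) = y" .
  have ZY: "Z * Y2 \<in> mats K" using Z Y2 by auto
  have "det (Z * Y2) = exp (of_nat (msize K) * logtr y)"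
    using det_eq_exp_logtr[OF ZY] ny by (simp add: py)
  moreover have "det Y2 = det Y1 * det (Z * Y2)"
  proof -
    have "det Y1 * det Z = 1" using det_mult[OF Y1(1) Z(1)] Z(2) by simp
    then show ?thesis unfolding det_mult[OF Z(1) Y2(1)] by simp
  qed
  ultimately have "exp (of_nat (msize K) * (d2 + logtr c2)) =
      exp (of_nat (msize K) * (d1 + logtr c1)) * exp (of_nat (msize K) * logtr y)"
    using Y1 Y2 by simp
  also have "\<dots> = exp (of_nat (msize K) * (d1 + logtr c2))"
    unfolding lc2 by (simp add: exp_add[symmetric] algebra_simps)
  finally have "exp (of_nat (msize K) * (d1 + logtr c2) - of_nat (msize K) * (d2 + logtr c2)) = 1"
    by (simp add: exp_diff)
  then have "exp (of_nat (msize K) * (d1 - d2)) = 1" by (simp add: algebra_simps)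
  with K(1) that show ?thesis by blast
qed

text \<open>A factorization of \<open>u\<close> into elements near 1 with \<open>d\<close> the sum
  of their logarithms. Unlike the factorizations in \<open>log_det\<close>, it is carried by an
  endomorphism to one of the same kind with the same \<open>d\<close>.\<close>

inductive near_product :: "real \<Rightarrow> 'a \<Rightarrow> complex \<Rightarrow> bool" for \<delta> where
  one: "near_product \<delta> 1 0"
| mult: "near_product \<delta> u d \<Longrightarrow> c \<in> A \<Longrightarrow> norm (c - 1) < \<delta> \<Longrightarrow> near_product \<delta> (u * c) (d + logtr c)"

lemma near_product_imp_log_det:
  assumes "near_product \<delta> u d" "\<delta> \<le> 1/4"
  shows "log_det u d"
  using assms(1)
proof induction
  case one
  show ?case using log_det_near_one[of 1] in_A(1) by (simp add: logtr_one)
next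
  case (mult u d c)
  then have c: "norm (c - 1) < 1/4" using assms(2) by simp
  obtain e where "inverses c e" using inverses_near_one[of c] mult.hyps(2) c by auto
  with log_det_mult[OF mult.IH log_det_near_one[OF mult.hyps(2) c]] show ?case by blast
qed

text \<open>Applied factor by factor: \<open>\<theta>\<close> multiplies distances to 1 by at most
  \<open>C\<close> and preserves \<open>logtr\<close>.\<close>

lemma near_product_endo:
  assumes \<theta>: "bounded_endo C \<theta>" and C: "C * \<delta> \<le> \<delta>'" and u: "near_product \<delta> u d"
  shows "u \<in> A \<and> near_product \<delta>' (\<theta> u) d"
  using u
proof induction
  case one
  show ?case using near_product.one[of \<delta>'] by (simp add: bounded_endoD(1)[OF \<theta>] in_A)
next
  case (mult u d c)
  note E = bounded_endoD[OF \<theta>]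
  have "norm (\<theta> c - 1) \<le> C * norm (c - 1)"
    using E(3)[of "c - 1"] E(7)[of c 1] mult.hyps(2) in_A(1,8) by (simp add: E(1))
  also have "\<dots> < C * \<delta>" using mult.hyps(3) E(9) by (intro mult_strict_left_mono) auto
  finally have "norm (\<theta> c - 1) < \<delta>'" using C by simp
  from near_product.mult[OF conjunct2[OF mult.IH] E(2)[OF mult.hyps(2)] this]
  show ?case using mult by (simp add: E(5) logtr_bounded_endo[OF \<theta>] in_A)
qed

definition near_generated :: "real \<Rightarrow> 'a \<Rightarrow> bool" where
  "near_generated \<delta> u \<longleftrightarrow> (\<exists>d. near_product \<delta> u d)"

lemma near_generated_mult:
  "near_generated \<delta> u \<Longrightarrow> c \<in> A \<Longrightarrow> norm (c - 1) < \<delta> \<Longrightarrow> near_generated \<delta> (u * c)"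
  unfolding near_generated_def using near_product.mult by blast

text \<open>The line \<open>z \<mapsto> 1 + z (X - 1)\<close> avoids the singular matrices off a finite set of \<open>z\<close>, whose
  complement is connected; along it, being generated by elements near 1 is locally constant.\<close>

lemma near_generated_emb:
  assumes X: "X \<in> mats K" and det: "det X \<noteq> 0" and \<delta>: "\<delta> > 0"
  shows "near_generated \<delta> (\<phi> K X)"
proof -
  define Y where "Y = 1\<^sub>m (msize K) - X"
  have Y: "Y \<in> mats K" using X by (auto simp: Y_def)
  obtain \<mu> where \<mu>: "\<And>z. det (1\<^sub>m (msize K) - z \<cdot>\<^sub>m Y) = (\<Prod>i<msize K. 1 - z * \<mu> i)"
    using power_spectrum[OF Y] by metis
  define S where "S = {z. det (1\<^sub>m (msize K) - z \<cdot>\<^sub>m Y) \<noteq> 0}"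
  have "- S \<subseteq> (\<lambda>i. 1 / \<mu> i) ` {..<msize K}"
  proof
    fix z assume "z \<in> - S"
    then obtain i where i: "i < msize K" "1 - z * \<mu> i = 0" by (auto simp: S_def \<mu>)
    then have "z = 1 / \<mu> i" by (cases "\<mu> i = 0") (auto simp: field_simps)
    with i show "z \<in> (\<lambda>i. 1 / \<mu> i) ` {..<msize K}" by blast
  qed
  then have "countable (- S)" by (meson countable_finite countable_subset finite_imageI finite_lessThan)
  then have conn: "connected S"
    using path_connected_complement_countable[of "- S"] by (simp add: path_connected_imp_connected)
  define w where "w z = \<phi> K (1\<^sub>m (msize K) - z \<cdot>\<^sub>m Y)" for z
  have wA: "w z \<in> A" for z unfolding w_def by (rule emb_in) (use Y in auto)
  have weq: "w z = 1 - z *\<^sub>C \<phi> K Y" for z unfolding w_def using Y by (simp add: emb_diff emb_smult)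
  have "1 \<in> S" "0 \<in> S"
  proof -
    have "1\<^sub>m (msize K) - 1 \<cdot>\<^sub>m Y = X" "1\<^sub>m (msize K) - 0 \<cdot>\<^sub>m Y = 1\<^sub>m (msize K)"
      using X by (auto simp: Y_def intro!: eq_matI)
    then show "1 \<in> S" "0 \<in> S" using det by (auto simp: S_def)
  qed
  have w1: "w 1 = \<phi> K X" and w0: "w 0 = 1"
    using X by (simp_all add: weq scaleC_one scaleC_zero_left Y_def emb_diff)
  have "near_generated \<delta> (w 1)"
  proof (rule connected_induction_simple[OF conn \<open>0 \<in> S\<close> \<open>1 \<in> S\<close>, of "\<lambda>z. near_generated \<delta> (w z)"])
    show "near_generated \<delta> (w 0)" using near_product.one by (auto simp: w0 near_generated_def)
    fix a assume a: "a \<in> S"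
    have "1\<^sub>m (msize K) - a \<cdot>\<^sub>m Y \<in> mats K" using Y by auto
    then obtain Z where Z: "Z \<in> mats K" "(1\<^sub>m (msize K) - a \<cdot>\<^sub>m Y) * Z = 1\<^sub>m (msize K)"
      using mat_inverse_exists a unfolding S_def by blast
    define y where "y = \<phi> K Z"
    have yA: "y \<in> A" using Z by (simp add: y_def)
    have wy: "w a * y = 1"
      unfolding w_def y_def using Z Y by (subst emb_mult[symmetric]) auto
    \<comment> \<open>The inverse of an element within \<open>\<eta>\<close> of 1 is within
      \<open>2 * \<eta>\<close>, so both are usable as factors.\<close>
    define \<eta> where "\<eta> = min (\<delta> / 2) (1/2)"
    have \<eta>: "\<eta> > 0" "\<eta> \<le> 1/2" "2 * \<eta> \<le> \<delta>" using \<delta> by (auto simp: \<eta>_def)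
    define \<rho> where "\<rho> = \<eta> / (1 + norm y * norm (\<phi> K Y))"
    have den: "1 + norm y * norm (\<phi> K Y) > 0" by (intro add_pos_nonneg) auto
    have step: "\<exists>c\<in>A. norm (c - 1) < \<eta> \<and> w z = w a * c" if "z \<in> ball a \<rho>" for z
    proof -
      define c where "c = 1 + y * (w z - w a)"
      have "c \<in> A" using yA wA by (auto simp: c_def intro: in_A)
      moreover have "w z = w a * c"
      proof -
        have "w a * c = w a + (w a * y) * (w z - w a)" by (simp add: c_def algebra_simps)
        then show ?thesis by (simp add: wy)
      qed
      moreover have "norm (c - 1) < \<eta>"
      proof -
        have "w z - w a = (a - z) *\<^sub>C \<phi> K Y" by (simp add: weq scaleC_diff_left)
        then have "norm (c - 1) \<le> norm y * (cmod (a - z) * norm (\<phi> K Y))"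
          using norm_mult_ineq[of y "w z - w a"] by (simp add: c_def norm_scaleC)
        also have "\<dots> \<le> (1 + norm y * norm (\<phi> K Y)) * cmod (a - z)" by (simp add: algebra_simps)
        also have "\<dots> < (1 + norm y * norm (\<phi> K Y)) * \<rho>"
          using that den by (intro mult_strict_left_mono) (auto simp: dist_norm)
        also have "\<dots> = \<eta>" using den by (simp add: \<rho>_def)
        finally show ?thesis .
      qed
      ultimately show ?thesis by blast
    qed
    show "\<exists>T. openin (top_of_set S) T \<and> a \<in> T \<and>
        (\<forall>x\<in>T. \<forall>z\<in>T. near_generated \<delta> (w x) \<longrightarrow> near_generated \<delta> (w z))"
    proof (intro exI[of _ "S \<inter> ball a \<rho>"] conjI ballI impI)
      show "openin (top_of_set S) (S \<inter> ball a \<rho>)" by (simp add: openin_open_Int)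
      show "a \<in> S \<inter> ball a \<rho>" using a \<eta> den by (simp add: \<rho>_def)
      \<comment> \<open>The two points are compared through the centre: an inverse factor leads from
        \<open>w x\<close> to \<open>w a\<close>, another factor from there to
        \<open>w z\<close>.\<close>
      fix x z assume x: "x \<in> S \<inter> ball a \<rho>" and z: "z \<in> S \<inter> ball a \<rho>" and nx: "near_generated \<delta> (w x)"
      obtain c where c: "c \<in> A" "norm (c - 1) < \<eta>" "w x = w a * c" using step x by blast
      obtain e where e: "inverses c e" "norm (e - 1) \<le> norm (c - 1) / (1 - norm (c - 1))"
        using inverses_near_one[of c] c \<eta> by auto
      have "norm (c - 1) / (1 - norm (c - 1)) \<le> norm (c - 1) / (1/2)"
        using c \<eta> by (intro divide_left_mono) auto
      then have "norm (e - 1) < \<delta>" using e c \<eta> by simp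
      from near_generated_mult[OF nx _ this]
      have "near_generated \<delta> (w a)" using e c by (simp add: inverses_def mult.assoc)
      moreover obtain c' where "c' \<in> A" "norm (c' - 1) < \<eta>" "w z = w a * c'" using step z by blast
      ultimately show "near_generated \<delta> (w z)"
        using near_generated_mult[of \<delta> "w a" c'] \<eta> by simp
    qed
  qed
  then show ?thesis by (simp add: w1)
qed

text \<open>The inverse \<open>v\<close> need not come from a matrix. A singular \<open>X\<close>
  would annihilate some \<open>V\<close> other than 0, and \<open>v\<close> would cancel
  \<open>X\<close> in the image of that equation.\<close>

lemma det_nonzero_if_invertible:
  assumes X: "X \<in> mats K" and v: "v * \<phi> K X = 1"
  shows "det X \<noteq> 0"
proof
  assume d: "det X = 0"
  define Y where "Y = 1\<^sub>m (msize K) - X"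
  have Y: "Y \<in> mats K" using X by (auto simp: Y_def)
  obtain \<mu> where \<mu>: "\<And>i. i < msize K \<Longrightarrow> eigenvalue Y (\<mu> i)"
    "\<And>z. det (1\<^sub>m (msize K) - z \<cdot>\<^sub>m Y) = (\<Prod>i<msize K. 1 - z * \<mu> i)"
    using power_spectrum[OF Y] by metis
  have "1\<^sub>m (msize K) - 1 \<cdot>\<^sub>m Y = X" using X by (auto simp: Y_def intro!: eq_matI)
  then have "(\<Prod>i<msize K. 1 - \<mu> i) = 0" using \<mu>(2)[of 1] d by simp
  then obtain i where "i < msize K" "\<mu> i = 1" by auto
  then have "eigenvalue Y 1" using \<mu>(1) by metis
  then obtain V where V: "V \<in> mats K" "V \<noteq> 0\<^sub>m (msize K) (msize K)" "Y * V = 1 \<cdot>\<^sub>m V"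
    using eigenvalue_mat[OF Y] by metis
  have "(1 - \<phi> K X) * \<phi> K V = \<phi> K V"
    using arg_cong[OF V(3), of "\<phi> K"] V(1) X Y
    by (simp add: emb_mult emb_smult scaleC_one Y_def emb_diff)
  then have "\<phi> K X * \<phi> K V = 0" by (simp add: algebra_simps)
  then have "v * \<phi> K X * \<phi> K V = 0" by (simp add: mult.assoc)
  then have "\<phi> K V = \<phi> K (0\<^sub>m (msize K) (msize K))" using v embedding_zero[OF embedding] by simp
  then show False using V emb_eq_iff[OF V(1) zero_carrier_mat] by blast
qed

text \<open>A matrix close enough to \<open>u\<close> has the form \<open>u * c\<close> with
  \<open>c\<close> near 1, so it is invertible, hence generated, and one more factor near 1 leads
  back to \<open>u\<close>.\<close>

lemma near_generated_invertible:
  assumes u: "inverses u v" and \<delta>: "\<delta> > 0"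
  shows "near_generated \<delta> u"
proof -
  define \<eta> where "\<eta> = min (\<delta> / 2) (1/2)"
  have \<eta>: "\<eta> > 0" "\<eta> \<le> 1/2" "2 * \<eta> \<le> \<delta>" using \<delta> by (auto simp: \<eta>_def)
  define \<epsilon> where "\<epsilon> = \<eta> / (1 + norm v)"
  have den: "1 + norm v > 0" by (intro add_pos_nonneg) auto
  have \<epsilon>: "\<epsilon> > 0" using \<eta> den by (simp add: \<epsilon>_def)
  have uA: "u \<in> A" and vA: "v \<in> A" and uv: "u * v = 1" "v * u = 1" using u by (auto simp: inverses_def)
  obtain K X where X: "X \<in> mats K" "norm (\<phi> K X - u) < \<epsilon>"
    using emb_dense[OF uA \<epsilon>] by metis
  define c where "c = v * \<phi> K X"
  have cA: "c \<in> A" using vA X by (auto simp: c_def intro: in_A)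
  have "c - 1 = v * (\<phi> K X - u)" by (simp add: c_def algebra_simps uv)
  then have "norm (c - 1) \<le> norm v * norm (\<phi> K X - u)" by (simp add: norm_mult_ineq)
  also have "\<dots> \<le> (1 + norm v) * norm (\<phi> K X - u)" by (intro mult_right_mono) auto
  also have "\<dots> < (1 + norm v) * \<epsilon>" using X(2) den by (rule mult_strict_left_mono)
  also have "\<dots> = \<eta>" using den by (simp add: \<epsilon>_def)
  finally have nc: "norm (c - 1) < \<eta>" .
  obtain e where e: "inverses c e" "norm (e - 1) \<le> norm (c - 1) / (1 - norm (c - 1))"
    using inverses_near_one[of c] cA nc \<eta> by auto
  have "norm (c - 1) / (1 - norm (c - 1)) \<le> norm (c - 1) / (1/2)"
    using nc \<eta> by (intro divide_left_mono) auto
  then have ne: "norm (e - 1) < \<delta>" using e nc \<eta> by simp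
  have eA: "e \<in> A" "c * e = 1" "e * c = 1" using e by (auto simp: inverses_def)
  have "(e * v) * \<phi> K X = 1" using eA(3) by (simp add: c_def mult.assoc)
  then have "det X \<noteq> 0" by (rule det_nonzero_if_invertible[OF X(1)])
  then have "near_generated \<delta> (\<phi> K X)" by (rule near_generated_emb[OF X(1) _ \<delta>])
  then have "near_generated \<delta> (\<phi> K X * e)" using eA(1) ne by (rule near_generated_mult)
  moreover have "\<phi> K X * e = u"
  proof -
    have "\<phi> K X * e = u * c * e" by (simp add: c_def mult.assoc[symmetric] uv)
    then show ?thesis by (simp add: mult.assoc eA)
  qed
  ultimately show ?thesis by simp
qed

section \<open>Idempotents of \<open>A\<close> up to conjugacy\<close>

lemma emb_diag_ones:
  assumes "K0 \<le> K"
  shows "\<phi> K (diag_ones (m * (\<Prod>k=K0..<K. n k)) (msize K)) = \<phi> K0 (diag_ones m (msize K0))"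
  using assms
proof (induction K rule: dec_induct)
  case (step K)
  have "kronecker (diag_ones (m * (\<Prod>k=K0..<K. n k)) (msize K)) (1\<^sub>m (n K)) =
      diag_ones (m * (\<Prod>k=K0..<Suc K. n k)) (msize (Suc K))"
    using step kronecker_diag_ones[OF pos] by (simp add: mult.assoc)
  then show ?case using connecting[of "diag_ones (m * (\<Prod>k=K0..<K. n k)) (msize K)" K] step by simp
qed simp

lemma msize_split: "K0 \<le> K \<Longrightarrow> msize K = msize K0 * (\<Prod>k=K0..<K. n k)"
  using prod.atLeastLessThan_concat[of 0 K0 K n] by (simp add: atLeast0LessThan)

text \<open>An idempotent \<open>f\<close> is close to an idempotent \<open>q\<close> of some matrix algebra: if \<open>a\<close> is close to \<open>f\<close>,
  take \<open>q = 1/2 + (a - 1/2) (1 + 4 (a\<^sup>2 - a))\<^sup>-\<^sup>1\<^sup>/\<^sup>2\<close>. The trace determines the rank of \<open>q\<close>.\<close>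

lemma idempotent_conjugate_emb:
  assumes f: "f \<in> A" "f * f = f" and tr: "tau f = of_nat m / of_nat (msize K0)"
  obtains w w' where "inverses w w'" "f * w = w * \<phi> K0 (diag_ones m (msize K0))"
proof -
  define B where "B = norm f + 2"
  have B: "B \<ge> 2" "norm f = B - 2" by (simp_all add: B_def)
  \<comment> \<open>The estimates below give \<open>norm b \<le> 8 * \<epsilon> * B\<close> and
    \<open>norm (w1 - 1) \<le> 24 * \<epsilon> * B ^ 3\<close>, that is at most 8/100 and
    24/100.\<close>
  define \<epsilon> where "\<epsilon> = 1 / (100 * B ^ 3)"
  have B3: "B ^ 3 \<ge> 1" "B ^ 3 > 0" using B by (auto intro: one_le_power)
  have \<epsilon>: "\<epsilon> > 0" "\<epsilon> \<le> 1" "\<epsilon> * B ^ 3 = 1/100"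
    using B3 by (auto simp: \<epsilon>_def)
  have \<epsilon>B: "\<epsilon> * B \<le> 1/100" "\<epsilon> * B\<^sup>2 * B = 1/100"
  proof -
    have "B ^ 1 \<le> B ^ 3" using B by (intro power_increasing) auto
    then have "\<epsilon> * B \<le> \<epsilon> * B ^ 3" using \<epsilon>(1) by simp
    then show "\<epsilon> * B \<le> 1/100" using \<epsilon>(3) by simp
    show "\<epsilon> * B\<^sup>2 * B = 1/100" using \<epsilon>(3) by (simp add: power3_eq_cube power2_eq_square mult.assoc)
  qed
  obtain K X where X: "K \<ge> K0" "X \<in> mats K" "norm (\<phi> K X - f) < \<epsilon>"
    using emb_dense[OF f(1) \<epsilon>(1)] by metis
  define a where "a = \<phi> K X"
  define M where "M = \<phi> K ` mats K"
  have M: "closed_subalgebra M" unfolding M_def by (rule closed_subalgebra_embedding_image[OF embedding])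
  note in_M = subalgebra_intros[OF M]
  have aM: "a \<in> M" using X by (auto simp: a_def M_def)
  have MA: "x \<in> A" if "x \<in> M" for x using that by (auto simp: M_def)
  have naf: "norm (a - f) < \<epsilon>" using X by (simp add: a_def)
  have na: "norm a \<le> B - 1"
    using norm_triangle_ineq[of f "a - f"] naf \<epsilon>(2) by (simp add: B)
  \<comment> \<open>Here \<open>1 - b\<close> is the square of \<open>2 a - 1\<close>. Dividing
    \<open>2 a - 1\<close> by the root \<open>1 - s\<close> turns it into an involution, which is
    \<open>2 q - 1\<close>.\<close>
  define b where "b = (-4) *\<^sub>R (a * a - a)"
  have bM: "b \<in> M" unfolding b_def by (intro in_M aM)
  have "a * a - a = (a - f) * a + f * (a - f) - (a - f)" using f(2) by (simp add: algebra_simps)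
  then have "norm (a * a - a) \<le> norm (a - f) * norm a + norm f * norm (a - f) + norm (a - f)"
    by (simp only:) (intro norm_triangle_le_diff add_mono order_refl norm_mult_ineq norm_triangle_le)
  also have "\<dots> = norm (a - f) * (norm a + norm f + 1)" by (simp add: algebra_simps)
  also have "\<dots> \<le> \<epsilon> * (2 * B)"
  proof (rule mult_mono)
    show "0 \<le> norm a + norm f + 1" by (intro add_nonneg_nonneg) auto
  qed (use naf na B \<epsilon>(1) in auto)
  finally have nb: "norm b \<le> 8 * (\<epsilon> * B)" by (simp add: b_def mult.commute mult.left_commute)
  then have nb': "norm b \<le> 3/4" using \<epsilon>B by linarith
  obtain s where s: "s \<in> M" "norm s \<le> 1/2" "(1 - s) * (1 - s) = 1 - b"
    and scomm: "\<And>x. x * b = b * x \<Longrightarrow> x * s = s * x"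
    using square_root_near_one[OF M bM nb'] by metis
  \<comment> \<open>The fixed point equation improves the bound 1/2 on \<open>s\<close> to one
    proportional to \<open>norm b\<close>, as needed for \<open>q\<close> to be close to
    \<open>a\<close>.\<close>
  have "2 *\<^sub>R s = b + s * s" using s(3) by (simp add: algebra_simps scaleR_2)
  then have "2 * norm s \<le> norm b + norm (s * s)"
    using norm_triangle_ineq[of b "s * s"] by (metis abs_numeral norm_scaleR)
  also have "\<dots> \<le> norm b + norm s * (1/2)"
    using norm_mult_ineq[of s s] mult_left_mono[OF s(2), of "norm s"] by simp
  finally have ns: "norm s \<le> 2/3 * norm b" by simp
  obtain y where y: "y \<in> M" "(1 - s) * y = 1" "y * (1 - s) = 1" "norm (y - 1) \<le> norm s / (1 - norm s)"
    using inverse_near_one[OF M, of "1 - s"] s in_M(8)[OF in_M(1) s(1)] by auto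
  have "norm s / (1 - norm s) \<le> norm s / (1/2)" using s(2) by (intro divide_left_mono) auto
  then have ny: "norm (y - 1) \<le> 4/3 * norm b" using y(4) ns by simp
  have "a * b = b * a" by (simp add: b_def algebra_simps)
  then have as: "a * s = s * a" by (rule scomm)
  have ay: "a * y = y * a"
  proof -
    have "a * (1 - s) = (1 - s) * a" using as by (simp add: algebra_simps)
    then have "y * (a * (1 - s)) * y = y * ((1 - s) * a) * y" by simp
    then have "y * a * ((1 - s) * y) = (y * (1 - s)) * a * y" by (simp only: mult.assoc)
    then show ?thesis using y by simp
  qed
  define h :: 'a where "h = (1/2) *\<^sub>R 1"
  define q where "q = h + (a - h) * y"
  have hh: "h + h = 1" by (simp add: h_def scaleR_add_left[symmetric])
  have hc: "h * x = x * h" for x by (simp add: h_def)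
  have hM: "h \<in> M" unfolding h_def by (intro in_M)
  have qM: "q \<in> M" unfolding q_def by (intro in_M hM aM y)
  have qq: "q * q = q"
  proof -
    define g where "g = (a - h) * y"
    have comm: "(a - h) * y = y * (a - h)" using ay hc[of y] by (simp add: algebra_simps)
    have "4 *\<^sub>R ((a - h) * (a - h)) = 1 - b"
    proof -
      have "(a - h) * (a - h) = a * a - a * (h + h) + h * h" by (simp add: algebra_simps hc[of a])
      then show ?thesis by (simp add: hh b_def h_def algebra_simps) (simp add: scaleR_add_left[symmetric])
    qed
    then have "4 *\<^sub>R ((a - h) * (a - h)) * (y * y) = (1 - s) * ((1 - s) * y) * y"
      by (simp add: s(3)[symmetric] mult.assoc)
    also have "\<dots> = 1" by (simp add: y)
    finally have "4 *\<^sub>R ((a - h) * (a - h) * (y * y)) = 1" by simp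
    moreover have "g * g = (a - h) * (a - h) * (y * y)"
    proof -
      have "g * g = (a - h) * (y * (a - h)) * y" by (simp add: g_def mult.assoc)
      then show ?thesis by (simp only: comm[symmetric] mult.assoc)
    qed
    ultimately have "4 *\<^sub>R (g * g) = 1" by simp
    then have "(1/4) *\<^sub>R (4 *\<^sub>R (g * g)) = (1/4) *\<^sub>R 1" by simp
    then have gg: "g * g = h * h" by (simp add: h_def)
    have qg: "q = h + g" by (simp add: q_def g_def)
    have "q * q = h * h + (h + h) * g + g * g"
      unfolding qg by (simp add: distrib_left distrib_right hc[of g] add_ac)
    also have "\<dots> = (h + h) * h + (h + h) * g" by (simp add: gg distrib_right add_ac)
    finally show ?thesis by (simp add: hh qg)
  qed
  have "q - a = (a - h) * (y - 1)" by (simp add: q_def algebra_simps)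
  then have "norm (q - a) \<le> norm (a - h) * norm (y - 1)" by (simp add: norm_mult_ineq)
  also have "\<dots> \<le> B * (4/3 * (8 * (\<epsilon> * B)))"
  proof (intro mult_mono)
    show "norm (a - h) \<le> B"
      using norm_triangle_ineq4[of a h] na by (simp add: h_def)
    show "norm (y - 1) \<le> 4/3 * (8 * (\<epsilon> * B))" using ny nb by simp
  qed (use B in auto)
  also have "\<dots> = 32/3 * (\<epsilon> * B\<^sup>2)" by (simp add: power2_eq_square)
  also have "\<dots> \<le> 11 * (\<epsilon> * B\<^sup>2)" using \<epsilon>(1) by (intro mult_right_mono) auto
  finally have "norm (q - a) \<le> 11 * (\<epsilon> * B\<^sup>2)" .
  moreover have "norm (a - f) \<le> \<epsilon> * B\<^sup>2"
  proof -
    have "\<epsilon> * 1 \<le> \<epsilon> * B\<^sup>2" using \<epsilon>(1) B by (intro mult_left_mono) (auto simp: one_le_power)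
    with naf show ?thesis by simp
  qed
  ultimately have nqf: "norm (q - f) \<le> 12 * (\<epsilon> * B\<^sup>2)"
    using norm_triangle_ineq[of "q - a" "a - f"] by simp
  have nq: "norm q \<le> B - 1"
  proof -
    have "\<epsilon> * B\<^sup>2 * 1 \<le> \<epsilon> * B\<^sup>2 * B" using B \<epsilon>(1) by (intro mult_left_mono) auto
    then have "norm (q - f) \<le> 1" using nqf \<epsilon>B by linarith
    then show ?thesis using norm_triangle_ineq[of f "q - f"] by (simp add: B)
  qed
  have qA: "q \<in> A" by (rule MA[OF qM])
  \<comment> \<open>The standard intertwiner of nearby idempotents:
    \<open>f * w1 = f * q = w1 * q\<close>, and it equals 1 if \<open>q = f\<close>.\<close>
  define w1 where "w1 = f * q + (1 - f) * (1 - q)"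
  have w1A: "w1 \<in> A" unfolding w1_def by (intro in_A f qA)
  have "w1 - 1 = f * (q - f) + (f - q) * q" by (simp add: w1_def algebra_simps f qq)
  then have "norm (w1 - 1) \<le> norm f * norm (q - f) + norm (q - f) * norm q"
    by (simp only:) (intro norm_triangle_le add_mono order_trans[OF norm_mult_ineq], simp_all add: norm_minus_commute)
  also have "\<dots> = norm (q - f) * (norm f + norm q)" by (simp add: algebra_simps)
  also have "\<dots> \<le> 12 * (\<epsilon> * B\<^sup>2) * (2 * B)"
    using nqf nq B \<epsilon>(1) by (intro mult_mono) auto
  also have "\<dots> < 1" using \<epsilon>B(2) by simp
  finally obtain v1 where w1: "inverses w1 v1" using inverses_near_one[OF w1A] by metis
  then have wv: "v1 \<in> A" "w1 * v1 = 1" "v1 * w1 = 1" by (auto simp: inverses_def)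
  have fw1: "f * w1 = w1 * q"
  proof -
    have "f * w1 = f * q" by (simp add: w1_def algebra_simps f mult.assoc[symmetric])
    moreover have "w1 * q = f * q" by (simp add: w1_def algebra_simps qq mult.assoc)
    ultimately show ?thesis by simp
  qed
  obtain Q where Q: "Q \<in> mats K" "q = \<phi> K Q" using qM by (auto simp: M_def)
  have QQ: "Q * Q = Q"
    using qq emb_eq_iff[OF mult_carrier_mat[OF Q(1) Q(1)] Q(1)] Q by (simp add: emb_mult)
  define m' where "m' = m * (\<Prod>k=K0..<K. n k)"
  \<comment> \<open>Conjugation by \<open>w1\<close> preserves \<open>tau\<close>, so the normalized
    rank is still \<open>m / msize K0\<close>, now at level \<open>K\<close>.\<close>
  have "mat_trace Q = of_nat m'"
  proof -
    have "tau q = tau (v1 * (f * w1))" unfolding fw1 by (simp add: mult.assoc[symmetric] wv)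
    also have "\<dots> = tau (f * w1 * v1)" by (rule tau_mult_commute) (use wv f w1A in \<open>auto intro: in_A\<close>)
    also have "\<dots> = tau f" by (simp add: mult.assoc wv)
    finally have "mat_trace Q / of_nat (msize K) = of_nat m / of_nat (msize K0)"
      using tau_emb[OF Q(1)] tr by (simp add: Q)
    then have "mat_trace Q = of_nat (msize K) * of_nat m / of_nat (msize K0)"
      using msize_neq_0[of K] by (simp add: field_simps)
    also have "\<dots> = of_nat m'"
    proof -
      have "of_nat (a * b) * of_nat c / of_nat a = (of_nat (c * b) :: complex)"
        if "of_nat a \<noteq> (0::complex)" for a b c :: nat using that by simp
      from this[OF msize_neq_0] show ?thesis unfolding msize_split[OF X(1)] m'_def .
    qed
    finally show ?thesis .
  qed
  then obtain W V where W: "W \<in> mats K" "V \<in> mats K" "W * V = 1\<^sub>m (msize K)" "V * W = 1\<^sub>m (msize K)"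
    "Q * W = W * diag_ones m' (msize K)"
    using idempotent_mat_conjugate[OF Q(1) QQ] by metis
  have iW: "inverses (\<phi> K W) (\<phi> K V)"
    unfolding inverses_def using emb_mult[OF W(1,2)] emb_mult[OF W(2,1)] W by simp
  have qW: "q * \<phi> K W = \<phi> K W * \<phi> K0 (diag_ones m (msize K0))"
    using emb_mult[OF Q(1) W(1)] emb_mult[OF W(1) diag_ones_carrier] W(5) emb_diag_ones[OF X(1), of m]
    by (simp add: Q m'_def)
  have "f * (w1 * \<phi> K W) = w1 * (q * \<phi> K W)" by (simp add: mult.assoc[symmetric] fw1)
  also have "\<dots> = w1 * \<phi> K W * \<phi> K0 (diag_ones m (msize K0))" unfolding qW by (simp add: mult.assoc)
  finally show ?thesis using that[OF inverses_mult[OF w1 iW]] by simp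
qed

end

section \<open>Powers of the anomaly\<close>

lemma Z3_pow:
  assumes "x \<in> carrier (Z3 G)"
  shows "x [^]\<^bsub>Z3 G\<^esub> (k::nat) = (\<lambda>p\<in>carrier G \<times> carrier G \<times> carrier G. x p ^ k)"
proof (induction k)
  case 0
  show ?case by (simp add: Z3_def cochains3_def product_group_def circle_group_def)
next
  case (Suc k)
  then show ?case
    by (auto simp: Z3_def cochains3_def product_group_def circle_group_def fun_eq_iff mult.commute)
qed

text \<open>\<open>b\<close> is only nonzero, being a determinant of invertible elements. Since
  \<open>sgn\<close> is multiplicative and fixes the unimodular power of \<open>\<omega>\<close>,
  the cochain \<open>sgn (b g h) ^ Q\<close> on the circle has the same coboundary.\<close>

lemma ord_cohomology_class3_dvd:
  fixes G :: "('g, 'm) monoid_scheme" and b :: "'g \<Rightarrow> 'g \<Rightarrow> complex"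
  assumes G: "group G" and \<omega>: "\<omega> \<in> cocycles3 G"
    and nz: "\<And>g h. g \<in> carrier G \<Longrightarrow> h \<in> carrier G \<Longrightarrow> b g h \<noteq> 0"
    and eq: "\<And>g h k. g \<in> carrier G \<Longrightarrow> h \<in> carrier G \<Longrightarrow> k \<in> carrier G \<Longrightarrow>
      \<omega> (g, h, k) ^ Q = (b h k * inverse (b (g \<otimes>\<^bsub>G\<^esub> h) k) * b g (h \<otimes>\<^bsub>G\<^esub> k) * inverse (b g h)) ^ Q"
  shows "group.ord (H3 G) (cohomology_class3 G \<omega>) dvd Q"
proof -
  interpret group G by fact
  interpret Z: comm_group "Z3 G" by (rule comm_group_Z3[OF G])
  interpret H: comm_group "H3 G" by (rule comm_group_H3[OF G])
  have "group (cochains2 G)" unfolding cochains2_def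
    using comm_group.axioms(2)[OF comm_group_circle_group] by simp
  then have "group_hom (cochains2 G) (Z3 G) (coboundary2 G)"
    using coboundary2_hom[OF G] Z.group_axioms by (simp add: group_hom_def group_hom_axioms_def)
  then have sub: "subgroup (coboundaries3 G) (Z3 G)"
    unfolding coboundaries3_def by (rule group_hom.img_is_subgroup)
  then interpret N: normal "coboundaries3 G" "Z3 G" by (rule Z.subgroup_imp_normal)
  have wZ: "\<omega> \<in> carrier (Z3 G)" using \<omega> by (simp add: Z3_def)
  have n\<omega>: "cmod (\<omega> (g, h, k)) = 1" if "g \<in> carrier G" "h \<in> carrier G" "k \<in> carrier G" for g h k
    using \<omega> that by (auto simp: cocycles3_def cochains3_def circle_group_def PiE_iff)
  define \<beta> where "\<beta> = (\<lambda>(g, h)\<in>carrier G \<times> carrier G. sgn (b g h) ^ Q)"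
  have \<beta>: "\<beta> \<in> carrier (cochains2 G)"
    using nz by (auto simp: \<beta>_def cochains2_def circle_group_def norm_power norm_sgn)
  have "\<omega> [^]\<^bsub>Z3 G\<^esub> Q = coboundary2 G \<beta>"
  proof
    fix p :: "'g \<times> 'g \<times> 'g"
    obtain g h k where p: "p = (g, h, k)" by (cases p)
    show "(\<omega> [^]\<^bsub>Z3 G\<^esub> Q) p = coboundary2 G \<beta> p"
    proof (cases "g \<in> carrier G \<and> h \<in> carrier G \<and> k \<in> carrier G")
      case True
      then have "sgn (\<omega> (g, h, k) ^ Q) = \<omega> (g, h, k) ^ Q"
        using n\<omega> by (simp add: sgn_eq norm_power)
      then have "\<omega> (g, h, k) ^ Q =
          sgn ((b h k * inverse (b (g \<otimes>\<^bsub>G\<^esub> h) k) * b g (h \<otimes>\<^bsub>G\<^esub> k) * inverse (b g h)) ^ Q)"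
        using eq True by simp
      moreover have sp: "sgn (x ^ m) = sgn x ^ m" for x :: complex and m
        by (induction m) (simp_all add: sgn_mult)
      moreover have "sgn (inverse x) = inverse (sgn x)" for x :: complex
          by (simp add: sgn_eq norm_inverse divide_inverse mult.commute)
      ultimately show ?thesis
        using True by (simp add: Z3_pow[OF wZ] p coboundary2_def \<beta>_def sgn_mult power_mult_distrib power_inverse)
    next
      case False
      then show ?thesis by (auto simp: Z3_pow[OF wZ] p coboundary2_def)
    qed
  qed
  then have in_H: "\<omega> [^]\<^bsub>Z3 G\<^esub> Q \<in> coboundaries3 G" using \<beta> by (auto simp: coboundaries3_def)
  have hom: "(\<lambda>a. coboundaries3 G #>\<^bsub>Z3 G\<^esub> a) \<in> hom (Z3 G) (H3 G)"
    unfolding H3_def by (rule N.r_coset_hom_Mod)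
  have "cohomology_class3 G \<omega> [^]\<^bsub>H3 G\<^esub> Q = coboundaries3 G #>\<^bsub>Z3 G\<^esub> (\<omega> [^]\<^bsub>Z3 G\<^esub> Q)"
    unfolding cohomology_class3_def
    by (rule hom_nat_pow[OF hom wZ Z.group_axioms H.group_axioms, symmetric])
  also have "\<dots> = coboundaries3 G"
    by (rule Z.coset_join2[OF _ sub in_H]) (use wZ in simp)
  also have "\<dots> = \<one>\<^bsub>H3 G\<^esub>" by (simp add: H3_def FactGroup_def)
  finally have "cohomology_class3 G \<omega> [^]\<^bsub>H3 G\<^esub> Q = \<one>\<^bsub>H3 G\<^esub>" .
  moreover have "cohomology_class3 G \<omega> \<in> carrier (H3 G)"
    using hom wZ unfolding cohomology_class3_def hom_def by blast
  ultimately show ?thesis using H.pow_eq_id by blast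
qed

section \<open>The determinant applied to an anomalous action\<close>

context matrix_tower
begin

lemma bounded_endo_star_automorphism:
  assumes f: "f \<in> star_automorphisms A"
  shows "bounded_endo 2 f"
proof -
  have "1 \<in> f ` A" using f in_A(1) by (simp add: star_automorphisms_def bij_betw_def)
  then obtain y where y: "y \<in> A" "f y = 1" by auto
  have mult: "f (x * y) = f x * f y" if "x \<in> A" "y \<in> A" for x y
    using f that by (simp add: star_automorphisms_def)
  have "f 1 = 1" using mult[OF in_A(1) y(1)] y(2) by simp
  moreover have "f x \<in> A" if "x \<in> A" for x
    using f that by (auto simp: star_automorphisms_def bij_betw_def)
  ultimately show ?thesis
    using f star_automorphism_bounded[OF subalgebra f]
    unfolding bounded_endo_def star_automorphisms_def by blast
qed

lemma bounded_endo_inverses: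
  "bounded_endo C \<theta> \<Longrightarrow> inverses u v \<Longrightarrow> inverses (\<theta> u) (\<theta> v)"
  unfolding inverses_def by (metis bounded_endoD(1,2,5))

lemma bounded_endo_conj:
  assumes \<theta>: "bounded_endo C \<theta>" and w: "inverses w w'"
  shows "bounded_endo (norm w' * C * norm w) (\<lambda>x. w' * \<theta> x * w)"
proof -
  note E = bounded_endoD[OF \<theta>]
  have W: "w \<in> A" "w' \<in> A" "w * w' = 1" "w' * w = 1" using w by (auto simp: inverses_def)
  have "norm (w' * \<theta> x * w) \<le> norm w' * C * norm w * norm x" if "x \<in> A" for x
  proof -
    have "norm (w' * \<theta> x * w) \<le> norm (w' * \<theta> x) * norm w" by (rule norm_mult_ineq)
    also have "\<dots> \<le> norm w' * norm (\<theta> x) * norm w" by (intro mult_right_mono norm_mult_ineq) auto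
    also have "\<dots> \<le> norm w' * (C * norm x) * norm w"
      by (intro mult_right_mono mult_left_mono E(3) that) auto
    finally show ?thesis by (simp add: mult_ac)
  qed
  moreover have "w' * \<theta> (x * y) * w = w' * \<theta> x * w * (w' * \<theta> y * w)" if "x \<in> A" "y \<in> A" for x y
  proof -
    have "w' * \<theta> x * w * (w' * \<theta> y * w) = w' * \<theta> x * (w * w') * \<theta> y * w" by (simp only: mult.assoc)
    then show ?thesis using that by (simp add: W E mult.assoc)
  qed
  ultimately show ?thesis
    unfolding bounded_endo_def using W E
    by (auto simp: distrib_left distrib_right mult_scaleC_left mult_scaleC_right intro!: in_A)
qed

text \<open>The element is the diagonal matrix with entries \<open>c\<close>, 1, ..., 1 of size
  \<open>msize K0\<close>, so its determinant is \<open>c\<close> and the normalized one a root of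
  \<open>c\<close> of that degree.\<close>

lemma log_det_corner_scalar:
  fixes K0 :: nat
  assumes "c \<noteq> 0"
  defines "e \<equiv> \<phi> K0 (diag_ones 1 (msize K0))"
  shows "log_det (c *\<^sub>C e + (1 - e)) (ln c / of_nat (msize K0))"
proof -
  define P where "P = 1\<^sub>m (msize K0) + (c - 1) \<cdot>\<^sub>m diag_ones 1 (msize K0)"
  have P: "P \<in> mats K0" by (simp add: P_def)
  have ut: "upper_triangular P" by (auto simp: P_def diag_ones_def)
  have "det P = (\<Prod>i<msize K0. P $$ (i, i))"
    unfolding det_upper_triangular[OF ut P] prod_list_diag_prod
    using carrier_matD(1)[OF P] by (simp only: atLeast0LessThan)
  also have "\<dots> = (\<Prod>i<msize K0. if i = 0 then c else 1)"
    by (intro prod.cong refl) (auto simp: P_def diag_ones_def)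
  also have "\<dots> = c" using msize_pos[of K0] by (subst prod.delta) auto
  finally have "det P = exp (of_nat (msize K0) * (ln c / of_nat (msize K0)))"
    using msize_neq_0[of K0] assms(1) by simp
  then have "log_det (\<phi> K0 P) (ln c / of_nat (msize K0))" by (rule log_det_emb[OF P])
  moreover have "\<phi> K0 P = c *\<^sub>C e + (1 - e)"
    by (simp add: P_def e_def emb_add emb_smult scaleC_diff_left scaleC_one)
  ultimately show ?thesis by simp
qed

lemma exp_msize_mono:
  assumes "exp (of_nat (msize K) * D) = 1" "K \<le> K'"
  shows "exp (of_nat (msize K') * D) = (1::complex)"
proof -
  have "of_nat (msize K') * D = of_nat (\<Prod>k=K..<K'. n k) * (of_nat (msize K) * D)"
    unfolding msize_split[OF assms(2)] of_nat_mult by (simp only: mult_ac)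
  then show ?thesis using assms(1) by (simp only: exp_of_nat_mult power_one)
qed

text \<open>The action is perturbed by inner automorphisms so that it fixes a minimal projection \<open>e\<close> of the
  matrix algebra number \<open>K0\<close>. The determinant is then applied to the action cut down to the corner
  of \<open>e\<close>, where only the factors of index at least \<open>K0\<close> survive.\<close>

lemma anomaly_power_coboundary:
  fixes G :: "('g, 'm) monoid_scheme"
  assumes G: "group G" and fin: "finite (carrier G)" and \<omega>: "\<omega> \<in> cocycles3 G"
    and act: "anomalous_action G \<omega> A \<theta> u"
  obtains K b where "K \<ge> K0" "\<And>g h. b g h \<noteq> (0::complex)"
    "\<And>g h k. g \<in> carrier G \<Longrightarrow> h \<in> carrier G \<Longrightarrow> k \<in> carrier G \<Longrightarrow>
      \<omega> (g, h, k) ^ (\<Prod>k=K0..<K. n k) =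
      (b h k * inverse (b (g \<otimes>\<^bsub>G\<^esub> h) k) * b g (h \<otimes>\<^bsub>G\<^esub> k) * inverse (b g h)) ^ (\<Prod>k=K0..<K. n k)"
proof -
  interpret group G by fact
  define e where "e = \<phi> K0 (diag_ones 1 (msize K0))"
  have eA: "e \<in> A" by (simp add: e_def)
  have "\<phi> K0 (diag_ones 1 (msize K0) * diag_ones 1 (msize K0)) = e * e"
    unfolding e_def by (intro emb_mult diag_ones_carrier)
  then have ee: "e * e = e" unfolding diag_ones_idem e_def[symmetric] by (rule sym)
  have "1 \<le> msize K0" using msize_pos[of K0] by linarith
  then have te: "tau e = of_nat 1 / of_nat (msize K0)"
    unfolding e_def tau_emb[OF diag_ones_carrier] by (simp only: mat_trace_diag_ones)
  have \<theta>: "bounded_endo 2 (\<theta> g)" if "g \<in> carrier G" for g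
    using act that bounded_endo_star_automorphism by (auto simp: anomalous_action_def)
  note E = bounded_endoD[OF \<theta>]
  have iu: "inverses (u g h) (adj (u g h))" if "g \<in> carrier G" "h \<in> carrier G" for g h
  proof -
    have "u g h \<in> unitary_elements A" using act that by (auto simp: anomalous_action_def)
    then show ?thesis using subalgebra
      by (auto simp: unitary_elements_def inverses_def unital_cstar_subalgebra_def)
  qed
  have conj: "\<theta> (g \<otimes>\<^bsub>G\<^esub> h) x * u g h = u g h * \<theta> g (\<theta> h x)"
    if "g \<in> carrier G" "h \<in> carrier G" "x \<in> A" for g h x
  proof -
    have "\<theta> (g \<otimes>\<^bsub>G\<^esub> h) x = u g h * \<theta> g (\<theta> h x) * adj (u g h)"
      using act that by (auto simp: anomalous_action_def Ad_def)
    then show ?thesis using iu[OF that(1,2)] by (simp add: inverses_def mult.assoc)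
  qed
  have anomaly: "\<omega> (g, h, k) *\<^sub>C (u (g \<otimes>\<^bsub>G\<^esub> h) k * u g h) = u g (h \<otimes>\<^bsub>G\<^esub> k) * \<theta> g (u h k)"
    if "g \<in> carrier G" "h \<in> carrier G" "k \<in> carrier G" for g h k
    using act that by (auto simp: anomalous_action_def)
  \<comment> \<open>Automorphisms preserve \<open>tau\<close>, so \<open>\<theta> g e\<close> is an
    idempotent of trace \<open>1 / msize K0\<close> and conjugate to \<open>e\<close>.\<close>
  have "\<exists>w w'. inverses w w' \<and> \<theta> g e * w = w * e" if g: "g \<in> carrier G" for g
  proof -
    have "tau (\<theta> g e) = of_nat 1 / of_nat (msize K0)"
      using tau_bounded_endo[OF \<theta>[OF g] eA] te by simp
    then obtain w w' where "inverses w w'" "\<theta> g e * w = w * \<phi> K0 (diag_ones 1 (msize K0))"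
      using idempotent_conjugate_emb[of "\<theta> g e" 1 K0] E(2)[OF g eA] E(5)[OF g eA eA] ee by metis
    then show ?thesis unfolding e_def by blast
  qed
  then obtain w w' where iw: "\<And>g. g \<in> carrier G \<Longrightarrow> inverses (w g) (w' g)"
    and we: "\<And>g. g \<in> carrier G \<Longrightarrow> \<theta> g e * w g = w g * e"
    by metis
  have W: "w g \<in> A" "w' g \<in> A" "w g * w' g = 1" "w' g * w g = 1" if "g \<in> carrier G" for g
    using iw[OF that] by (auto simp: inverses_def)
  have we': "w' g * \<theta> g e = e * w' g" if "g \<in> carrier G" for g
  proof -
    have "w' g * (\<theta> g e * w g) * w' g = w' g * (w g * e) * w' g" using we[OF that] by simp
    then have "w' g * \<theta> g e * (w g * w' g) = (w' g * w g) * e * w' g" by (simp only: mult.assoc)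
    then show ?thesis using W[OF that] by simp
  qed
  define \<theta>' where "\<theta>' g x = w' g * \<theta> g x * w g" for g x
  define C where "C g = norm (w' g) * 2 * norm (w g)" for g
  have \<theta>': "bounded_endo (C g) (\<theta>' g)" if "g \<in> carrier G" for g
    using bounded_endo_conj[OF \<theta>[OF that] iw[OF that]] by (simp add: \<theta>'_def[abs_def] C_def)
  note E' = bounded_endoD[OF \<theta>']
  have \<theta>'e: "\<theta>' g e = e" if "g \<in> carrier G" for g
    using we'[OF that] W[OF that] by (simp add: \<theta>'_def mult.assoc)
  \<comment> \<open>The correction of \<open>u\<close> that belongs to \<open>\<theta>'\<close>: it
    keeps the anomaly equal to \<open>\<omega>\<close>, and it commutes with \<open>e\<close>
    because all \<open>\<theta>' g\<close> fix \<open>e\<close>.\<close>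
  define v where "v g h = w' (g \<otimes>\<^bsub>G\<^esub> h) * u g h * \<theta> g (w h) * w g" for g h
  have "\<exists>v'. inverses (v g h) v'" if "g \<in> carrier G" "h \<in> carrier G" for g h
    unfolding v_def using that
    by (meson inverses_mult inverses_sym iw iu bounded_endo_inverses \<theta> m_closed)
  then obtain v' where iv: "\<And>g h. g \<in> carrier G \<Longrightarrow> h \<in> carrier G \<Longrightarrow> inverses (v g h) (v' g h)"
    by metis
  have V: "v g h \<in> A" "v' g h \<in> A" "v g h * v' g h = 1" "v' g h * v g h = 1"
    if "g \<in> carrier G" "h \<in> carrier G" for g h
    using iv[OF that] by (auto simp: inverses_def)
  have ve: "v g h * e = e * v g h" if g: "g \<in> carrier G" and h: "h \<in> carrier G" for g h
  proof -
    have gh: "g \<otimes>\<^bsub>G\<^esub> h \<in> carrier G" using g h by simp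
    have "v g h * e = w' (g \<otimes>\<^bsub>G\<^esub> h) * u g h * \<theta> g (w h) * (w g * e)" by (simp add: v_def mult.assoc)
    also have "\<dots> = w' (g \<otimes>\<^bsub>G\<^esub> h) * u g h * (\<theta> g (w h) * \<theta> g e) * w g"
      unfolding we[OF g, symmetric] by (simp add: mult.assoc)
    also have "\<theta> g (w h) * \<theta> g e = \<theta> g (\<theta> h e) * \<theta> g (w h)"
      using E(5)[OF g W(1)[OF h] eA] E(5)[OF g E(2)[OF h eA] W(1)[OF h]] we[OF h] by simp
    also have "w' (g \<otimes>\<^bsub>G\<^esub> h) * u g h * (\<theta> g (\<theta> h e) * \<theta> g (w h)) * w g =
        w' (g \<otimes>\<^bsub>G\<^esub> h) * (u g h * \<theta> g (\<theta> h e)) * \<theta> g (w h) * w g" by (simp add: mult.assoc)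
    also have "\<dots> = (w' (g \<otimes>\<^bsub>G\<^esub> h) * \<theta> (g \<otimes>\<^bsub>G\<^esub> h) e) * u g h * \<theta> g (w h) * w g"
      unfolding conj[OF g h eA, symmetric] by (simp add: mult.assoc)
    also have "\<dots> = e * v g h" unfolding we'[OF gh] by (simp add: v_def mult.assoc)
    finally show ?thesis .
  qed
  have v'e: "v' g h * e = e * v' g h" if "g \<in> carrier G" "h \<in> carrier G" for g h
  proof -
    have "v' g h * (e * v g h) * v' g h = v' g h * (v g h * e) * v' g h" using ve[OF that] by simp
    then have "v' g h * e * (v g h * v' g h) = (v' g h * v g h) * e * v' g h" by (simp only: mult.assoc)
    then show ?thesis using V[OF that] by simp
  qed
  have v_anomaly: "\<omega> (g, h, k) *\<^sub>C (v (g \<otimes>\<^bsub>G\<^esub> h) k * v g h) = v g (h \<otimes>\<^bsub>G\<^esub> k) * \<theta>' g (v h k)"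
    if g: "g \<in> carrier G" and h: "h \<in> carrier G" and k: "k \<in> carrier G" for g h k
  proof -
    have gh: "g \<otimes>\<^bsub>G\<^esub> h \<in> carrier G" and hk: "h \<otimes>\<^bsub>G\<^esub> k \<in> carrier G" using g h k by simp_all
    define x where "x = w' (g \<otimes>\<^bsub>G\<^esub> h \<otimes>\<^bsub>G\<^esub> k)"
    define t where "t = \<theta> g (\<theta> h (w k)) * \<theta> g (w h) * w g"
    have uA: "u h k \<in> A" "u g h \<in> A" using iu g h k by (auto simp: inverses_def)
    have "v (g \<otimes>\<^bsub>G\<^esub> h) k * v g h =
        x * u (g \<otimes>\<^bsub>G\<^esub> h) k * \<theta> (g \<otimes>\<^bsub>G\<^esub> h) (w k) * (w (g \<otimes>\<^bsub>G\<^esub> h) * w' (g \<otimes>\<^bsub>G\<^esub> h)) * u g h * \<theta> g (w h) * w g"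
      by (simp only: v_def x_def mult.assoc)
    also have "\<dots> = x * u (g \<otimes>\<^bsub>G\<^esub> h) k * (\<theta> (g \<otimes>\<^bsub>G\<^esub> h) (w k) * u g h) * \<theta> g (w h) * w g"
      using W(3)[OF gh] by (simp add: mult.assoc)
    also have "\<dots> = x * (u (g \<otimes>\<^bsub>G\<^esub> h) k * u g h) * t"
      unfolding conj[OF g h W(1)[OF k]] by (simp add: t_def mult.assoc)
    finally have L: "\<omega> (g, h, k) *\<^sub>C (v (g \<otimes>\<^bsub>G\<^esub> h) k * v g h) =
        x * (u g (h \<otimes>\<^bsub>G\<^esub> k) * \<theta> g (u h k)) * t"
      by (simp add: anomaly[OF g h k, symmetric] mult_scaleC_left mult_scaleC_right)
    have "\<theta> g (v h k) = \<theta> g (w' (h \<otimes>\<^bsub>G\<^esub> k)) * \<theta> g (u h k) * \<theta> g (\<theta> h (w k)) * \<theta> g (w h)"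
      unfolding v_def using W(1)[OF h] W(2)[OF hk] uA(1) E(2)[OF h W(1)[OF k]]
      by (simp add: E(5)[OF g] in_A)
    then have "v g (h \<otimes>\<^bsub>G\<^esub> k) * \<theta>' g (v h k) = x * u g (h \<otimes>\<^bsub>G\<^esub> k) *
        (\<theta> g (w (h \<otimes>\<^bsub>G\<^esub> k)) * ((w g * w' g) * \<theta> g (w' (h \<otimes>\<^bsub>G\<^esub> k)))) * \<theta> g (u h k) * t"
      using g h k by (simp only: v_def \<theta>'_def x_def t_def m_assoc mult.assoc)
    also have "\<theta> g (w (h \<otimes>\<^bsub>G\<^esub> k)) * ((w g * w' g) * \<theta> g (w' (h \<otimes>\<^bsub>G\<^esub> k))) = 1"
      using E(5)[OF g W(1)[OF hk] W(2)[OF hk]] W(3)[OF g] W(3)[OF hk] E(1)[OF g] by simp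
    finally show ?thesis unfolding L by (simp add: mult.assoc)
  qed
  \<comment> \<open>The corner part of \<open>v\<close>, completed by \<open>1 - e\<close> to an
    invertible element of \<open>A\<close>.\<close>
  define z where "z g h = v g h * e + (1 - e)" for g h
  have comm_mult: "(x * e + (1 - e)) * (y * e + (1 - e)) = x * y * e + (1 - e)" if "y * e = e * y" for x y
  proof -
    have "x * e * (y * e) = x * y * e" using that by (simp add: mult.assoc[symmetric] ee) (metis ee mult.assoc that)
    moreover have "x * e * (1 - e) = 0" by (simp add: right_diff_distrib mult.assoc ee)
    moreover have "(1 - e) * (y * e) = 0" using that by (simp add: left_diff_distrib mult.assoc[symmetric] ee)
    moreover have "(1 - e) * (1 - e) = 1 - e" by (simp add: algebra_simps ee)
    ultimately show ?thesis by (simp add: distrib_left distrib_right)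
  qed
  have iz: "inverses (z g h) (v' g h * e + (1 - e))" if "g \<in> carrier G" "h \<in> carrier G" for g h
    unfolding inverses_def z_def comm_mult[OF ve[OF that]] comm_mult[OF v'e[OF that]] V(3,4)[OF that]
    by (intro conjI in_A V[OF that] eA) simp_all
  have \<theta>'z: "\<theta>' g (z h k) = \<theta>' g (v h k) * e + (1 - e)"
    if "g \<in> carrier G" "h \<in> carrier G" "k \<in> carrier G" for g h k
    using V(1)[OF that(2,3)] eA \<theta>'e[OF that(1)]
    by (simp add: z_def E'(1,4,5,7)[OF that(1)] in_A)
  \<comment> \<open>The scalar now acts on the corner only, as an element whose determinant
    \<open>log_det_corner_scalar\<close> provides.\<close>
  have relation: "(\<omega> (g, h, k) *\<^sub>C e + (1 - e)) * z (g \<otimes>\<^bsub>G\<^esub> h) k * z g h = z g (h \<otimes>\<^bsub>G\<^esub> k) * \<theta>' g (z h k)"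
    if g: "g \<in> carrier G" and h: "h \<in> carrier G" and k: "k \<in> carrier G" for g h k
  proof -
    have gh: "g \<otimes>\<^bsub>G\<^esub> h \<in> carrier G" using g h by simp
    have \<theta>v: "\<theta>' g (v h k) * e = e * \<theta>' g (v h k)"
      using E'(5)[OF g V(1)[OF h k] eA] E'(5)[OF g eA V(1)[OF h k]] ve[OF h k] \<theta>'e[OF g] by simp
    have "(\<omega> (g, h, k) *\<^sub>C 1 * e + (1 - e)) * z (g \<otimes>\<^bsub>G\<^esub> h) k * z g h =
        \<omega> (g, h, k) *\<^sub>C 1 * v (g \<otimes>\<^bsub>G\<^esub> h) k * v g h * e + (1 - e)"
      unfolding z_def by (simp only: comm_mult[OF ve[OF gh k]] comm_mult[OF ve[OF g h]])
    also have "\<dots> = (v g (h \<otimes>\<^bsub>G\<^esub> k) * \<theta>' g (v h k)) * e + (1 - e)"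
      by (simp add: v_anomaly[OF g h k, symmetric] mult_scaleC_left)
    also have "\<dots> = z g (h \<otimes>\<^bsub>G\<^esub> k) * \<theta>' g (z h k)"
      unfolding \<theta>'z[OF g h k] unfolding z_def by (rule comm_mult[OF \<theta>v, symmetric])
    finally show ?thesis by (simp add: mult_scaleC_left)
  qed
  define S where "S = 1 + (\<Sum>g\<in>carrier G. C g)"
  have C0: "C g \<ge> 0" for g by (simp add: C_def)
  have S: "S \<ge> 1" "\<And>g. g \<in> carrier G \<Longrightarrow> C g \<le> S"
  proof -
    show "S \<ge> 1" using C0 by (simp add: S_def sum_nonneg)
    show "C g \<le> S" if "g \<in> carrier G" for g
      using member_le_sum[OF that _ fin, of C] C0 by (simp add: S_def)
  qed
  \<comment> \<open>Fine enough for every \<open>\<theta>' g\<close> at once to map factors within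
    \<open>\<delta>\<close> of 1 to factors within 1/4; finiteness of the group enters through
    \<open>S\<close>.\<close>
  define \<delta> where "\<delta> = 1 / (4 * S)"
  have \<delta>: "\<delta> > 0" "\<delta> \<le> 1/4" using S(1) by (auto simp: \<delta>_def field_simps)
  have C\<delta>: "C g * \<delta> \<le> 1/4" if "g \<in> carrier G" for g
    using S(1) S(2)[OF that] by (simp add: \<delta>_def field_simps)
  have "\<exists>d. near_product \<delta> (z g h) d" if "g \<in> carrier G" "h \<in> carrier G" for g h
    using near_generated_invertible[OF iz[OF that] \<delta>(1)] by (simp add: near_generated_def)
  then obtain d where d: "\<And>g h. g \<in> carrier G \<Longrightarrow> h \<in> carrier G \<Longrightarrow> near_product \<delta> (z g h) (d g h)"
    by metis
  \<comment> \<open>The two sides of \<open>relation\<close> are one element with two logarithms,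
    and \<open>D\<close> is their difference; by \<open>log_det_unique\<close> a suitable
    \<open>msize K\<close> makes it a logarithm of 1.\<close>
  define D where "D g h k = ln (\<omega> (g, h, k)) / of_nat (msize K0) + d (g \<otimes>\<^bsub>G\<^esub> h) k + d g h
    - (d g (h \<otimes>\<^bsub>G\<^esub> k) + d h k)" for g h k
  have \<omega>0: "\<omega> (g, h, k) \<noteq> 0" if "g \<in> carrier G" "h \<in> carrier G" "k \<in> carrier G" for g h k
  proof -
    have "cmod (\<omega> (g, h, k)) = 1"
      using \<omega> that by (auto simp: cocycles3_def cochains3_def circle_group_def PiE_iff)
    then show ?thesis by auto
  qed
  have "\<exists>K. K \<ge> K0 \<and> exp (of_nat (msize K) * D g h k) = 1"
    if g: "g \<in> carrier G" and h: "h \<in> carrier G" and k: "k \<in> carrier G" for g h k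
  proof -
    have gh: "g \<otimes>\<^bsub>G\<^esub> h \<in> carrier G" and hk: "h \<otimes>\<^bsub>G\<^esub> k \<in> carrier G" using g h k by simp_all
    have ld: "log_det (z g h) (d g h)" if "g \<in> carrier G" "h \<in> carrier G" for g h
      using near_product_imp_log_det[OF d[OF that] \<delta>(2)] .
    have "near_product (1/4) (\<theta>' g (z h k)) (d h k)"
      using near_product_endo[OF \<theta>'[OF g] C\<delta>[OF g] d[OF h k]] by blast
    then have l1: "log_det (\<theta>' g (z h k)) (d h k)" by (rule near_product_imp_log_det) simp
    have "log_det (z g (h \<otimes>\<^bsub>G\<^esub> k) * \<theta>' g (z h k)) (d g (h \<otimes>\<^bsub>G\<^esub> k) + d h k)"
      by (rule log_det_mult[OF ld[OF g hk] l1 bounded_endo_inverses[OF \<theta>'[OF g] iz[OF h k]]])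
    moreover have "log_det ((\<omega> (g, h, k) *\<^sub>C e + (1 - e)) * z (g \<otimes>\<^bsub>G\<^esub> h) k * z g h)
        (ln (\<omega> (g, h, k)) / of_nat (msize K0) + d (g \<otimes>\<^bsub>G\<^esub> h) k + d g h)"
      unfolding e_def
      by (intro log_det_mult[OF _ ld[OF g h] iz[OF g h]] log_det_mult[OF _ ld[OF gh k] iz[OF gh k]]
          log_det_corner_scalar \<omega>0 g h k)
    ultimately show ?thesis
      unfolding relation[OF g h k] D_def using log_det_unique[of _ _ _ K0] by metis
  qed
  then obtain L where L: "\<And>g h k. g \<in> carrier G \<Longrightarrow> h \<in> carrier G \<Longrightarrow> k \<in> carrier G \<Longrightarrow>
      exp (of_nat (msize (L g h k)) * D g h k) = 1"
    by metis
  \<comment> \<open>The sum bounds all levels \<open>L g h k\<close> at once, and a larger level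
    only raises the relation to an integer power.\<close>
  define K where "K = K0 + (\<Sum>g\<in>carrier G. \<Sum>h\<in>carrier G. \<Sum>k\<in>carrier G. L g h k)"
  have LK: "L g h k \<le> K" if "g \<in> carrier G" "h \<in> carrier G" "k \<in> carrier G" for g h k
  proof -
    have "L g h k \<le> (\<Sum>k\<in>carrier G. L g h k)" by (rule member_le_sum[OF that(3) _ fin]) simp
    also have "\<dots> \<le> (\<Sum>h\<in>carrier G. \<Sum>k\<in>carrier G. L g h k)"
      by (rule member_le_sum[OF that(2) _ fin, of "\<lambda>h. \<Sum>k\<in>carrier G. L g h k"]) simp
    also have "\<dots> \<le> (\<Sum>g\<in>carrier G. \<Sum>h\<in>carrier G. \<Sum>k\<in>carrier G. L g h k)"
      by (rule member_le_sum[OF that(1) _ fin, of "\<lambda>g. \<Sum>h\<in>carrier G. \<Sum>k\<in>carrier G. L g h k"]) simp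
    finally show ?thesis by (simp add: K_def)
  qed
  define Q where "Q = (\<Prod>k=K0..<K. n k)"
  \<comment> \<open>Of the exponent \<open>msize K = msize K0 * Q\<close>, the first factor goes
    into \<open>b\<close> and cancels the denominator under \<open>ln (\<omega> (g, h, k))\<close>;
    the second remains as the power.\<close>
  define b where "b g h = exp (of_nat (msize K0) * d g h)" for g h
  show ?thesis
  proof (rule that[of K b])
    show "K0 \<le> K" by (simp add: K_def)
    show "b g h \<noteq> 0" for g h by (simp add: b_def)
    fix g h k assume g: "g \<in> carrier G" and h: "h \<in> carrier G" and k: "k \<in> carrier G"
    have "1 = exp (of_nat (msize K) * D g h k)"
      using exp_msize_mono[OF L[OF g h k] LK[OF g h k]] by simp
    also have "of_nat (msize K) * D g h k = of_nat Q * (of_nat (msize K0) * D g h k)"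
      unfolding msize_split[OF \<open>K0 \<le> K\<close>] of_nat_mult Q_def by (simp only: mult_ac)
    also have "exp \<dots> = exp (of_nat (msize K0) * D g h k) ^ Q" by (rule exp_of_nat_mult)
    also have "of_nat (msize K0) * D g h k = ln (\<omega> (g, h, k)) + of_nat (msize K0) * d (g \<otimes>\<^bsub>G\<^esub> h) k
        + of_nat (msize K0) * d g h - of_nat (msize K0) * d g (h \<otimes>\<^bsub>G\<^esub> k) - of_nat (msize K0) * d h k"
    proof -
      have "N * (l / N + d1 + d2 - (d3 + d4)) = l + N * d1 + N * d2 - N * d3 - N * d4"
        if "N \<noteq> 0" for N l d1 d2 d3 d4 :: complex
        using that by (simp add: algebra_simps)
      from this[OF msize_neq_0[of K0]] show ?thesis unfolding D_def .
    qed
    also have "exp \<dots> = \<omega> (g, h, k) * b (g \<otimes>\<^bsub>G\<^esub> h) k * b g h / b g (h \<otimes>\<^bsub>G\<^esub> k) / b h k"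
      unfolding exp_diff exp_add b_def using \<omega>0[OF g h k] by simp
    finally have "(\<omega> (g, h, k) * b (g \<otimes>\<^bsub>G\<^esub> h) k * b g h / b g (h \<otimes>\<^bsub>G\<^esub> k) / b h k) ^ Q = 1" by simp
    then have "\<omega> (g, h, k) ^ Q =
        (b h k * inverse (b (g \<otimes>\<^bsub>G\<^esub> h) k) * b g (h \<otimes>\<^bsub>G\<^esub> k) * inverse (b g h)) ^ Q"
      by (simp add: b_def power_mult_distrib power_divide power_inverse field_simps)
    then show "\<omega> (g, h, k) ^ (\<Prod>k=K0..<K. n k) = (b h k * inverse (b (g \<otimes>\<^bsub>G\<^esub> h) k) *
        b g (h \<otimes>\<^bsub>G\<^esub> k) * inverse (b g h)) ^ (\<Prod>k=K0..<K. n k)"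
      unfolding Q_def .
  qed
qed

end

theorem theoremB:
  fixes G :: "('g, 'm) monoid_scheme"
    and \<omega> :: "'g \<times> 'g \<times> 'g \<Rightarrow> complex"
    and n :: "nat \<Rightarrow> nat"
    and A :: "'a::cstar_algebra set"
    and r :: nat
  assumes "group G"
    and "finite (carrier G)"
    and "\<omega> \<in> cocycles3 G"
    and "\<And>k. n k > 0"
    and "infinite_matrix_tensor_product n A"
    and "\<exists>\<theta> u. anomalous_action G \<omega> A \<theta> u"
    and "r = group.ord (H3 G) (cohomology_class3 G \<omega>)"
  shows "\<forall>m::nat. dvd_supernatural (r ^ m) n"
proof
  fix m :: nat
  obtain \<phi> where "unital_cstar_subalgebra A"
    "\<forall>K. unital_star_embedding (\<Prod>k<K. n k) A (\<phi> K)"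
    "\<forall>K. \<forall>X\<in>carrier_mat (\<Prod>k<K. n k) (\<Prod>k<K. n k). \<phi> (Suc K) (kronecker X (1\<^sub>m (n K))) = \<phi> K X"
    "closure (\<Union>K. \<phi> K ` carrier_mat (\<Prod>k<K. n k) (\<Prod>k<K. n k)) = A"
    using assms(5) unfolding infinite_matrix_tensor_product_def by blast
  then interpret matrix_tower n A \<phi>
    by unfold_locales (use assms(4) in auto)
  obtain \<theta> u where act: "anomalous_action G \<omega> A \<theta> u" using assms(6) by blast
  have step: "\<exists>K\<ge>K0. r dvd (\<Prod>k=K0..<K. n k)" for K0
  proof -
    obtain K b where "K \<ge> K0" "\<And>g h. b g h \<noteq> (0::complex)"
      "\<And>g h k. g \<in> carrier G \<Longrightarrow> h \<in> carrier G \<Longrightarrow> k \<in> carrier G \<Longrightarrow>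
        \<omega> (g, h, k) ^ (\<Prod>k=K0..<K. n k) =
        (b h k * inverse (b (g \<otimes>\<^bsub>G\<^esub> h) k) * b g (h \<otimes>\<^bsub>G\<^esub> k) * inverse (b g h)) ^ (\<Prod>k=K0..<K. n k)"
      using anomaly_power_coboundary[OF assms(1-3) act, of K0] by metis
    then have "r dvd (\<Prod>k=K0..<K. n k)"
      unfolding assms(7) by (intro ord_cohomology_class3_dvd[OF assms(1,3), of b])
    with \<open>K \<ge> K0\<close> show ?thesis by blast
  qed
  have "\<exists>K. r ^ m dvd msize K"
  proof (induction m)
    case (Suc m)
    then obtain K0 where K0: "r ^ m dvd msize K0" by blast
    obtain K where K: "K \<ge> K0" "r dvd (\<Prod>k=K0..<K. n k)" using step by blast
    have "r ^ m * r dvd msize K0 * (\<Prod>k=K0..<K. n k)" using K0 K(2) by (rule mult_dvd_mono)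
    then show ?case unfolding msize_split[OF K(1), symmetric] by (metis power_Suc2)
  qed simp
  then show "dvd_supernatural (r ^ m) n" by (simp add: dvd_supernatural_def)
qed

end
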